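(* There exists a numerical constant $C>0$ such that the following holds. Assume that $p\ge n$. For any integer $k\in\{1,\dots,p\}$, any $k$-sparse vector $\beta^*\in\mathbb{R}^p$ and any $\sigma>0$, the estimator $\widehat\eta^A$ satisfies $$\mathbb{E}\left[\left(\widehat\eta^A-\eta\right)^2\right]\le C\left[\frac1n+\left(\frac{k^2\log^2(p)}{n^2}\,\frac{\lambda_{\max}^2(\boldsymbol\Sigma)}{\lambda_{\min}^2(\boldsymbol\Sigma)}\right)\wedge\left(\frac{p\log(p)}{n^2}\right)\right].$$
   Context: Model: $Y=(y_1,\dots,y_n)^T=\mathbf{X}\beta^*+\epsilon$, where $\mathbf{X}\in\mathbb{R}^{n\times p}$ has i.i.d. rows with distribution $\mathcal{N}(0,\boldsymbol\Sigma)$, $\epsilon\sim\mathcal{N}(0,\sigma^2\mathbf{I}_n)$ is independent of $\mathbf{X}$, $\boldsymbol\Sigma$ is invertible, $\boldsymbol\Omega:=\boldsymbol\Sigma^{-1}$, $\sigma>0$. A vector is $k$-sparse if at most $k$ of its coordinates are nonzero. The proportion of explained variation is $\eta:=\frac{\beta^{*T}\boldsymbol\Sigma\beta^*}{\sigma^2+\beta^{*T}\boldsymbol\Sigma\beta^*}$. $\lambda_{\max},\lambda_{\min}$ are the largest and smallest eigenvalues; $a\wedge b=\min(a,b)$. Dense estimator: $\widehat\eta^D(\boldsymbol\Omega):=\frac{Y^T(\mathbf{X}\boldsymbol\Omega\mathbf{X}^T-\mathrm{tr}(\mathbf{X}\boldsymbol\Omega\mathbf{X}^T)\mathbf{I}_n/n)Y}{(n+1)\|Y\|_2^2}$,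 with truncated version $\widehat\eta^D_T(\boldsymbol\Omega):=\min(1,\max(0,\widehat\eta^D(\boldsymbol\Omega)))$. Square-root Lasso estimator: let $\mathbf{W}$ be the matrix whose $j$-th column is the $j$-th column of $\mathbf{X}$ divided by its Euclidean norm, $\lambda_0:=13\sqrt{\log p}$, and $\widetilde\beta_{SL}$ a minimizer over $\beta\in\mathbb{R}^p$ of $\|Y-\mathbf{W}\beta\|_2+\frac{\lambda_0}{\sqrt n}\|\beta\|_1$; then $\widehat\eta^{SL}:=1-\|Y-\mathbf{W}\widetilde\beta_{SL}\|_2^2/\|Y\|_2^2$. Constant $c_0$: let $C_1,C_2$ be numerical constants such that, whenever $p\ge n$, for every invertible $\boldsymbol\Sigma$, every $\beta^*$, every $\sigma>0$ and every $0\le t\le n^{1/3}$, the statistic $\widehat V:=\frac{Y^T(\mathbf{X}\mathbf{X}^T-\mathrm{tr}(\mathbf{X}\mathbf{X}^T)\mathbf{I}_n/n)Y}{(n+1)\|Y\|_2^2}$ satisfies $\mathbb{P}\big[|\widehat V-\beta^{*T}\boldsymbol\Sigma^2\beta^*/\mathrm{Var}(y_1)|\le C_1\|\boldsymbol\Sigma\|_{op}\sqrt{pt}/n\big]\ge1-C_2e^{-t}$ (such constants exist by another theorem of the paper). Set $c_0:=2C_1$. Adaptive estimator: $\widehat\eta^A:=\widehat\eta^{SL}$ if $|\widehat\eta^D_T(\boldsymbol\Omega)-\widehat\eta^{SL}|\le c_0\sqrt{p\log(p)}/n$, and $\widehat\eta^A:=\widehat\eta^D_T(\boldsymbol\Omega)$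 otherwise. *)

theory Defs
  imports
    "HOL-Probability.Probability"
    "Jordan_Normal_Form.Spectral_Radius"
    "Jordan_Normal_Form.Gauss_Jordan_Elimination"
begin

(* HOL-Analysis and Jordan_Normal_Form both claim these notations and names;
   throughout, matrices and vectors are those of Jordan_Normal_Form, whose
   dimensions are natural numbers that can be quantified inside a formula. *)
no_notation vec_nth (infixl "$" 90)
no_notation inner (infix "\<bullet>" 70)
hide_const (open) Finite_Cartesian_Product.vec Finite_Cartesian_Product.mat
  Determinants.det Finite_Cartesian_Product.transpose
hide_type (open) Finite_Cartesian_Product.vec

definition l2norm :: "real vec \<Rightarrow> real" where
  "l2norm v = sqrt (v \<bullet> v)"

definition l1norm :: "real vec \<Rightarrow> real" where
  "l1norm v = (\<Sum>j<dim_vec v. \<bar>v $ j\<bar>)"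

definition k_sparse :: "nat \<Rightarrow> real vec \<Rightarrow> bool" where
  "k_sparse k b \<longleftrightarrow> card {j. j < dim_vec b \<and> b $ j \<noteq> 0} \<le> k"

definition trace :: "real mat \<Rightarrow> real" where
  "trace A = (\<Sum>i<dim_row A. A $$ (i, i))"

definition op_norm :: "real mat \<Rightarrow> real" where
  "op_norm A = (SUP v\<in>{v \<in> carrier_vec (dim_col A). l2norm v \<le> 1}. l2norm (A *\<^sub>v v))"

(* Used for symmetric matrices only, whose spectrum is real, finite and nonempty. *)
definition lambda_max :: "real mat \<Rightarrow> real" where
  "lambda_max A = Max (spectrum A)"

definition lambda_min :: "real mat \<Rightarrow> real" where
  "lambda_min A = Min (spectrum A)"

definition covariance_matrix :: "nat \<Rightarrow> real mat \<Rightarrow> bool" where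
  "covariance_matrix p S \<longleftrightarrow> S \<in> carrier_mat p p \<and> transpose_mat S = S \<and>
     (\<forall>v \<in> carrier_vec p. 0 \<le> v \<bullet> (S *\<^sub>v v))"

(* The option value is Some whenever S is an invertible matrix. *)
definition precision :: "real mat \<Rightarrow> real mat" where
  "precision S = the (mat_inverse S)"

(* The centred Gaussian distribution N(0, S) on R^p for an invertible covariance
   matrix S, given by its density; a point of R^p is a function on the indices
   0, ..., p - 1. *)
definition gaussian_vector_law :: "nat \<Rightarrow> real mat \<Rightarrow> (nat \<Rightarrow> real) measure" where
  "gaussian_vector_law p S =
     density (Pi\<^sub>M {..<p} (\<lambda>_. lborel))
       (\<lambda>z. ennreal (exp (- (vec p z \<bullet> (precision S *\<^sub>v vec p z)) / 2)
                       / sqrt ((2 * pi) ^ p * det S)))"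

(* Joint law of (X, epsilon): the n rows of X are i.i.d. N(0, S), the n coordinates
   of epsilon are i.i.d. N(0, sigma^2) (normal_density takes the standard deviation),
   and X and epsilon are independent.  Every probability and expectation below depends
   on this law only, so it is taken as the underlying probability space. *)
definition model_law ::
    "nat \<Rightarrow> nat \<Rightarrow> real mat \<Rightarrow> real \<Rightarrow> ((nat \<Rightarrow> nat \<Rightarrow> real) \<times> (nat \<Rightarrow> real)) measure" where
  "model_law n p S \<sigma> =
     Pi\<^sub>M {..<n} (\<lambda>_. gaussian_vector_law p S)
       \<Otimes>\<^sub>M Pi\<^sub>M {..<n} (\<lambda>_. density lborel (\<lambda>u. ennreal (normal_density 0 \<sigma> u)))"

definition design :: "nat \<Rightarrow> nat \<Rightarrow> (nat \<Rightarrow> nat \<Rightarrow> real) \<Rightarrow> real mat" where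
  "design n p x = mat n p (\<lambda>(i, j). x i j)"

definition response ::
    "nat \<Rightarrow> nat \<Rightarrow> real vec \<Rightarrow> (nat \<Rightarrow> nat \<Rightarrow> real) \<times> (nat \<Rightarrow> real) \<Rightarrow> real vec" where
  "response n p b = (\<lambda>(x, e). design n p x *\<^sub>v b + vec n e)"

definition explained_variation :: "real mat \<Rightarrow> real vec \<Rightarrow> real \<Rightarrow> real" where
  "explained_variation S b \<sigma> = (b \<bullet> (S *\<^sub>v b)) / (\<sigma>\<^sup>2 + b \<bullet> (S *\<^sub>v b))"

(* (Y^T (K - tr(K) I_n / n) Y) / ((n + 1) |Y|_2^2) *)
definition centred_quadratic_ratio :: "real mat \<Rightarrow> real vec \<Rightarrow> real" where
  "centred_quadratic_ratio K Y =
     (let n = dim_vec Y in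
      (Y \<bullet> ((K - (trace K / real n) \<cdot>\<^sub>m 1\<^sub>m n) *\<^sub>v Y)) / (real (n + 1) * (l2norm Y)\<^sup>2))"

definition V_hat :: "real mat \<Rightarrow> real vec \<Rightarrow> real" where
  "V_hat X Y = centred_quadratic_ratio (X * transpose_mat X) Y"

definition eta_dense :: "real mat \<Rightarrow> real mat \<Rightarrow> real vec \<Rightarrow> real" where
  "eta_dense Om X Y = centred_quadratic_ratio (X * Om * transpose_mat X) Y"

definition eta_dense_trunc :: "real mat \<Rightarrow> real mat \<Rightarrow> real vec \<Rightarrow> real" where
  "eta_dense_trunc Om X Y = min 1 (max 0 (eta_dense Om X Y))"

definition normalized_design :: "real mat \<Rightarrow> real mat" where
  "normalized_design X =
     mat (dim_row X) (dim_col X) (\<lambda>(i, j). X $$ (i, j) / l2norm (col X j))"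

definition sqrt_lasso_objective :: "real mat \<Rightarrow> real vec \<Rightarrow> real vec \<Rightarrow> real" where
  "sqrt_lasso_objective X Y b =
     l2norm (Y - normalized_design X *\<^sub>v b)
       + (13 * sqrt (ln (real (dim_col X)))) / sqrt (real (dim_row X)) * l1norm b"

(* A square-root Lasso estimator, as a function of the data (X, Y): a minimizer of the
   objective for every data set.  Minimizers need not be unique, so the choice is a
   parameter; as any estimator it has to be a measurable function of the data
   (the Bochner integral of a non-measurable function would be 0). *)
definition sqrt_lasso_estimator ::
    "nat \<Rightarrow> nat \<Rightarrow> (real mat \<Rightarrow> real vec \<Rightarrow> real vec) \<Rightarrow> bool" where
  "sqrt_lasso_estimator n p sl \<longleftrightarrow>
     (\<forall>X \<in> carrier_mat n p. \<forall>Y \<in> carrier_vec n.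
        is_arg_min (sqrt_lasso_objective X Y) (\<lambda>b. b \<in> carrier_vec p) (sl X Y)) \<and>
     (\<forall>j<p. (\<lambda>(x, y). sl (design n p x) (vec n y) $ j)
        \<in> borel_measurable (Pi\<^sub>M {..<n} (\<lambda>_. Pi\<^sub>M {..<p} (\<lambda>_. borel))
                             \<Otimes>\<^sub>M Pi\<^sub>M {..<n} (\<lambda>_. borel)))"

definition eta_sqrt_lasso ::
    "(real mat \<Rightarrow> real vec \<Rightarrow> real vec) \<Rightarrow> real mat \<Rightarrow> real vec \<Rightarrow> real" where
  "eta_sqrt_lasso sl X Y =
     1 - (l2norm (Y - normalized_design X *\<^sub>v sl X Y))\<^sup>2 / (l2norm Y)\<^sup>2"

definition eta_adaptive ::
    "real \<Rightarrow> (real mat \<Rightarrow> real vec \<Rightarrow> real vec) \<Rightarrow> real mat \<Rightarrow> real mat \<Rightarrow> real vec \<Rightarrow> real" where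
  "eta_adaptive c0 sl Om X Y =
     (let p = real (dim_col X); n = real (dim_row X) in
      if \<bar>eta_dense_trunc Om X Y - eta_sqrt_lasso sl X Y\<bar> \<le> c0 * sqrt (p * ln p) / n
      then eta_sqrt_lasso sl X Y else eta_dense_trunc Om X Y)"

definition variance_on :: "'a measure \<Rightarrow> ('a \<Rightarrow> real) \<Rightarrow> real" where
  "variance_on M f = (\<integral>\<omega>. (f \<omega> - (\<integral>\<omega>'. f \<omega>' \<partial>M))\<^sup>2 \<partial>M)"

(* Numerical constants C1, C2 for which the deviation bound for V_hat holds uniformly
   over all sizes and parameters of the model.  Coordinate 0 of Y is y_1. *)
definition deviation_constants :: "real \<Rightarrow> real \<Rightarrow> bool" where
  "deviation_constants C1 C2 \<longleftrightarrow> 0 < C1 \<and> 0 < C2 \<and>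
     (\<forall>n p S b \<sigma> t.
        1 \<le> n \<longrightarrow> n \<le> p \<longrightarrow> covariance_matrix p S \<longrightarrow> invertible_mat S \<longrightarrow>
        b \<in> carrier_vec p \<longrightarrow> 0 < \<sigma> \<longrightarrow> 0 \<le> t \<longrightarrow> t \<le> real n powr (1 / 3) \<longrightarrow>
        1 - C2 * exp (- t) \<le>
          measure (model_law n p S \<sigma>)
            {\<omega> \<in> space (model_law n p S \<sigma>).
               \<bar>V_hat (design n p (fst \<omega>)) (response n p b \<omega>)
                  - (b \<bullet> ((S * S) *\<^sub>v b))
                    / variance_on (model_law n p S \<sigma>) (\<lambda>\<omega>'. response n p b \<omega>' $ 0)\<bar>
               \<le> C1 * op_norm S * sqrt (real p * t) / real n})"

end

theory Submission
  imports Defs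
begin

text \<open>
  The dense estimator is pulled back to the identity covariance by whitening: if \<open>S = L L^T\<close> is the
  Cholesky factorisation, then \<open>X = Z L^T\<close> with standard Gaussian \<open>Z\<close>, and \<open>X S^-1 X^T = Z Z^T\<close>.  Hence
  the assumed deviation bound, with \<open>t = ln p\<close>, puts it within \<open>r = C1 sqrt (p ln p) / n\<close> of the target
  outside an event of probability at most \<open>C2 / p\<close>.

  The square-root Lasso has error of order \<open>n^(-1/2) + k (lmax / lmin) ln p / n\<close>.  Its restricted
  eigenvalue condition follows from Maurey's empirical method: \<open>|X v|^2 >= n v^T S v / 4\<close> is required
  only for the finitely many normalised sums \<open>v\<close> of \<open>m\<close> signed coordinate vectors, where it is a
  chi-square tail bound, and then transfers to the whole cone once \<open>m\<close> is a multiple of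
  \<open>k lmax / lmin\<close>.

  On the good event the adaptive estimator is within \<open>2 r\<close> of the dense one, and it is never worse
  than the square-root Lasso, because it departs from the latter only if the latter is off by more
  than \<open>r\<close>.  As all errors are at most 1, the exceptional events cost \<open>O(1/n)\<close>.
\<close>

section \<open>Gaussian vectors as linear images of standard ones\<close>

text \<open>The assumed deviation bound carries the factor \<open>op_norm S\<close> and aims at
  \<open>b^T S^2 b / Var(y_1)\<close>. At the identity covariance with coefficient vector
  \<open>L^T b\<close> the factor is at most 1 and the target is the explained variation: that is
  what whitening buys. The bound allows only \<open>t\<close> up to \<open>n^(1/3)\<close>, so it
  cannot be used with \<open>t = ln p\<close> once \<open>ln p\<close> exceeds this; that range is
  settled by comparing sizes.

  For the Lasso the obstacle is uniformity over a cone. A union bound over \<open>(2 p)^m\<close>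
  grid points against \<open>exp (- n / 4)\<close> is affordable as long as \<open>m ln p\<close> is
  a small multiple of \<open>n\<close>, that is, as long as
  \<open>k (lmax / lmin) ln p <= n / 100000\<close>; beyond this the sparse rate is at least a
  constant and covers an error of at most 1. Maurey's method is run on the indefinite form
  \<open>X^T X - n S / 4\<close> itself, so only its sign on the grid is needed. The penalty
  constant 13 has to be large for one reason: with \<open>t = 13 sqrt (ln p) / 6\<close> the
  \<open>p\<close> noise tails \<open>2 exp (- t^2 / 2)\<close> must add up to at most
  \<open>2 / p\<close>.\<close>

abbreviation lebesgue_pow :: "nat \<Rightarrow> (nat \<Rightarrow> real) measure" where
  "lebesgue_pow p \<equiv> Pi\<^sub>M {..<p} (\<lambda>_. lborel)"

definition lin_map :: "nat \<Rightarrow> (nat \<Rightarrow> nat \<Rightarrow> real) \<Rightarrow> (nat \<Rightarrow> real) \<Rightarrow> nat \<Rightarrow> real" where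
  "lin_map p L z = (\<lambda>i\<in>{..<p}. \<Sum>j<p. L i j * z j)"

definition std_normal :: "real measure" where
  "std_normal = density lborel (\<lambda>x. ennreal (std_normal_density x))"

definition std_gauss :: "nat \<Rightarrow> (nat \<Rightarrow> real) measure" where
  "std_gauss p = Pi\<^sub>M {..<p} (\<lambda>_. std_normal)"

lemma prob_space_std_normal: "prob_space std_normal"
  unfolding std_normal_def by (rule prob_space_normal_density) simp

lemma sets_std_normal [measurable_cong, simp]: "sets std_normal = sets borel"
  by (simp add: std_normal_def)

lemma space_std_normal [simp]: "space std_normal = UNIV"
  by (simp add: std_normal_def)

lemma prob_space_std_gauss: "prob_space (std_gauss p)"
  unfolding std_gauss_def by (intro prob_space_PiM prob_space_std_normal)

lemma sets_std_gauss [measurable_cong, simp]: "sets (std_gauss p) = sets (Pi\<^sub>M {..<p} (\<lambda>_. borel))"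
  unfolding std_gauss_def by (rule sets_PiM_cong) simp_all

lemma sets_lebesgue_pow [measurable_cong]: "sets (lebesgue_pow p) = sets (Pi\<^sub>M {..<p} (\<lambda>_. borel))"
  by (rule sets_PiM_cong) simp_all

lemma lin_map_measurable [measurable]:
  "lin_map p L \<in> Pi\<^sub>M {..<p} (\<lambda>_. borel) \<rightarrow>\<^sub>M Pi\<^sub>M {..<p} (\<lambda>_. borel)"
  unfolding lin_map_def by (intro measurable_restrict borel_measurable_sum borel_measurable_times
     borel_measurable_const measurable_component_singleton) auto

text \<open>The last coordinate is peeled off: with the first \<open>p\<close> variables fixed it is
  an affine function of the new one, so the one-dimensional substitution rule and Fubini suffice,
  and the Jacobian appears as the product of the diagonal.\<close>

lemma nn_integral_triangular:
  assumes "f \<in> borel_measurable (Pi\<^sub>M {..<p} (\<lambda>_. borel))"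
    and "\<And>i. i < p \<Longrightarrow> 0 < L i i" and "\<And>i j. i < j \<Longrightarrow> j < p \<Longrightarrow> L i j = 0"
  shows "(\<integral>\<^sup>+x. f x \<partial>lebesgue_pow p) =
    ennreal (\<Prod>i<p. L i i) * (\<integral>\<^sup>+z. f (lin_map p L z) \<partial>lebesgue_pow p)"
  using assms
proof (induction p arbitrary: f)
  case 0
  interpret product_sigma_finite "\<lambda>_::nat. lborel :: real measure" by standard
  show ?case by (simp add: lin_map_def PiM_empty restrict_def nn_integral_count_space_finite)
next
  case (Suc p)
  interpret product_sigma_finite "\<lambda>_::nat. lborel :: real measure" by standard
  have ins: "{..<Suc p} = insert p {..<p}" by auto
  note [measurable] = Suc.prems(1)
  have upd [measurable]: "(\<lambda>(x, y). x(p := y)) \<in> Pi\<^sub>M {..<p} (\<lambda>_. borel) \<Otimes>\<^sub>M borel \<rightarrow>\<^sub>M Pi\<^sub>M {..<Suc p} (\<lambda>_. borel :: real measure)"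
    unfolding ins by (rule measurable_add_dim)
  define g where "g x = (\<integral>\<^sup>+y. f (x(p := y)) \<partial>lborel)" for x
  have fm: "(\<lambda>(x, y). f (x(p := y))) \<in> borel_measurable (Pi\<^sub>M {..<p} (\<lambda>_. borel) \<Otimes>\<^sub>M borel)"
    using measurable_compose[OF upd Suc.prems(1)] by (simp add: case_prod_unfold)
  have gm: "g \<in> borel_measurable (Pi\<^sub>M {..<p} (\<lambda>_. borel))"
    unfolding g_def using fm
    by (intro sigma_finite_measure.borel_measurable_nn_integral[OF sigma_finite_lborel])
       (simp cong: measurable_cong_sets)
  have fm': "(\<lambda>y. f (x(p := y))) \<in> borel_measurable borel" if "x \<in> space (Pi\<^sub>M {..<p} (\<lambda>_. borel :: real measure))" for x
    using measurable_compose[OF measurable_Pair1'[OF that] fm] by simp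
  \<comment> \<open>The zeros above the diagonal ensure that changing \<open>z p\<close> leaves the
    first \<open>p\<close> coordinates of the image alone.\<close>
  have lin: "(lin_map p L z)(p := (\<Sum>j<p. L p j * z j) + L p p * t) = lin_map (Suc p) L (z(p := t))" for z t
    using Suc.prems(3) by (auto simp: lin_map_def fun_eq_iff less_Suc_eq restrict_def)
  have "(\<integral>\<^sup>+x. f x \<partial>lebesgue_pow (Suc p)) = (\<integral>\<^sup>+x. g x \<partial>lebesgue_pow p)"
    unfolding ins g_def using Suc.prems(1)
    by (intro product_nn_integral_insert) (auto simp: ins cong: measurable_cong_sets sets_PiM_cong)
  also have "\<dots> = ennreal (\<Prod>i<p. L i i) * (\<integral>\<^sup>+z. g (lin_map p L z) \<partial>lebesgue_pow p)"
    by (rule Suc.IH[OF gm]) (use Suc.prems in auto)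
  also have "(\<integral>\<^sup>+z. g (lin_map p L z) \<partial>lebesgue_pow p)
     = (\<integral>\<^sup>+z. ennreal (L p p) * (\<integral>\<^sup>+t. f (lin_map (Suc p) L (z(p := t))) \<partial>lborel) \<partial>lebesgue_pow p)"
  proof (rule nn_integral_cong)
    fix z assume "z \<in> space (lebesgue_pow p)"
    have "lin_map p L z \<in> space (Pi\<^sub>M {..<p} (\<lambda>_. borel :: real measure))"
      by (auto simp: space_PiM lin_map_def)
    from nn_integral_real_affine[OF fm'[OF this], of "L p p" "\<Sum>j<p. L p j * z j"] Suc.prems(2)[of p]
    show "g (lin_map p L z) = ennreal (L p p) * (\<integral>\<^sup>+t. f (lin_map (Suc p) L (z(p := t))) \<partial>lborel)"
      by (simp add: g_def lin)
  qed
  also have "\<dots> = ennreal (L p p) * (\<integral>\<^sup>+z. (\<integral>\<^sup>+t. f (lin_map (Suc p) L (z(p := t))) \<partial>lborel) \<partial>lebesgue_pow p)"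
  proof (rule nn_integral_cmult)
    have "(\<lambda>(z, t). f (lin_map (Suc p) L (z(p := t)))) \<in> borel_measurable (Pi\<^sub>M {..<p} (\<lambda>_. borel) \<Otimes>\<^sub>M borel)"
      using measurable_compose[OF upd measurable_compose[OF lin_map_measurable Suc.prems(1)]] by (simp add: case_prod_unfold)
    then show "(\<lambda>z. \<integral>\<^sup>+t. f (lin_map (Suc p) L (z(p := t))) \<partial>lborel) \<in> borel_measurable (lebesgue_pow p)"
      by (intro sigma_finite_measure.borel_measurable_nn_integral[OF sigma_finite_lborel])
       (simp cong: measurable_cong_sets sets_PiM_cong)
  qed
  also have "(\<integral>\<^sup>+z. (\<integral>\<^sup>+t. f (lin_map (Suc p) L (z(p := t))) \<partial>lborel) \<partial>lebesgue_pow p)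
     = (\<integral>\<^sup>+z. f (lin_map (Suc p) L z) \<partial>lebesgue_pow (Suc p))"
    unfolding ins
    by (intro product_nn_integral_insert[symmetric]) (auto simp: ins[symmetric] cong: measurable_cong_sets sets_PiM_cong)
  finally show ?case
    using Suc.prems(2) by (simp add: mult.assoc, subst ennreal_mult)
      (auto intro!: prod_nonneg simp: less_imp_le mult.assoc)
qed

text \<open>Bridges two encodings of a Gaussian vector: the product of one-dimensional laws,
  convenient for independence, and a density on R^p, the form in which
  \<open>gaussian_vector_law\<close> is given. Agreement on rectangles is enough.\<close>

lemma std_gauss_density:
  "std_gauss p = density (lebesgue_pow p) (\<lambda>z. \<Prod>i<p. ennreal (std_normal_density (z i)))"
proof -
  interpret product_sigma_finite "\<lambda>_::nat. lborel :: real measure" by standard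
  interpret N: product_sigma_finite "\<lambda>_::nat. std_normal" 
    by (simp add: product_sigma_finite_def prob_space_imp_sigma_finite prob_space_std_normal)
  have "density (lebesgue_pow p) (\<lambda>z. \<Prod>i<p. ennreal (std_normal_density (z i))) = Pi\<^sub>M {..<p} (\<lambda>_. std_normal)"
  proof (rule N.PiM_eqI)
    show "sets (density (lebesgue_pow p) (\<lambda>z. \<Prod>i<p. ennreal (std_normal_density (z i)))) = sets (Pi\<^sub>M {..<p} (\<lambda>_. std_normal))"
      by (simp cong: sets_PiM_cong)
    fix A :: "nat \<Rightarrow> real set" assume A: "\<And>i. i \<in> {..<p} \<Longrightarrow> A i \<in> sets std_normal"
    have "emeasure (density (lebesgue_pow p) (\<lambda>z. \<Prod>i<p. ennreal (std_normal_density (z i)))) (Pi\<^sub>E {..<p} A)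
      = (\<integral>\<^sup>+z. (\<Prod>i<p. ennreal (std_normal_density (z i))) * indicator (Pi\<^sub>E {..<p} A) z \<partial>lebesgue_pow p)"
      using A by (intro emeasure_density) (auto intro!: sets_PiM_I_finite)
    also have "\<dots> = (\<integral>\<^sup>+z. (\<Prod>i<p. ennreal (std_normal_density (z i)) * indicator (A i) (z i)) \<partial>lebesgue_pow p)"
    proof (rule nn_integral_cong)
      fix z :: "nat \<Rightarrow> real" assume z: "z \<in> space (lebesgue_pow p)"
      show "(\<Prod>i<p. ennreal (std_normal_density (z i))) * indicator (Pi\<^sub>E {..<p} A) z =
        (\<Prod>i<p. ennreal (std_normal_density (z i)) * indicator (A i) (z i))"
      proof (cases "z \<in> Pi\<^sub>E {..<p} A")
        case True
        then show ?thesis by (auto intro!: prod.cong simp: PiE_def Pi_def)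
      next
        case False
        with z obtain i where "i < p" "z i \<notin> A i" by (auto simp: space_PiM PiE_def Pi_def)
        then have "(\<Prod>i<p. ennreal (std_normal_density (z i)) * indicator (A i) (z i)) = 0"
          by (intro prod_zero bexI[of _ i]) auto
        with False show ?thesis by simp
      qed
    qed
    also have "\<dots> = (\<Prod>i<p. \<integral>\<^sup>+y. ennreal (std_normal_density y) * indicator (A i) y \<partial>lborel)"
      using A by (intro product_nn_integral_prod) auto
    also have "\<dots> = (\<Prod>i<p. emeasure std_normal (A i))"
      using A by (intro prod.cong) (auto simp: std_normal_def emeasure_density)
    finally show "emeasure (density (lebesgue_pow p) (\<lambda>z. \<Prod>i<p. ennreal (std_normal_density (z i)))) (Pi\<^sub>E {..<p} A)
      = (\<Prod>i\<in>{..<p}. emeasure std_normal (A i))" .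
  qed auto
  then show ?thesis by (simp add: std_gauss_def)
qed

section \<open>Cholesky factors and the density of N(0, S)\<close>

lemma prod_std_normal_density:
  "(\<Prod>i<p. ennreal (std_normal_density (z i))) = ennreal (exp (- (\<Sum>i<p. (z i)\<^sup>2) / 2) / sqrt ((2 * pi) ^ p))"
proof -
  have "(\<Prod>i<p. ennreal (std_normal_density (z i))) = ennreal (\<Prod>i<p. std_normal_density (z i))"
    by (rule prod_ennreal) simp
  also have "(\<Prod>i<p. std_normal_density (z i)) = exp (- (\<Sum>i<p. (z i)\<^sup>2) / 2) / sqrt ((2 * pi) ^ p)"
    by (induction p) (auto simp: std_normal_density_def real_sqrt_mult exp_add[symmetric] field_simps)
  finally show ?thesis .
qed

text \<open>The factor is a function on indices instead of a matrix, so that rows can be added or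
  removed in inductions on \<open>p\<close>.\<close>

definition cholesky :: "nat \<Rightarrow> real mat \<Rightarrow> (nat \<Rightarrow> nat \<Rightarrow> real) \<Rightarrow> bool" where
  "cholesky p S L \<longleftrightarrow> S \<in> carrier_mat p p \<and> (\<forall>i<p. 0 < L i i) \<and> (\<forall>j<p. \<forall>i<j. L i j = 0) \<and>
     (\<forall>i<p. \<forall>j<p. S $$ (i, j) = (\<Sum>l<p. L i l * L j l))"

abbreviation lmat :: "nat \<Rightarrow> (nat \<Rightarrow> nat \<Rightarrow> real) \<Rightarrow> real mat" where
  "lmat p L \<equiv> mat p p (\<lambda>(i, j). L i j)"

lemma cholesky_mat: "cholesky p S L \<Longrightarrow> S = lmat p L * transpose_mat (lmat p L)"
  by (rule eq_matI) (auto simp: cholesky_def scalar_prod_def atLeast0LessThan)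

lemma cholesky_det_lmat:
  assumes "cholesky p S L" shows "det (lmat p L) = (\<Prod>i<p. L i i)"
proof -
  have "det (lmat p L) = prod_list (diag_mat (lmat p L))"
    using assms by (intro det_lower_triangular[where n = p]) (auto simp: cholesky_def)
  also have "\<dots> = (\<Prod>i<p. L i i)"
    unfolding diag_mat_def by (simp add: interv_sum_list_conv_sum_set_nat prod.distinct_set_conv_list[symmetric] atLeast0LessThan)
  finally show ?thesis .
qed

lemma cholesky_det:
  assumes "cholesky p S L" shows "det S = (\<Prod>i<p. L i i)\<^sup>2"
  using det_mult[of "lmat p L" p "transpose_mat (lmat p L)"] cholesky_mat[OF assms] 
    det_transpose[of "lmat p L" p] cholesky_det_lmat[OF assms]
  by (simp add: power2_eq_square)

lemma cholesky_prod_pos: "cholesky p S L \<Longrightarrow> 0 < (\<Prod>i<p. L i i)"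
  by (intro prod_pos) (auto simp: cholesky_def)

lemma precision_inverse:
  assumes "S \<in> carrier_mat p p" "det S \<noteq> 0"
  shows "precision S \<in> carrier_mat p p" "S * precision S = 1\<^sub>m p" "precision S * S = 1\<^sub>m p"
proof -
  have "S \<in> Units (ring_mat TYPE(real) p ())"
    using assms by (rule det_non_zero_imp_unit)
  then obtain B where B: "mat_inverse S = Some B"
    using mat_inverse(1)[OF assms(1), where b = "()"] by (cases "mat_inverse S") auto
  from mat_inverse(2)[OF assms(1) B]
  show "precision S \<in> carrier_mat p p" "S * precision S = 1\<^sub>m p" "precision S * S = 1\<^sub>m p"
    by (simp_all add: precision_def B)
qed

text \<open>Since \<open>S = L L^T\<close>, multiplying the claimed identity by \<open>L\<close>
  from the left gives \<open>S S^-1 L = L\<close>; the invertible \<open>L\<close> is then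
  cancelled.\<close>

lemma cholesky_precision:
  assumes "cholesky p S L"
  shows "transpose_mat (lmat p L) * (precision S * lmat p L) = 1\<^sub>m p"
    "precision S \<in> carrier_mat p p"
proof -
  let ?L = "lmat p L" and ?T = "transpose_mat (lmat p L)"
  have S: "S \<in> carrier_mat p p" using assms by (simp add: cholesky_def)
  have d: "det S \<noteq> 0"
    unfolding cholesky_det[OF assms] by (rule less_imp_neq[OF zero_less_power[OF cholesky_prod_pos[OF assms]], symmetric])
  note pr = precision_inverse[OF S d]
  show c: "precision S \<in> carrier_mat p p" by (rule pr)
  have L: "?L \<in> carrier_mat p p" "?T \<in> carrier_mat p p" by simp_all
  have "det ?L \<noteq> 0"
    unfolding cholesky_det_lmat[OF assms] by (rule less_imp_neq[OF cholesky_prod_pos[OF assms], symmetric])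
  from precision_inverse[OF L(1) this] obtain K where K: "K \<in> carrier_mat p p" "K * ?L = 1\<^sub>m p"
    by blast
  have T: "?T * (precision S * ?L) \<in> carrier_mat p p"
    by (rule mult_carrier_mat[OF L(2) mult_carrier_mat[OF c L(1)]])
  have "?L * (?T * (precision S * ?L)) = (?L * ?T) * (precision S * ?L)"
    by (rule assoc_mult_mat[OF L mult_carrier_mat[OF c L(1)], symmetric])
  also have "\<dots> = ((?L * ?T) * precision S) * ?L"
    by (rule assoc_mult_mat[OF mult_carrier_mat[OF L] c L(1), symmetric])
  also have "(?L * ?T) * precision S = 1\<^sub>m p"
    by (simp only: cholesky_mat[OF assms, symmetric] pr(2))
  also have "1\<^sub>m p * ?L = ?L" by (rule left_mult_one_mat[OF L(1)])
  finally have eq: "?L * (?T * (precision S * ?L)) = ?L" .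
  have "?T * (precision S * ?L) = (K * ?L) * (?T * (precision S * ?L))"
    unfolding K(2) by (rule left_mult_one_mat[OF T, symmetric])
  also have "\<dots> = K * (?L * (?T * (precision S * ?L)))"
    by (rule assoc_mult_mat[OF K(1) L(1) T])
  also have "\<dots> = 1\<^sub>m p" unfolding eq K(2) ..
  finally show "?T * (precision S * ?L) = 1\<^sub>m p" .
qed

lemma vec_lin_map: "vec p (lin_map p L z) = lmat p L *\<^sub>v vec p z"
  by (rule eq_vecI) (auto simp: lin_map_def scalar_prod_def atLeast0LessThan)

lemma cholesky_precision_form:
  assumes "cholesky p S L"
  shows "vec p (lin_map p L z) \<bullet> (precision S *\<^sub>v vec p (lin_map p L z)) = (\<Sum>i<p. (z i)\<^sup>2)"
proof -
  let ?L = "lmat p L" and ?T = "transpose_mat (lmat p L)"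
  note c = cholesky_precision[OF assms]
  have L: "?L \<in> carrier_mat p p" "?T \<in> carrier_mat p p" by simp_all
  have z: "vec p z \<in> carrier_vec p" by simp
  have "(?L *\<^sub>v vec p z) \<bullet> (precision S *\<^sub>v (?L *\<^sub>v vec p z)) = vec p z \<bullet> (?T *\<^sub>v (precision S *\<^sub>v (?L *\<^sub>v vec p z)))"
  proof -
    let ?w = "precision S *\<^sub>v (?L *\<^sub>v vec p z)"
    have w: "?w \<in> carrier_vec p" by (rule mult_mat_vec_carrier[OF c(2) mult_mat_vec_carrier[OF L(1) z]])
    have "(?T *\<^sub>v ?w) \<bullet> vec p z = ?w \<bullet> (?L *\<^sub>v vec p z)"
      by (rule transpose_vec_mult_scalar[OF L(1) z w])
    moreover have "(?T *\<^sub>v ?w) \<bullet> vec p z = vec p z \<bullet> (?T *\<^sub>v ?w)"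
      by (rule comm_scalar_prod[of _ p]) (simp_all add: mult_mat_vec_carrier[OF L(2) w])
    moreover have "?w \<bullet> (?L *\<^sub>v vec p z) = (?L *\<^sub>v vec p z) \<bullet> ?w"
      by (rule comm_scalar_prod[of _ p]) (simp_all add: w mult_mat_vec_carrier[OF L(1) z])
    ultimately show ?thesis by (simp only:)
  qed
  also have "?T *\<^sub>v (precision S *\<^sub>v (?L *\<^sub>v vec p z)) = (?T * (precision S * ?L)) *\<^sub>v vec p z"
    by (simp only: assoc_mult_mat_vec[OF c(2) L(1) z] assoc_mult_mat_vec[OF L(2) mult_carrier_mat[OF c(2) L(1)] z])
  also have "\<dots> = vec p z" unfolding c(1) by (rule one_mult_mat_vec[OF z])
  finally show ?thesis
    by (simp add: vec_lin_map scalar_prod_def atLeast0LessThan power2_eq_square)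
qed

lemma sets_gaussian_vector_law [measurable_cong, simp]:
  "sets (gaussian_vector_law p S) = sets (Pi\<^sub>M {..<p} (\<lambda>_. borel))"
  unfolding gaussian_vector_law_def by (simp cong: sets_PiM_cong)

lemma gaussian_law_measurable:
  assumes "precision S \<in> carrier_mat p p"
  shows "(\<lambda>z. vec p z \<bullet> (precision S *\<^sub>v vec p z)) \<in> borel_measurable (Pi\<^sub>M {..<p} (\<lambda>_. borel))"
proof -
  have "vec p z \<bullet> (precision S *\<^sub>v vec p z) = (\<Sum>i<p. z i * (\<Sum>j<p. precision S $$ (i, j) * z j))" for z
    using assms by (auto simp: scalar_prod_def atLeast0LessThan mult_mat_vec_def)
  then show ?thesis
    by simp
qed

text \<open>The substitution turns the exponent into a sum of squares, and the Jacobian cancels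
  \<open>sqrt (det S)\<close>, as both equal the product of the diagonal of
  \<open>L\<close>.\<close>

lemma gaussian_vector_law_eq_distr:
  assumes "cholesky p S L"
  shows "gaussian_vector_law p S = distr (std_gauss p) (Pi\<^sub>M {..<p} (\<lambda>_. borel)) (lin_map p L)"
proof (rule measure_eqI)
  fix A assume "A \<in> sets (gaussian_vector_law p S)"
  then have A [measurable]: "A \<in> sets (Pi\<^sub>M {..<p} (\<lambda>_. borel))" by simp
  note [measurable] = gaussian_law_measurable[OF cholesky_precision(2)[OF assms]]
  let ?D = "\<Prod>i<p. L i i"
  let ?q = "\<lambda>z. vec p z \<bullet> (precision S *\<^sub>v vec p z)"
  let ?d = "\<lambda>z. ennreal (exp (- ?q z / 2) / sqrt ((2 * pi) ^ p * det S))"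
  have D: "?D > 0" by (rule cholesky_prod_pos[OF assms])
  have "space (std_gauss p) = space (Pi\<^sub>M {..<p} (\<lambda>_. borel))"
    by (rule sets_eq_imp_space_eq) simp
  then have lin_vimage: "lin_map p L -` A \<inter> space (std_gauss p) \<in> sets (lebesgue_pow p)"
    using measurable_sets[OF lin_map_measurable A, of L] by (simp cong: sets_PiM_cong)
  have "d * (e / sqrt (c * d\<^sup>2)) = e / sqrt c" if "d > 0" for c d e :: real
    using that by (simp add: real_sqrt_mult)
  note dens = this[OF D]
  have "emeasure (gaussian_vector_law p S) A = (\<integral>\<^sup>+z. ?d z * indicator A z \<partial>lebesgue_pow p)"
    unfolding gaussian_vector_law_def by (intro emeasure_density) (simp_all cong: measurable_cong_sets sets_PiM_cong)
  also have "\<dots> = ennreal ?D * (\<integral>\<^sup>+z. ?d (lin_map p L z) * indicator A (lin_map p L z) \<partial>lebesgue_pow p)"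
    using assms by (intro nn_integral_triangular) (auto simp: cholesky_def)
  also have "\<dots> = (\<integral>\<^sup>+z. ennreal ?D * (?d (lin_map p L z) * indicator A (lin_map p L z)) \<partial>lebesgue_pow p)"
    by (rule nn_integral_cmult[symmetric]) measurable
  also have "\<dots> = (\<integral>\<^sup>+z. (\<Prod>i<p. ennreal (std_normal_density (z i))) * indicator (lin_map p L -` A \<inter> space (std_gauss p)) z \<partial>lebesgue_pow p)"
  proof (rule nn_integral_cong)
    fix z assume z: "z \<in> space (lebesgue_pow p)"
    have "ennreal ?D * ?d (lin_map p L z) = (\<Prod>i<p. ennreal (std_normal_density (z i)))"
      unfolding cholesky_precision_form[OF assms] cholesky_det[OF assms] prod_std_normal_density
      by (subst ennreal_mult'[OF less_imp_le[OF D], symmetric]) (simp only: dens)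
    note d = this
    have i: "indicator A (lin_map p L z) = (indicator (lin_map p L -` A \<inter> space (std_gauss p)) z :: ennreal)"
      using z by (simp add: std_gauss_def space_PiM indicator_def)
    show "ennreal ?D * (?d (lin_map p L z) * indicator A (lin_map p L z)) =
      (\<Prod>i<p. ennreal (std_normal_density (z i))) * indicator (lin_map p L -` A \<inter> space (std_gauss p)) z"
      by (simp only: mult.assoc[symmetric] d i)
  qed
  also have "\<dots> = emeasure (density (lebesgue_pow p) (\<lambda>z. \<Prod>i<p. ennreal (std_normal_density (z i)))) (lin_map p L -` A \<inter> space (std_gauss p))"
    by (rule emeasure_density[symmetric, OF _ lin_vimage]) measurable
  also have "\<dots> = emeasure (distr (std_gauss p) (Pi\<^sub>M {..<p} (\<lambda>_. borel)) (lin_map p L)) A"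
    unfolding std_gauss_density[symmetric] by (rule emeasure_distr[symmetric]) measurable
  finally show "emeasure (gaussian_vector_law p S) A = emeasure (distr (std_gauss p) (Pi\<^sub>M {..<p} (\<lambda>_. borel)) (lin_map p L)) A" .
qed simp

section \<open>Integrals against the standard normal law\<close>

lemma normal_density_scale:
  assumes "0 < a" shows "a * normal_density 0 a (a * x) = std_normal_density x"
  using assms by (simp add: normal_density_def power_mult_distrib real_sqrt_mult field_simps)

lemma nn_integral_normal_scale:
  assumes [measurable]: "f \<in> borel_measurable borel" and a: "0 < a"
  shows "(\<integral>\<^sup>+x. f x \<partial>density lborel (\<lambda>x. ennreal (normal_density 0 a x))) = (\<integral>\<^sup>+x. f (a * x) \<partial>std_normal)"
proof -
  have "(\<integral>\<^sup>+x. f x \<partial>density lborel (\<lambda>x. ennreal (normal_density 0 a x)))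
      = (\<integral>\<^sup>+x. ennreal (normal_density 0 a x) * f x \<partial>lborel)"
    by (rule nn_integral_density) simp_all
  also have "\<dots> = ennreal \<bar>a\<bar> * (\<integral>\<^sup>+x. ennreal (normal_density 0 a (0 + a * x)) * f (0 + a * x) \<partial>lborel)"
    using a by (intro nn_integral_real_affine) auto
  also have "\<dots> = (\<integral>\<^sup>+x. ennreal a * (ennreal (normal_density 0 a (a * x)) * f (a * x)) \<partial>lborel)"
    using a by (simp add: nn_integral_cmult)
  also have "\<dots> = (\<integral>\<^sup>+x. ennreal (std_normal_density x) * f (a * x) \<partial>lborel)"
    using a by (simp add: mult.assoc[symmetric] ennreal_mult'[symmetric] normal_density_scale)
  also have "\<dots> = (\<integral>\<^sup>+x. f (a * x) \<partial>std_normal)"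
    unfolding std_normal_def by (rule nn_integral_density[symmetric]) simp_all
  finally show ?thesis .
qed

text \<open>Symmetry of the normal law. It serves to remove signs, because the convolution formula
  for normal densities requires positive standard deviations.\<close>

lemma nn_integral_std_normal_abs:
  assumes [measurable]: "f \<in> borel_measurable borel"
  shows "(\<integral>\<^sup>+x. f (a * x) \<partial>std_normal) = (\<integral>\<^sup>+x. f (\<bar>a\<bar> * x) \<partial>std_normal)"
proof (cases "0 \<le> a")
  case False
  have "(\<integral>\<^sup>+x. f (a * x) \<partial>std_normal) = (\<integral>\<^sup>+x. ennreal (std_normal_density x) * f (a * x) \<partial>lborel)"
    unfolding std_normal_def by (rule nn_integral_density) simp_all
  also have "\<dots> = ennreal \<bar>-1\<bar> * (\<integral>\<^sup>+x. ennreal (std_normal_density (0 + -1 * x)) * f (a * (0 + -1 * x)) \<partial>lborel)"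
    by (intro nn_integral_real_affine) auto
  also have "\<dots> = (\<integral>\<^sup>+x. ennreal (std_normal_density x) * f (\<bar>a\<bar> * x) \<partial>lborel)"
    using False by (simp add: std_normal_density_def)
  also have "\<dots> = (\<integral>\<^sup>+x. f (\<bar>a\<bar> * x) \<partial>std_normal)"
    unfolding std_normal_def by (rule nn_integral_density[symmetric]) simp_all
  finally show ?thesis .
qed simp

lemma emeasure_std_normal_UNIV [simp]: "emeasure std_normal UNIV = 1"
  using prob_space.emeasure_space_1[OF prob_space_std_normal] by simp

text \<open>For positive \<open>a\<close> and \<open>b\<close> this is the convolution of two
  centred normal densities. Signs are removed by symmetry, and a zero coefficient is treated apart
  because that summand has no density. Working with nonnegative integrals avoids integrability
  questions.\<close>

lemma nn_integral_std_normal_add: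
  assumes [measurable]: "f \<in> borel_measurable borel"
  shows "(\<integral>\<^sup>+x. \<integral>\<^sup>+y. f (a * x + b * y) \<partial>std_normal \<partial>std_normal) = (\<integral>\<^sup>+x. f (sqrt (a\<^sup>2 + b\<^sup>2) * x) \<partial>std_normal)"
proof -
  have pos: "(\<integral>\<^sup>+x. \<integral>\<^sup>+y. f (a * x + b * y) \<partial>std_normal \<partial>std_normal) = (\<integral>\<^sup>+x. f (sqrt (a\<^sup>2 + b\<^sup>2) * x) \<partial>std_normal)"
    if a: "0 < a" and b: "0 < b" for a b :: real
  proof -
    have [measurable]: "(\<lambda>u. \<integral>\<^sup>+y. f (u + b * y) \<partial>std_normal) \<in> borel_measurable borel"
      using prob_space_imp_sigma_finite[OF prob_space_std_normal]
      by (intro sigma_finite_measure.borel_measurable_nn_integral) measurable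
    have "(\<integral>\<^sup>+x. \<integral>\<^sup>+y. f (a * x + b * y) \<partial>std_normal \<partial>std_normal)
      = (\<integral>\<^sup>+u. \<integral>\<^sup>+y. f (u + b * y) \<partial>std_normal \<partial>density lborel (\<lambda>x. ennreal (normal_density 0 a x)))"
      by (rule nn_integral_normal_scale[OF _ a, symmetric]) measurable
    also have "\<dots> = (\<integral>\<^sup>+u. ennreal (normal_density 0 a u) * (\<integral>\<^sup>+y. f (u + b * y) \<partial>std_normal) \<partial>lborel)"
      by (rule nn_integral_density) simp_all
    also have "\<dots> = (\<integral>\<^sup>+u. (\<integral>\<^sup>+t. ennreal (normal_density 0 b (t - u) * normal_density 0 a u) * f t \<partial>lborel) \<partial>lborel)"
    proof (rule nn_integral_cong)
      fix u :: real
      have "(\<integral>\<^sup>+y. f (u + b * y) \<partial>std_normal) = (\<integral>\<^sup>+v. f (u + v) \<partial>density lborel (\<lambda>x. ennreal (normal_density 0 b x)))"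
        by (rule nn_integral_normal_scale[OF _ b, symmetric]) measurable
      also have "\<dots> = (\<integral>\<^sup>+v. ennreal (normal_density 0 b v) * f (u + v) \<partial>lborel)"
        by (rule nn_integral_density) simp_all
      also have "\<dots> = ennreal \<bar>1\<bar> * (\<integral>\<^sup>+t. ennreal (normal_density 0 b (- u + 1 * t)) * f (u + (- u + 1 * t)) \<partial>lborel)"
        by (rule nn_integral_real_affine) auto
      also have "\<dots> = (\<integral>\<^sup>+t. ennreal (normal_density 0 b (t - u)) * f t \<partial>lborel)" by simp
      finally have "ennreal (normal_density 0 a u) * (\<integral>\<^sup>+y. f (u + b * y) \<partial>std_normal) = 
        (\<integral>\<^sup>+t. ennreal (normal_density 0 a u) * (ennreal (normal_density 0 b (t - u)) * f t) \<partial>lborel)"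
        by (simp add: nn_integral_cmult)
      then show "ennreal (normal_density 0 a u) * (\<integral>\<^sup>+y. f (u + b * y) \<partial>std_normal) =
         (\<integral>\<^sup>+t. ennreal (normal_density 0 b (t - u) * normal_density 0 a u) * f t \<partial>lborel)"
        by (simp add: ennreal_mult mult_ac)
    qed
    also have "\<dots> = (\<integral>\<^sup>+t. (\<integral>\<^sup>+u. ennreal (normal_density 0 b (t - u) * normal_density 0 a u) * f t \<partial>lborel) \<partial>lborel)"
      by (rule lborel_pair.Fubini') measurable
    also have "\<dots> = (\<integral>\<^sup>+t. ennreal (normal_density 0 (sqrt (b\<^sup>2 + a\<^sup>2)) t) * f t \<partial>lborel)"
      using fun_cong[OF conv_normal_density_zero_mean[OF b a]] by (simp add: nn_integral_multc)
    also have "\<dots> = (\<integral>\<^sup>+t. f t \<partial>density lborel (\<lambda>t. ennreal (normal_density 0 (sqrt (a\<^sup>2 + b\<^sup>2)) t)))"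
      by (subst nn_integral_density) (simp_all add: add.commute)
    also have "\<dots> = (\<integral>\<^sup>+x. f (sqrt (a\<^sup>2 + b\<^sup>2) * x) \<partial>std_normal)"
      using a b by (intro nn_integral_normal_scale) (auto simp: add_pos_pos)
    finally show ?thesis .
  qed
  have abs: "(\<integral>\<^sup>+x. \<integral>\<^sup>+y. f (a * x + b * y) \<partial>std_normal \<partial>std_normal) = (\<integral>\<^sup>+x. \<integral>\<^sup>+y. f (\<bar>a\<bar> * x + \<bar>b\<bar> * y) \<partial>std_normal \<partial>std_normal)"
  proof -
    have "(\<integral>\<^sup>+y. f (u + b * y) \<partial>std_normal) = (\<integral>\<^sup>+y. f (u + \<bar>b\<bar> * y) \<partial>std_normal)" for u
      by (rule nn_integral_std_normal_abs) measurable
    moreover have "(\<integral>\<^sup>+x. \<integral>\<^sup>+y. f (a * x + \<bar>b\<bar> * y) \<partial>std_normal \<partial>std_normal) = (\<integral>\<^sup>+x. \<integral>\<^sup>+y. f (\<bar>a\<bar> * x + \<bar>b\<bar> * y) \<partial>std_normal \<partial>std_normal)"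
    proof (rule nn_integral_std_normal_abs)
      show "(\<lambda>u. \<integral>\<^sup>+y. f (u + \<bar>b\<bar> * y) \<partial>std_normal) \<in> borel_measurable borel"
        using prob_space_imp_sigma_finite[OF prob_space_std_normal]
        by (intro sigma_finite_measure.borel_measurable_nn_integral) measurable
    qed
    ultimately show ?thesis by simp
  qed
  consider "a = 0" | "b = 0" | "a \<noteq> 0" "b \<noteq> 0" by auto
  then show ?thesis
  proof cases
    case 1 then show ?thesis using nn_integral_std_normal_abs[OF assms, of b] by simp
  next
    case 2 then show ?thesis using nn_integral_std_normal_abs[OF assms, of a] by simp
  next
    case 3 then show ?thesis unfolding abs by (subst pos) auto
  qed
qed

text \<open>Coordinates are merged one at a time: by induction the partial sum behaves like a single
  normal variable, to which the two-variable case adds the next term.\<close>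

lemma nn_integral_std_gauss_linear:
  assumes "f \<in> borel_measurable borel"
  shows "(\<integral>\<^sup>+z. f (\<Sum>j<p. w j * z j) \<partial>std_gauss p) = (\<integral>\<^sup>+x. f (sqrt (\<Sum>j<p. (w j)\<^sup>2) * x) \<partial>std_normal)"
  using assms
proof (induction p arbitrary: f)
  case 0
  then show ?case
    using prob_space.emeasure_space_1[OF prob_space_std_gauss, of 0] by simp
next
  case (Suc p)
  note [measurable] = Suc.prems
  interpret product_sigma_finite "\<lambda>_::nat. std_normal"
    by (simp add: product_sigma_finite_def prob_space_imp_sigma_finite prob_space_std_normal)
  have ins: "{..<Suc p} = insert p {..<p}" by auto
  have [measurable]: "(\<lambda>u. \<integral>\<^sup>+y. f (u + w p * y) \<partial>std_normal) \<in> borel_measurable borel"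
    using prob_space_imp_sigma_finite[OF prob_space_std_normal]
    by (intro sigma_finite_measure.borel_measurable_nn_integral) measurable
  have "(\<integral>\<^sup>+z. f (\<Sum>j<Suc p. w j * z j) \<partial>std_gauss (Suc p)) =
     (\<integral>\<^sup>+x. \<integral>\<^sup>+y. f (\<Sum>j<Suc p. w j * (x(p := y)) j) \<partial>std_normal \<partial>std_gauss p)"
    unfolding std_gauss_def ins
  proof (rule product_nn_integral_insert)
    show "(\<lambda>z. f (\<Sum>j\<in>insert p {..<p}. w j * z j)) \<in> borel_measurable (Pi\<^sub>M (insert p {..<p}) (\<lambda>i. std_normal))"
      by measurable
  qed auto
  also have "\<dots> = (\<integral>\<^sup>+x. \<integral>\<^sup>+y. f ((\<Sum>j<p. w j * x j) + w p * y) \<partial>std_normal \<partial>std_gauss p)"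
    by (intro nn_integral_cong arg_cong[of _ _ f]) simp
  also have "\<dots> = (\<integral>\<^sup>+x. \<integral>\<^sup>+y. f (sqrt (\<Sum>j<p. (w j)\<^sup>2) * x + w p * y) \<partial>std_normal \<partial>std_normal)"
    by (rule Suc.IH) measurable
  also have "\<dots> = (\<integral>\<^sup>+x. f (sqrt (\<Sum>j<Suc p. (w j)\<^sup>2) * x) \<partial>std_normal)"
    by (subst nn_integral_std_normal_add) (simp_all add: sum_nonneg)
  finally show ?case .
qed

text \<open>Tilting the standard normal density by \<open>exp (t x^2)\<close> gives \<open>r\<close>
  times the centred normal density with standard deviation \<open>r = 1 / sqrt (1 - 2 t)\<close>.
  This is the moment generating function of a chi-square variable with one degree of
  freedom.\<close>

lemma nn_integral_std_normal_exp_square: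
  assumes t: "t < 1 / 2"
  shows "(\<integral>\<^sup>+x. ennreal (exp (t * x\<^sup>2)) \<partial>std_normal) = ennreal (1 / sqrt (1 - 2 * t))"
proof -
  define r where "r = 1 / sqrt (1 - 2 * t)"
  have r: "r > 0" using t by (simp add: r_def)
  have r2: "1 / r\<^sup>2 = 1 - 2 * t" using t by (simp add: r_def power_divide)
  have eq: "std_normal_density x * exp (t * x\<^sup>2) = r * normal_density 0 r x" for x
  proof -
    have "- x\<^sup>2 / 2 + t * x\<^sup>2 = - (1 / r\<^sup>2) * x\<^sup>2 / 2" unfolding r2 by (simp add: field_simps)
    then have "exp (- x\<^sup>2 / 2) * exp (t * x\<^sup>2) = exp (- x\<^sup>2 / (2 * r\<^sup>2))"
      unfolding exp_add[symmetric] by (simp add: field_simps)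
    then show ?thesis using r
      by (simp add: std_normal_density_def normal_density_def real_sqrt_mult field_simps)
  qed
  have "(\<integral>\<^sup>+x. ennreal (exp (t * x\<^sup>2)) \<partial>std_normal) = (\<integral>\<^sup>+x. ennreal (std_normal_density x) * ennreal (exp (t * x\<^sup>2)) \<partial>lborel)"
    unfolding std_normal_def by (rule nn_integral_density) simp_all
  also have "\<dots> = (\<integral>\<^sup>+x. ennreal r * ennreal (normal_density 0 r x) \<partial>lborel)"
    using r by (simp add: ennreal_mult'[symmetric] eq)
  also have "\<dots> = ennreal r * (\<integral>\<^sup>+x. ennreal (normal_density 0 r x) \<partial>lborel)"
    by (rule nn_integral_cmult) simp
  also have "(\<integral>\<^sup>+x. ennreal (normal_density 0 r x) \<partial>lborel) = 1"
    using prob_space.emeasure_space_1[OF prob_space_normal_density[OF r, of 0]] by (simp add: emeasure_density)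
  finally show ?thesis by (simp add: r_def)
qed

lemma nn_integral_std_normal_exp:
  "(\<integral>\<^sup>+x. ennreal (exp (s * x)) \<partial>std_normal) = ennreal (exp (s\<^sup>2 / 2))"
proof -
  have eq: "std_normal_density x * exp (s * x) = exp (s\<^sup>2 / 2) * normal_density s 1 x" for x
  proof -
    have "exp (- x\<^sup>2 / 2) * exp (s * x) = exp (s\<^sup>2 / 2) * exp (- (x - s)\<^sup>2 / 2)"
      unfolding exp_add[symmetric] by (simp add: power2_eq_square field_simps)
    then show ?thesis by (simp add: std_normal_density_def normal_density_def field_simps)
  qed
  have "(\<integral>\<^sup>+x. ennreal (exp (s * x)) \<partial>std_normal) = (\<integral>\<^sup>+x. ennreal (std_normal_density x) * ennreal (exp (s * x)) \<partial>lborel)"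
    unfolding std_normal_def by (rule nn_integral_density) simp_all
  also have "\<dots> = (\<integral>\<^sup>+x. ennreal (exp (s\<^sup>2 / 2)) * ennreal (normal_density s 1 x) \<partial>lborel)"
    by (simp add: ennreal_mult'[symmetric] eq)
  also have "\<dots> = ennreal (exp (s\<^sup>2 / 2)) * (\<integral>\<^sup>+x. ennreal (normal_density s 1 x) \<partial>lborel)"
    by (rule nn_integral_cmult) simp
  also have "(\<integral>\<^sup>+x. ennreal (normal_density s 1 x) \<partial>lborel) = 1"
    using prob_space.emeasure_space_1[OF prob_space_normal_density[of 1 s]] by (simp add: emeasure_density)
  finally show ?thesis by simp
qed

section \<open>Quadratic functionals of the model\<close>

abbreviation lin_form :: "nat \<Rightarrow> (nat \<Rightarrow> real) \<Rightarrow> (nat \<Rightarrow> real) \<Rightarrow> real" where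
  "lin_form p \<theta> x \<equiv> \<Sum>j<p. \<theta> j * x j"

definition quad_form :: "nat \<Rightarrow> real mat \<Rightarrow> (nat \<Rightarrow> real) \<Rightarrow> real" where
  "quad_form p S \<theta> = (\<Sum>i<p. \<Sum>j<p. \<theta> i * \<theta> j * S $$ (i, j))"

abbreviation data_space :: "nat \<Rightarrow> nat \<Rightarrow> ((nat \<Rightarrow> nat \<Rightarrow> real) \<times> (nat \<Rightarrow> real)) measure" where
  "data_space n p \<equiv> Pi\<^sub>M {..<n} (\<lambda>_. Pi\<^sub>M {..<p} (\<lambda>_. borel)) \<Otimes>\<^sub>M Pi\<^sub>M {..<n} (\<lambda>_. borel)"

abbreviation noise_law :: "real \<Rightarrow> real measure" where
  "noise_law \<sigma> \<equiv> density lborel (\<lambda>u. ennreal (normal_density 0 \<sigma> u))"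

lemma cholesky_quad_form:
  assumes "cholesky p S L"
  shows "(\<Sum>l<p. (\<Sum>j<p. \<theta> j * L j l)\<^sup>2) = quad_form p S \<theta>"
proof -
  have "(\<Sum>l<p. (\<Sum>j<p. \<theta> j * L j l)\<^sup>2) = (\<Sum>l<p. \<Sum>i<p. \<Sum>j<p. \<theta> i * \<theta> j * (L i l * L j l))"
    by (simp add: power2_eq_square sum_product mult_ac)
  also have "\<dots> = (\<Sum>i<p. \<Sum>j<p. \<Sum>l<p. \<theta> i * \<theta> j * (L i l * L j l))"
    by (subst sum.swap, rule sum.cong[OF refl], rule sum.swap)
  also have "\<dots> = quad_form p S \<theta>"
    using assms by (auto simp: quad_form_def cholesky_def sum_distrib_left[symmetric] intro!: sum.cong)
  finally show ?thesis .
qed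

lemma sets_model_law [measurable_cong, simp]: "sets (model_law n p S \<sigma>) = sets (data_space n p)"
  unfolding model_law_def by (intro sets_pair_measure_cong sets_PiM_cong) simp_all

lemma space_model_law: "space (model_law n p S \<sigma>) = space (data_space n p)"
  by (rule sets_eq_imp_space_eq) simp

lemma prob_space_gaussian_vector_law: "cholesky p S L \<Longrightarrow> prob_space (gaussian_vector_law p S)"
  by (simp add: gaussian_vector_law_eq_distr)
     (intro prob_space.prob_space_distr prob_space_std_gauss, simp cong: measurable_cong_sets)

lemma nn_integral_noise:
  assumes [measurable]: "f \<in> borel_measurable borel" and "0 < \<sigma>"
  shows "(\<integral>\<^sup>+u. f (c * u) \<partial>noise_law \<sigma>) = (\<integral>\<^sup>+x. f ((c * \<sigma>) * x) \<partial>std_normal)"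
  using nn_integral_normal_scale[of "\<lambda>u. f (c * u)" \<sigma>] assms by (simp add: mult.assoc)

text \<open>Allows a second moment to be bounded by exponential moments of both signs.\<close>

lemma square_le_exp: "x\<^sup>2 \<le> 2 * (exp x + exp (- x))" for x :: real
proof -
  have "x\<^sup>2 \<le> 2 * (exp x + exp (- x))" if "0 \<le> x" for x :: real
  proof -
    have "1 + x + x\<^sup>2 / 2 \<le> exp x" by (rule exp_lower_Taylor_quadratic[OF that])
    then have "x\<^sup>2 / 2 \<le> exp x" using that by linarith
    then show ?thesis using exp_gt_zero[of "- x"] by (simp add: field_simps add_increasing2)
  qed
  from this[of x] this[of "- x"] show ?thesis by (cases "0 \<le> x") auto
qed

text \<open>The left side is a chi-square moment generating function. Centring the variable removes
  the linear term \<open>y\<close> of the exponent, so that only the quadratic remainder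
  survives.\<close>

lemma inverse_sqrt_le_exp:
  fixes y :: real
  assumes "\<bar>y\<bar> \<le> 1 / 4" shows "1 / sqrt (1 - 2 * y) \<le> exp (y + 4 * y\<^sup>2)"
proof -
  have "\<bar>ln (1 + (- 2 * y)) - (- 2 * y)\<bar> \<le> 2 * (- 2 * y)\<^sup>2"
    by (rule abs_ln_one_plus_x_minus_x_bound) (use assms in auto)
  then have "- ln (1 - 2 * y) / 2 \<le> y + 4 * y\<^sup>2" by (simp add: abs_le_iff power_mult_distrib)
  then have "exp (- ln (1 - 2 * y) / 2) \<le> exp (y + 4 * y\<^sup>2)" by simp
  moreover have "exp (- ln (1 - 2 * y) / 2) = 1 / sqrt (1 - 2 * y)"
  proof -
    have "sqrt (1 - 2 * y) = exp (ln (1 - 2 * y) / 2)"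
      by (rule real_sqrt_unique) (use assms in \<open>auto simp: power2_eq_square exp_add[symmetric]\<close>)
    then show ?thesis by (simp add: exp_minus field_simps)
  qed
  ultimately show ?thesis by metis
qed

lemma coord_measurable [measurable (raw)]:
  "i \<in> {..<n} \<Longrightarrow> j \<in> {..<p} \<Longrightarrow> (\<lambda>\<omega>. fst \<omega> i j) \<in> borel_measurable (data_space n p)"
  "i \<in> {..<n} \<Longrightarrow> (\<lambda>\<omega>. snd \<omega> i) \<in> borel_measurable (data_space n p)"
proof -
  assume i: "i \<in> {..<n}" and j: "j \<in> {..<p}"
  have "(\<lambda>\<omega>. fst \<omega> i) \<in> data_space n p \<rightarrow>\<^sub>M Pi\<^sub>M {..<p} (\<lambda>_. borel)"
    by (rule measurable_compose[OF measurable_fst measurable_component_singleton[OF i]])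
  then show "(\<lambda>\<omega>. fst \<omega> i j) \<in> borel_measurable (data_space n p)"
    by (rule measurable_compose[OF _ measurable_component_singleton[OF j]])
next
  assume i: "i \<in> {..<n}"
  show "(\<lambda>\<omega>. snd \<omega> i) \<in> borel_measurable (data_space n p)"
    by (rule measurable_compose[OF measurable_snd measurable_component_singleton[OF i]])
qed

text \<open>The Cholesky factor is a parameter, so the identity covariance with its trivial factor
  can serve as a second instance when the data are whitened.\<close>

locale gaussian_model =
  fixes n p :: nat and S :: "real mat" and \<sigma> :: real and L :: "nat \<Rightarrow> nat \<Rightarrow> real"
  assumes chol: "cholesky p S L" and \<sigma>_pos: "0 < \<sigma>"
begin

abbreviation \<mu> where "\<mu> \<equiv> model_law n p S \<sigma>"
abbreviation G where "G \<equiv> gaussian_vector_law p S"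

definition row_var :: "(nat \<Rightarrow> real) \<Rightarrow> real \<Rightarrow> real" where
  "row_var \<theta> c = quad_form p S \<theta> + c\<^sup>2 * \<sigma>\<^sup>2"

text \<open>One family for all norms that occur: \<open>c = 0\<close> gives
  \<open>|X \<theta>|^2\<close>, and \<open>c = 1\<close> gives the squared norm of the noise for
  \<open>\<theta> = 0\<close> and of the response for \<open>\<theta> = b\<close>. Divided by a
  positive \<open>row_var\<close>, each is chi-square with \<open>n\<close> degrees of
  freedom.\<close>

definition sq_sum :: "(nat \<Rightarrow> real) \<Rightarrow> real \<Rightarrow> ((nat \<Rightarrow> nat \<Rightarrow> real) \<times> (nat \<Rightarrow> real)) \<Rightarrow> real" where
  "sq_sum \<theta> c \<omega> = (\<Sum>i<n. (lin_form p \<theta> (fst \<omega> i) + c * snd \<omega> i)\<^sup>2)"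

lemma quad_form_nonneg: "0 \<le> quad_form p S \<theta>"
  unfolding cholesky_quad_form[OF chol, symmetric] by (intro sum_nonneg) simp

lemma row_var_nonneg: "0 \<le> row_var \<theta> c"
  unfolding row_var_def using quad_form_nonneg by simp

lemma prob_G: "prob_space G"
  by (rule prob_space_gaussian_vector_law[OF chol])

lemma prob_noise: "prob_space (noise_law \<sigma>)"
  by (rule prob_space_normal_density[OF \<sigma>_pos])

lemma prob_\<mu>: "prob_space \<mu>"
  unfolding model_law_def
  by (intro prob_space_pair prob_space_PiM prob_G prob_noise)

lemma sigma_noise: "sigma_finite_measure (noise_law \<sigma>)"
  by (rule prob_space_imp_sigma_finite[OF prob_noise])

lemma sq_sum_measurable [measurable]: "sq_sum \<theta> c \<in> borel_measurable (data_space n p)"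
  unfolding sq_sum_def by measurable

lemma nn_integral_row:
  assumes [measurable]: "f \<in> borel_measurable borel"
  shows "(\<integral>\<^sup>+x. \<integral>\<^sup>+u. f (lin_form p \<theta> x + c * u) \<partial>noise_law \<sigma> \<partial>G)
    = (\<integral>\<^sup>+g. f (sqrt (row_var \<theta> c) * g) \<partial>std_normal)"
proof -
  define w where "w l = (\<Sum>j<p. \<theta> j * L j l)" for l
  define h where "h b = (\<integral>\<^sup>+u. f (b + c * u) \<partial>noise_law \<sigma>)" for b
  have hm [measurable]: "h \<in> borel_measurable borel"
    unfolding h_def by (intro sigma_finite_measure.borel_measurable_nn_integral[OF sigma_noise]) measurable
  have lin: "lin_form p \<theta> (lin_map p L z) = (\<Sum>l<p. w l * z l)" for z
  proof -
    have "lin_form p \<theta> (lin_map p L z) = (\<Sum>j<p. \<Sum>l<p. \<theta> j * L j l * z l)"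
      by (simp add: lin_map_def sum_distrib_left mult.assoc)
    also have "\<dots> = (\<Sum>l<p. w l * z l)"
      unfolding w_def sum_distrib_right by (rule sum.swap)
    finally show ?thesis .
  qed
  have "(\<integral>\<^sup>+x. \<integral>\<^sup>+u. f (lin_form p \<theta> x + c * u) \<partial>noise_law \<sigma> \<partial>G) = (\<integral>\<^sup>+x. h (lin_form p \<theta> x) \<partial>G)"
    by (simp add: h_def)
  also have "\<dots> = (\<integral>\<^sup>+z. h (lin_form p \<theta> (lin_map p L z)) \<partial>std_gauss p)"
    unfolding gaussian_vector_law_eq_distr[OF chol] by (rule nn_integral_distr) measurable
  also have "\<dots> = (\<integral>\<^sup>+g. h (sqrt (\<Sum>l<p. (w l)\<^sup>2) * g) \<partial>std_normal)"
    unfolding lin by (rule nn_integral_std_gauss_linear[OF hm])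
  also have "\<dots> = (\<integral>\<^sup>+g. \<integral>\<^sup>+u. f (sqrt (quad_form p S \<theta>) * g + (c * \<sigma>) * u) \<partial>std_normal \<partial>std_normal)"
  proof (rule nn_integral_cong)
    fix g
    have "h (sqrt (quad_form p S \<theta>) * g) = (\<integral>\<^sup>+u. f (sqrt (quad_form p S \<theta>) * g + (c * \<sigma>) * u) \<partial>std_normal)"
      unfolding h_def by (rule nn_integral_noise[OF _ \<sigma>_pos]) measurable
    then show "h (sqrt (\<Sum>l<p. (w l)\<^sup>2) * g) = (\<integral>\<^sup>+u. f (sqrt (quad_form p S \<theta>) * g + (c * \<sigma>) * u) \<partial>std_normal)"
      by (simp add: w_def cholesky_quad_form[OF chol])
  qed
  also have "\<dots> = (\<integral>\<^sup>+g. f (sqrt (row_var \<theta> c) * g) \<partial>std_normal)"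
    by (subst nn_integral_std_normal_add) (simp_all add: row_var_def quad_form_nonneg power_mult_distrib)
  finally show ?thesis .
qed

text \<open>The independence of the rows in the form in which it is used. A separate function for
  each row is allowed, so that the law of a single row can be extracted as well.\<close>

lemma nn_integral_rows:
  assumes [measurable]: "\<And>i. f i \<in> borel_measurable borel"
  shows "(\<integral>\<^sup>+\<omega>. (\<Prod>i<n. f i (lin_form p \<theta> (fst \<omega> i) + c * snd \<omega> i)) \<partial>\<mu>)
    = (\<Prod>i<n. \<integral>\<^sup>+g. f i (sqrt (row_var \<theta> c) * g) \<partial>std_normal)"
proof -
  interpret N: product_sigma_finite "\<lambda>_::nat. noise_law \<sigma>"
    by (simp add: product_sigma_finite_def sigma_noise)
  interpret G: product_sigma_finite "\<lambda>_::nat. G"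
    by (simp add: product_sigma_finite_def prob_space_imp_sigma_finite[OF prob_G])
  interpret PN: sigma_finite_measure "Pi\<^sub>M {..<n} (\<lambda>_. noise_law \<sigma>)"
    by (intro prob_space_imp_sigma_finite prob_space_PiM prob_noise)
  let ?F = "\<lambda>\<omega>. \<Prod>i<n. f i (lin_form p \<theta> (fst \<omega> i) + c * snd \<omega> i)"
  have "?F \<in> borel_measurable (data_space n p)" by measurable
  then have Fm: "?F \<in> borel_measurable \<mu>" by (simp cong: measurable_cong_sets)
  have "(\<integral>\<^sup>+\<omega>. ?F \<omega> \<partial>\<mu>) = (\<integral>\<^sup>+x. \<integral>\<^sup>+e. ?F (x, e) \<partial>Pi\<^sub>M {..<n} (\<lambda>_. noise_law \<sigma>) \<partial>Pi\<^sub>M {..<n} (\<lambda>_. G))"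
    unfolding model_law_def by (rule PN.nn_integral_fst[symmetric]) (use Fm in \<open>simp add: model_law_def\<close>)
  also have "\<dots> = (\<integral>\<^sup>+x. (\<Prod>i<n. \<integral>\<^sup>+u. f i (lin_form p \<theta> (x i) + c * u) \<partial>noise_law \<sigma>) \<partial>Pi\<^sub>M {..<n} (\<lambda>_. G))"
  proof (rule nn_integral_cong)
    fix x :: "nat \<Rightarrow> nat \<Rightarrow> real"
    have "(\<integral>\<^sup>+e. (\<Prod>i<n. f i (lin_form p \<theta> (x i) + c * e i)) \<partial>Pi\<^sub>M {..<n} (\<lambda>_. noise_law \<sigma>))
      = (\<Prod>i<n. \<integral>\<^sup>+u. f i (lin_form p \<theta> (x i) + c * u) \<partial>noise_law \<sigma>)"
      by (rule N.product_nn_integral_prod[where f = "\<lambda>i u. f i (lin_form p \<theta> (x i) + c * u)"]) auto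
    then show "(\<integral>\<^sup>+e. ?F (x, e) \<partial>Pi\<^sub>M {..<n} (\<lambda>_. noise_law \<sigma>)) = (\<Prod>i<n. \<integral>\<^sup>+u. f i (lin_form p \<theta> (x i) + c * u) \<partial>noise_law \<sigma>)"
      by simp
  qed
  also have "\<dots> = (\<Prod>i<n. \<integral>\<^sup>+x. \<integral>\<^sup>+u. f i (lin_form p \<theta> x + c * u) \<partial>noise_law \<sigma> \<partial>G)"
  proof (rule G.product_nn_integral_prod)
    show "(\<lambda>x. \<integral>\<^sup>+u. f i (lin_form p \<theta> x + c * u) \<partial>noise_law \<sigma>) \<in> borel_measurable G" for i
      by (intro sigma_finite_measure.borel_measurable_nn_integral[OF sigma_noise]) measurable
  qed simp
  finally show ?thesis by (simp add: nn_integral_row)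
qed

section \<open>Chi-square moments and tails\<close>

lemma sq_sum_mgf:
  assumes s: "s * row_var \<theta> c < 1 / 2"
  shows "(\<integral>\<^sup>+\<omega>. ennreal (exp (s * sq_sum \<theta> c \<omega>)) \<partial>\<mu>) = ennreal ((1 / sqrt (1 - 2 * (s * row_var \<theta> c))) ^ n)"
proof -
  have "ennreal (exp (s * sq_sum \<theta> c \<omega>)) = (\<Prod>i<n. ennreal (exp (s * (lin_form p \<theta> (fst \<omega> i) + c * snd \<omega> i)\<^sup>2)))" for \<omega>
    by (simp add: sq_sum_def sum_distrib_left exp_sum prod_ennreal)
  then have "(\<integral>\<^sup>+\<omega>. ennreal (exp (s * sq_sum \<theta> c \<omega>)) \<partial>\<mu>)
     = (\<integral>\<^sup>+\<omega>. (\<Prod>i<n. ennreal (exp (s * (lin_form p \<theta> (fst \<omega> i) + c * snd \<omega> i)\<^sup>2))) \<partial>\<mu>)" by simp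
  also have "\<dots> = (\<integral>\<^sup>+g. ennreal (exp (s * (sqrt (row_var \<theta> c) * g)\<^sup>2)) \<partial>std_normal) ^ n"
    by (subst nn_integral_rows[where f = "\<lambda>_ y. ennreal (exp (s * y\<^sup>2))"]) simp_all
  also have "(\<integral>\<^sup>+g. ennreal (exp (s * (sqrt (row_var \<theta> c) * g)\<^sup>2)) \<partial>std_normal) = 
     (\<integral>\<^sup>+g. ennreal (exp ((s * row_var \<theta> c) * g\<^sup>2)) \<partial>std_normal)"
    using row_var_nonneg[of \<theta> c] by (simp add: power_mult_distrib mult.assoc)
  also have "\<dots> = ennreal (1 / sqrt (1 - 2 * (s * row_var \<theta> c)))"
    by (rule nn_integral_std_normal_exp_square[OF s])
  also have "\<dots> ^ n = ennreal ((1 / sqrt (1 - 2 * (s * row_var \<theta> c))) ^ n)"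
    by (rule ennreal_power) (use s in simp)
  finally show ?thesis .
qed

lemma markov_exp:
  assumes [measurable]: "f \<in> borel_measurable (data_space n p)" and "\<And>\<omega>. \<omega> \<in> A \<Longrightarrow> a \<le> f \<omega>"
    and A: "A \<in> sets (data_space n p)"
  shows "emeasure \<mu> A \<le> ennreal (exp (- a)) * (\<integral>\<^sup>+\<omega>. ennreal (exp (f \<omega>)) \<partial>\<mu>)"
proof -
  have "emeasure \<mu> A = (\<integral>\<^sup>+\<omega>. indicator A \<omega> \<partial>\<mu>)" using A by simp
  also have "\<dots> \<le> (\<integral>\<^sup>+\<omega>. ennreal (exp (- a)) * ennreal (exp (f \<omega>)) \<partial>\<mu>)"
  proof (rule nn_integral_mono)
    fix \<omega>
    show "indicator A \<omega> \<le> ennreal (exp (- a)) * ennreal (exp (f \<omega>))"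
      using assms(2)[of \<omega>] by (auto simp: indicator_def ennreal_mult'[symmetric] exp_add[symmetric])
  qed
  also have "\<dots> = ennreal (exp (- a)) * (\<integral>\<^sup>+\<omega>. ennreal (exp (f \<omega>)) \<partial>\<mu>)"
    by (rule nn_integral_cmult) measurable
  finally show ?thesis .
qed

lemma sq_sum_lower_tail:
  assumes v: "0 < row_var \<theta> c"
  shows "emeasure \<mu> {\<omega> \<in> space \<mu>. sq_sum \<theta> c \<omega> \<le> real n * row_var \<theta> c / 4} \<le> ennreal (exp (- real n / 4))"
proof -
  let ?v = "row_var \<theta> c"
  \<comment> \<open>Chernoff bound with exponent \<open>- 1 / ?v\<close>: each row contributes the
    factor \<open>1 / sqrt 3\<close>, which is at most \<open>exp (- 1 / 2)\<close> because
    \<open>e <= 3\<close>.\<close>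
  have "emeasure \<mu> {\<omega> \<in> space \<mu>. sq_sum \<theta> c \<omega> \<le> real n * ?v / 4}
      \<le> ennreal (exp (- (- real n / 4))) * (\<integral>\<^sup>+\<omega>. ennreal (exp ((- 1 / ?v) * sq_sum \<theta> c \<omega>)) \<partial>\<mu>)"
  proof (rule markov_exp)
    show "{\<omega> \<in> space \<mu>. sq_sum \<theta> c \<omega> \<le> real n * ?v / 4} \<in> sets (data_space n p)"
      unfolding space_model_law by measurable
  qed (use v in \<open>auto simp: field_simps\<close>)
  also have "\<dots> = ennreal (exp (real n / 4) * (1 / sqrt 3) ^ n)"
    using v by (subst sq_sum_mgf) (auto simp: ennreal_mult'[symmetric])
  also have "\<dots> \<le> ennreal (exp (- real n / 4))"
  proof (rule ennreal_leI)
    have "exp (1 / 2 :: real) = sqrt (exp 1)"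
      by (rule real_sqrt_unique[symmetric]) (simp_all add: power2_eq_square exp_add[symmetric])
    also have "\<dots> \<le> sqrt 3" using exp_le by simp
    finally have "1 / sqrt 3 \<le> exp (- (1 / 2) :: real)" by (simp add: exp_minus field_simps)
    then have "(1 / sqrt 3) ^ n \<le> exp (- (1 / 2) :: real) ^ n" by (intro power_mono) auto
    also have "\<dots> = exp (- real n / 2)" by (simp add: exp_of_nat_mult[symmetric])
    finally have "exp (real n / 4) * (1 / sqrt 3) ^ n \<le> exp (real n / 4) * exp (- real n / 2)" by simp
    also have "\<dots> = exp (- real n / 4)" by (simp add: exp_add[symmetric])
    finally show "exp (real n / 4) * (1 / sqrt 3) ^ n \<le> exp (- real n / 4)" .
  qed
  finally show ?thesis .
qed

lemma sq_sum_upper_tail: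
  assumes v: "0 < row_var \<theta> c"
  shows "emeasure \<mu> {\<omega> \<in> space \<mu>. 4 * (real n * row_var \<theta> c) \<le> sq_sum \<theta> c \<omega>} \<le> ennreal (exp (- real n / 2))"
proof -
  let ?v = "row_var \<theta> c"
  \<comment> \<open>Chernoff bound with exponent \<open>1 / (4 * ?v)\<close>: each row contributes
    the factor \<open>sqrt 2\<close>, which is at most \<open>exp (1 / 2)\<close>, against the gain
    \<open>exp (- n)\<close> at the threshold.\<close>
  have "emeasure \<mu> {\<omega> \<in> space \<mu>. 4 * (real n * row_var \<theta> c) \<le> sq_sum \<theta> c \<omega>}
      \<le> ennreal (exp (- real n)) * (\<integral>\<^sup>+\<omega>. ennreal (exp ((1 / (4 * ?v)) * sq_sum \<theta> c \<omega>)) \<partial>\<mu>)"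
  proof (rule markov_exp)
    show "{\<omega> \<in> space \<mu>. 4 * (real n * row_var \<theta> c) \<le> sq_sum \<theta> c \<omega>} \<in> sets (data_space n p)"
      unfolding space_model_law by measurable
  qed (use v in \<open>auto simp: field_simps\<close>)
  also have "\<dots> = ennreal (exp (- real n) * (1 / sqrt (1 / 2)) ^ n)"
    using v by (subst sq_sum_mgf) (auto simp: ennreal_mult'[symmetric])
  also have "\<dots> \<le> ennreal (exp (- real n / 2))"
  proof (rule ennreal_leI)
    have "sqrt 2 \<le> sqrt (exp 1)" using exp_ge_add_one_self[of 1] by (intro real_sqrt_le_mono) simp
    also have "\<dots> = exp (1 / 2 :: real)"
      by (rule real_sqrt_unique) (simp_all add: power2_eq_square exp_add[symmetric])
    finally have "1 / sqrt (1 / 2) \<le> exp (1 / 2 :: real)" by (simp add: real_sqrt_divide)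
    then have "(1 / sqrt (1 / 2)) ^ n \<le> exp (1 / 2 :: real) ^ n" by (intro power_mono) auto
    also have "\<dots> = exp (real n / 2)" by (simp add: exp_of_nat_mult[symmetric])
    finally have "exp (- real n) * (1 / sqrt (1 / 2)) ^ n \<le> exp (- real n) * exp (real n / 2)" by simp
    also have "\<dots> = exp (- real n / 2)" by (simp add: exp_add[symmetric])
    finally show "exp (- real n) * (1 / sqrt (1 / 2)) ^ n \<le> exp (- real n / 2)" .
  qed
  finally show ?thesis .
qed

text \<open>The scaling is chosen so that the exponent \<open>y\<close> per row satisfies
  \<open>\<bar>y\<bar> <= 1 / 4\<close>, as the logarithmic estimate demands, and
  \<open>n y^2 = 1 / 16\<close>; the centred exponent is then at most 1/4 for every
  \<open>n\<close>.\<close>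

lemma sq_sum_centered_mgf:
  assumes v: "0 < row_var \<theta> c" and n: "1 \<le> n" and r: "r = 1 \<or> r = (-1 :: real)"
  shows "(\<integral>\<^sup>+\<omega>. ennreal (exp (r * (sq_sum \<theta> c \<omega> - real n * row_var \<theta> c) / (4 * row_var \<theta> c * sqrt (real n)))) \<partial>\<mu>) \<le> 2"
proof -
  let ?v = "row_var \<theta> c"
  define s where "s = r / (4 * ?v * sqrt (real n))"
  define y where "y = r / (4 * sqrt (real n))"
  have sv: "s * ?v = y" using v by (simp add: s_def y_def)
  have n1: "1 \<le> sqrt (real n)" using n by simp
  have y: "\<bar>y\<bar> \<le> 1 / 4" using r n1 by (auto simp: y_def field_simps)
  have ny: "real n * y\<^sup>2 = 1 / 16" using r n by (auto simp: y_def power_divide power_mult_distrib)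
  have "exp (r * (sq_sum \<theta> c \<omega> - real n * ?v) / (4 * ?v * sqrt (real n))) = exp (- (real n * y)) * exp (s * sq_sum \<theta> c \<omega>)" for \<omega>
    unfolding exp_add[symmetric] sv[symmetric] by (simp add: s_def algebra_simps diff_divide_distrib)
  then have "(\<integral>\<^sup>+\<omega>. ennreal (exp (r * (sq_sum \<theta> c \<omega> - real n * ?v) / (4 * ?v * sqrt (real n)))) \<partial>\<mu>)
    = (\<integral>\<^sup>+\<omega>. ennreal (exp (- (real n * y))) * ennreal (exp (s * sq_sum \<theta> c \<omega>)) \<partial>\<mu>)"
    by (simp add: ennreal_mult')
  also have "\<dots> = ennreal (exp (- (real n * y))) * (\<integral>\<^sup>+\<omega>. ennreal (exp (s * sq_sum \<theta> c \<omega>)) \<partial>\<mu>)"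
    by (rule nn_integral_cmult) measurable
  also have "\<dots> = ennreal (exp (- (real n * y)) * (1 / sqrt (1 - 2 * y)) ^ n)"
    using y by (subst sq_sum_mgf) (auto simp: sv ennreal_mult'[symmetric])
  also have "\<dots> \<le> ennreal 2"
  proof (rule ennreal_leI)
    have "(1 / sqrt (1 - 2 * y)) ^ n \<le> exp (y + 4 * y\<^sup>2) ^ n"
      by (intro power_mono inverse_sqrt_le_exp y) (use y in auto)
    also have "\<dots> = exp (real n * y + 4 * (real n * y\<^sup>2))" by (simp add: exp_of_nat_mult[symmetric] algebra_simps)
    finally have "exp (- (real n * y)) * (1 / sqrt (1 - 2 * y)) ^ n \<le> exp (- (real n * y)) * exp (real n * y + 4 * (real n * y\<^sup>2))"
      by simp
    also have "\<dots> = exp (1 / 4)" by (simp add: exp_add[symmetric] ny)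
    also have "\<dots> \<le> (2 :: real)" using exp_bound[of "1/4 :: real"] by (simp add: power2_eq_square)
    finally show "exp (- (real n * y)) * (1 / sqrt (1 - 2 * y)) ^ n \<le> 2" .
  qed
  finally show ?thesis by simp
qed

text \<open>Fourth moments of normal variables are bypassed: the square equals \<open>16 / n\<close>
  times the square of the scaled variable \<open>x\<close>, which is at most
  \<open>2 (exp x + exp (- x))\<close>, and both exponential moments are at most 2.\<close>

lemma sq_sum_second_moment:
  assumes v: "0 < row_var \<theta> c" and n: "1 \<le> n"
  shows "(\<integral>\<^sup>+\<omega>. ennreal ((sq_sum \<theta> c \<omega> / (real n * row_var \<theta> c) - 1)\<^sup>2) \<partial>\<mu>) \<le> ennreal (128 / real n)"
proof -
  let ?v = "row_var \<theta> c"
  define x where "x \<omega> = (sq_sum \<theta> c \<omega> - real n * ?v) / (4 * ?v * sqrt (real n))" for \<omega>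
  have xm [measurable]: "x \<in> borel_measurable (data_space n p)" unfolding x_def by measurable
  have "(sq_sum \<theta> c \<omega> / (real n * ?v) - 1)\<^sup>2 = 16 / real n * (x \<omega>)\<^sup>2" for \<omega>
  proof -
    have "sq_sum \<theta> c \<omega> / (real n * ?v) - 1 = (sq_sum \<theta> c \<omega> - real n * ?v) / (real n * ?v)"
      using v n by (simp add: diff_divide_distrib)
    then show ?thesis using v n by (simp add: x_def power_divide power_mult_distrib power2_eq_square[of "real n"])
  qed
  moreover have "16 / real n * (x \<omega>)\<^sup>2 \<le> 32 / real n * (exp (x \<omega>) + exp (- x \<omega>))" for \<omega>
    using square_le_exp[of "x \<omega>"] n by (simp add: field_simps)
  ultimately have "(\<integral>\<^sup>+\<omega>. ennreal ((sq_sum \<theta> c \<omega> / (real n * ?v) - 1)\<^sup>2) \<partial>\<mu>)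
     \<le> (\<integral>\<^sup>+\<omega>. ennreal (32 / real n) * (ennreal (exp (x \<omega>)) + ennreal (exp (- x \<omega>))) \<partial>\<mu>)"
    by (intro nn_integral_mono) (auto simp: ennreal_mult'[symmetric] ennreal_plus[symmetric] intro!: ennreal_leI simp del: ennreal_plus)
  also have "\<dots> = ennreal (32 / real n) * ((\<integral>\<^sup>+\<omega>. ennreal (exp (x \<omega>)) \<partial>\<mu>) + (\<integral>\<^sup>+\<omega>. ennreal (exp (- x \<omega>)) \<partial>\<mu>))"
    by (subst nn_integral_cmult, measurable) (subst nn_integral_add, simp_all)
  also have "\<dots> \<le> ennreal (32 / real n) * (2 + 2)"
    using sq_sum_centered_mgf[OF v n, of 1] sq_sum_centered_mgf[OF v n, of "-1"]
    by (intro mult_left_mono add_mono) (simp_all add: x_def minus_divide_left)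
  also have "\<dots> = ennreal (128 / real n)"
    using ennreal_mult'[of "32 / real n" 4] by simp
  finally show ?thesis .
qed

section \<open>Correlation of the noise with the columns of the design\<close>

lemma noise_mgf:
  "(\<integral>\<^sup>+e. ennreal (exp (\<Sum>i<n. a i * e i)) \<partial>Pi\<^sub>M {..<n} (\<lambda>_. noise_law \<sigma>)) = ennreal (exp ((\<Sum>i<n. (a i)\<^sup>2) * \<sigma>\<^sup>2 / 2))"
proof -
  interpret N: product_sigma_finite "\<lambda>_::nat. noise_law \<sigma>"
    by (simp add: product_sigma_finite_def sigma_noise)
  have "(\<integral>\<^sup>+e. ennreal (exp (\<Sum>i<n. a i * e i)) \<partial>Pi\<^sub>M {..<n} (\<lambda>_. noise_law \<sigma>))
     = (\<integral>\<^sup>+e. (\<Prod>i<n. ennreal (exp (a i * e i))) \<partial>Pi\<^sub>M {..<n} (\<lambda>_. noise_law \<sigma>))"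
    by (simp add: exp_sum prod_ennreal)
  also have "\<dots> = (\<Prod>i<n. \<integral>\<^sup>+u. ennreal (exp (a i * u)) \<partial>noise_law \<sigma>)"
    by (rule N.product_nn_integral_prod[where f = "\<lambda>i u. ennreal (exp (a i * u))"]) auto
  also have "\<dots> = (\<Prod>i<n. ennreal (exp ((a i * \<sigma>)\<^sup>2 / 2)))"
    by (intro prod.cong refl) (simp add: nn_integral_noise[where f = "\<lambda>y. ennreal (exp y)", OF _ \<sigma>_pos] nn_integral_std_normal_exp)
  also have "\<dots> = ennreal (exp ((\<Sum>i<n. (a i)\<^sup>2) * \<sigma>\<^sup>2 / 2))"
    by (simp add: prod_ennreal exp_sum[symmetric] sum_distrib_right sum_divide_distrib power_mult_distrib)
  finally show ?thesis .
qed

lemma noise_tail_fixed: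
  assumes t: "0 < t"
  shows "(\<integral>\<^sup>+e. indicator {e. t * \<sigma> * sqrt (\<Sum>i<n. (a i)\<^sup>2) < \<bar>\<Sum>i<n. a i * e i\<bar>} e \<partial>Pi\<^sub>M {..<n} (\<lambda>_. noise_law \<sigma>))
    \<le> ennreal (2 * exp (- t\<^sup>2 / 2))"
proof (cases "(\<Sum>i<n. (a i)\<^sup>2) = 0")
  case True
  then have "\<forall>i<n. a i = 0" by (simp add: sum_nonneg_eq_0_iff)
  \<comment> \<open>The strict inequality in the event matters here: for zero coefficients it reads
    \<open>0 < 0\<close> and the event is empty.\<close>
  then have "(\<Sum>i<n. a i * e i) = 0" for e by (intro sum.neutral) auto
  then show ?thesis using True by simp
next
  case False
  define r where "r = sqrt (\<Sum>i<n. (a i)\<^sup>2)"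
  have r: "0 < r" using False sum_nonneg[of "{..<n}" "\<lambda>i. (a i)\<^sup>2"] by (simp add: r_def less_le)
  have r2: "r\<^sup>2 = (\<Sum>i<n. (a i)\<^sup>2)" by (simp add: r_def sum_nonneg)
  \<comment> \<open>The optimal exponent of the Chernoff bound for a normal variable with standard
    deviation \<open>\<sigma> * r\<close>.\<close>
  define s where "s = t / (\<sigma> * r)"
  have s: "s\<^sup>2 * r\<^sup>2 * \<sigma>\<^sup>2 = t\<^sup>2" using r \<sigma>_pos by (simp add: s_def power_divide power_mult_distrib)
  let ?N = "Pi\<^sub>M {..<n} (\<lambda>_. noise_law \<sigma>)"
  have m: "(\<integral>\<^sup>+e. ennreal (exp (q * s * (\<Sum>i<n. a i * e i))) \<partial>?N) = ennreal (exp (t\<^sup>2 / 2))" if "q\<^sup>2 = 1" for q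
    using noise_mgf[of "\<lambda>i. q * s * a i"] that s
    by (simp add: sum_distrib_left mult.assoc power_mult_distrib) (simp add: sum_distrib_left[symmetric] r2[symmetric] mult_ac)
  have "(\<integral>\<^sup>+e. indicator {e. t * \<sigma> * r < \<bar>\<Sum>i<n. a i * e i\<bar>} e \<partial>?N)
    \<le> (\<integral>\<^sup>+e. ennreal (exp (- t\<^sup>2)) * (ennreal (exp (1 * s * (\<Sum>i<n. a i * e i))) + ennreal (exp ((-1) * s * (\<Sum>i<n. a i * e i)))) \<partial>?N)"
  proof (rule nn_integral_mono)
    fix e :: "nat \<Rightarrow> real"
    define y where "y = (\<Sum>i<n. a i * e i)"
    have "1 \<le> exp (- t\<^sup>2) * (exp (s * y) + exp (- s * y))" if "t * \<sigma> * r < \<bar>y\<bar>"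
    proof -
      have "t\<^sup>2 = s * (t * \<sigma> * r)" using r \<sigma>_pos by (simp add: s_def power2_eq_square)
      also have "\<dots> \<le> s * \<bar>y\<bar>" using that t r \<sigma>_pos by (intro mult_left_mono) (auto simp: s_def)
      finally have "exp (t\<^sup>2) \<le> exp (s * \<bar>y\<bar>)" by simp
      also have "\<dots> \<le> exp (s * y) + exp (- s * y)" by (auto simp: abs_if)
      finally show ?thesis by (simp add: exp_minus field_simps)
    qed
    then show "indicator {e. t * \<sigma> * r < \<bar>\<Sum>i<n. a i * e i\<bar>} e
      \<le> ennreal (exp (- t\<^sup>2)) * (ennreal (exp (1 * s * (\<Sum>i<n. a i * e i))) + ennreal (exp ((-1) * s * (\<Sum>i<n. a i * e i))))"
      by (auto simp: y_def indicator_def ennreal_mult'[symmetric] ennreal_plus[symmetric] simp del: ennreal_plus)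
  qed
  also have "\<dots> = ennreal (exp (- t\<^sup>2)) * (ennreal (exp (t\<^sup>2 / 2)) + ennreal (exp (t\<^sup>2 / 2)))"
  proof -
    have "(\<integral>\<^sup>+e. ennreal (exp (1 * s * (\<Sum>i<n. a i * e i))) + ennreal (exp ((-1) * s * (\<Sum>i<n. a i * e i))) \<partial>?N)
      = (\<integral>\<^sup>+e. ennreal (exp (1 * s * (\<Sum>i<n. a i * e i))) \<partial>?N) + (\<integral>\<^sup>+e. ennreal (exp ((-1) * s * (\<Sum>i<n. a i * e i))) \<partial>?N)"
      by (rule nn_integral_add) measurable
    also have "\<dots> = ennreal (exp (t\<^sup>2 / 2)) + ennreal (exp (t\<^sup>2 / 2))"
      using m[of 1] m[of "-1"] by (simp only: power2_eq_square)
    finally show ?thesis by (subst nn_integral_cmult) simp_all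
  qed
  also have "\<dots> = ennreal (2 * exp (- t\<^sup>2 / 2))"
    by (simp add: ennreal_mult'[symmetric] ennreal_plus[symmetric] exp_add[symmetric] distrib_left del: ennreal_plus)
  finally show ?thesis by (simp add: r_def)
qed

text \<open>The design is integrated last. For every fixed design the threshold is proportional to
  the norm of column \<open>j\<close>, which makes the conditional tail bound independent of the
  design.\<close>

lemma noise_tail:
  assumes t: "0 < t" and j: "j < p"
  shows "emeasure \<mu> {\<omega> \<in> space \<mu>. t * \<sigma> * sqrt (\<Sum>i<n. (fst \<omega> i j)\<^sup>2) < \<bar>\<Sum>i<n. fst \<omega> i j * snd \<omega> i\<bar>}
    \<le> ennreal (2 * exp (- t\<^sup>2 / 2))"
proof -
  interpret PN: sigma_finite_measure "Pi\<^sub>M {..<n} (\<lambda>_. noise_law \<sigma>)"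
    by (intro prob_space_imp_sigma_finite prob_space_PiM prob_noise)
  interpret PG: prob_space "Pi\<^sub>M {..<n} (\<lambda>_. G)" by (intro prob_space_PiM prob_G)
  let ?A = "{\<omega> \<in> space \<mu>. t * \<sigma> * sqrt (\<Sum>i<n. (fst \<omega> i j)\<^sup>2) < \<bar>\<Sum>i<n. fst \<omega> i j * snd \<omega> i\<bar>}"
  have jj: "j \<in> {..<p}" using j by simp
  have "?A \<in> sets (data_space n p)" unfolding space_model_law using jj by measurable
  then have A: "?A \<in> sets \<mu>" by simp
  then have Am: "indicator ?A \<in> borel_measurable \<mu>" by simp
  have "emeasure \<mu> ?A = (\<integral>\<^sup>+\<omega>. indicator ?A \<omega> \<partial>\<mu>)" using A by simp
  also have "\<dots> = (\<integral>\<^sup>+x. \<integral>\<^sup>+e. indicator ?A (x, e) \<partial>Pi\<^sub>M {..<n} (\<lambda>_. noise_law \<sigma>) \<partial>Pi\<^sub>M {..<n} (\<lambda>_. G))"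
    unfolding model_law_def by (rule PN.nn_integral_fst[symmetric]) (use Am in \<open>simp add: model_law_def\<close>)
  also have "\<dots> \<le> (\<integral>\<^sup>+x. ennreal (2 * exp (- t\<^sup>2 / 2)) \<partial>Pi\<^sub>M {..<n} (\<lambda>_. G))"
  proof (rule nn_integral_mono)
    fix x :: "nat \<Rightarrow> nat \<Rightarrow> real"
    have "(\<integral>\<^sup>+e. indicator ?A (x, e) \<partial>Pi\<^sub>M {..<n} (\<lambda>_. noise_law \<sigma>)) \<le>
       (\<integral>\<^sup>+e. indicator {e. t * \<sigma> * sqrt (\<Sum>i<n. (x i j)\<^sup>2) < \<bar>\<Sum>i<n. x i j * e i\<bar>} e \<partial>Pi\<^sub>M {..<n} (\<lambda>_. noise_law \<sigma>))"
      by (intro nn_integral_mono) (auto simp: indicator_def)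
    also have "\<dots> \<le> ennreal (2 * exp (- t\<^sup>2 / 2))" by (rule noise_tail_fixed[OF t])
    finally show "(\<integral>\<^sup>+e. indicator ?A (x, e) \<partial>Pi\<^sub>M {..<n} (\<lambda>_. noise_law \<sigma>)) \<le> ennreal (2 * exp (- t\<^sup>2 / 2))" .
  qed
  also have "\<dots> = ennreal (2 * exp (- t\<^sup>2 / 2))" using PG.emeasure_space_1 by simp
  finally show ?thesis .
qed

end

section \<open>Cholesky factors and extreme eigenvalues\<close>

definition bil_form :: "nat \<Rightarrow> real mat \<Rightarrow> (nat \<Rightarrow> real) \<Rightarrow> (nat \<Rightarrow> real) \<Rightarrow> real" where
  "bil_form p S x y = (\<Sum>i<p. \<Sum>j<p. x i * y j * S $$ (i, j))"

lemma quad_form_vec: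
  assumes "S \<in> carrier_mat p p"
  shows "vec p \<theta> \<bullet> (S *\<^sub>v vec p \<theta>) = quad_form p S \<theta>"
  using assms by (simp add: quad_form_def scalar_prod_def atLeast0LessThan sum_distrib_left mult_ac)

lemma quad_form_add_scaled:
  assumes "\<And>i j. i < p \<Longrightarrow> j < p \<Longrightarrow> S $$ (i, j) = S $$ (j, i)"
  shows "quad_form p S (\<lambda>i. x i + t * y i) = quad_form p S x + 2 * t * bil_form p S x y + t\<^sup>2 * quad_form p S y"
proof -
  have sw: "(\<Sum>i<p. \<Sum>j<p. y i * x j * S $$ (i, j)) = bil_form p S x y"
    unfolding bil_form_def
    by (subst sum.swap) (auto intro!: sum.cong simp: assms mult.commute)
  have "quad_form p S (\<lambda>i. x i + t * y i) = quad_form p S x + t * bil_form p S x y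
      + t * (\<Sum>i<p. \<Sum>j<p. y i * x j * S $$ (i, j)) + t\<^sup>2 * quad_form p S y"
    by (simp add: quad_form_def bil_form_def sum.distrib sum_distrib_left power2_eq_square algebra_simps)
  then show ?thesis unfolding sw by simp
qed

lemma symmetric_entries:
  assumes "S \<in> carrier_mat p p" "transpose_mat S = S" "i < p" "j < p"
  shows "S $$ (i, j) = S $$ (j, i)"
  using assms by (metis index_transpose_mat(1) carrier_matD)

lemma invertible_det:
  assumes S: "S \<in> carrier_mat p p" and "invertible_mat S"
  shows "det S \<noteq> (0 :: real)"
proof -
  obtain B where B: "S * B = 1\<^sub>m (dim_row S)" "B * S = 1\<^sub>m (dim_row B)"
    using assms by (auto simp: invertible_mat_def inverts_mat_def)
  have "dim_col B = p" using arg_cong[OF B(1), of dim_col] S by simp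
  moreover have "dim_row B = p" using arg_cong[OF B(2), of dim_col] S by simp
  ultimately have Bc: "B \<in> carrier_mat p p" by auto
  have "det S * det B = 1" using det_mult[OF S Bc] B(1) S by simp
  then show ?thesis by auto
qed

lemma linear_term_zero:
  fixes a c :: real
  assumes "\<And>t. 0 \<le> 2 * t * a + t\<^sup>2 * c" and c: "0 \<le> c"
  shows "a = 0"
proof -
  \<comment> \<open>The quadratic is minimal at \<open>- a / c\<close>; adding 1 to the denominator
    keeps the point defined for \<open>c = 0\<close>, and the value there is still negative unless
    \<open>a = 0\<close>.\<close>
  define t where "t = - a / (c + 1)"
  have td: "t * (c + 1) = - a" using c by (simp add: t_def)
  have "0 \<le> (2 * t * a + t\<^sup>2 * c) * (c + 1)\<^sup>2" using assms by simp
  also have "\<dots> = 2 * (t * (c + 1)) * a * (c + 1) + (t * (c + 1))\<^sup>2 * c"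
    by (simp add: power2_eq_square algebra_simps)
  also have "\<dots> = - (a\<^sup>2 * (c + 2))" unfolding td by (simp add: power2_eq_square algebra_simps)
  finally have "a\<^sup>2 * (c + 2) \<le> 0" by simp
  then show ?thesis using c by (simp add: mult_le_0_iff)
qed

definition pos_def :: "nat \<Rightarrow> real mat \<Rightarrow> bool" where
  "pos_def p S \<longleftrightarrow> (\<forall>\<theta>. (\<exists>i<p. \<theta> i \<noteq> 0) \<longrightarrow> 0 < quad_form p S \<theta>)"

text \<open>A vector on which the form vanishes minimises it, so every cross term with it vanishes.
  Taking the cross term with \<open>y = S \<theta>\<close> gives \<open>|S \<theta>|^2 = 0\<close>,
  which contradicts invertibility.\<close>

lemma covariance_pos_def:
  assumes cov: "covariance_matrix p S" and det: "det S \<noteq> 0"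
  shows "pos_def p S"
  unfolding pos_def_def
proof (intro allI impI)
  fix \<theta> :: "nat \<Rightarrow> real" assume nz: "\<exists>i<p. \<theta> i \<noteq> 0"
  have S: "S \<in> carrier_mat p p" and sym: "transpose_mat S = S" using cov by (auto simp: covariance_matrix_def)
  have nonneg: "0 \<le> quad_form p S x" for x
    using cov unfolding quad_form_vec[OF S, of x, symmetric] covariance_matrix_def by simp
  show "0 < quad_form p S \<theta>"
  proof (rule ccontr)
    assume "\<not> 0 < quad_form p S \<theta>"
    with nonneg[of \<theta>] have q0: "quad_form p S \<theta> = 0" by simp
    define y where "y j = (\<Sum>i<p. \<theta> i * S $$ (i, j))" for j
    define a where "a = (\<Sum>j<p. (y j)\<^sup>2)"
    define c where "c = quad_form p S y"
    have c: "0 \<le> c" by (simp add: c_def nonneg)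
    have b: "bil_form p S \<theta> y = a"
      unfolding bil_form_def a_def
      by (subst sum.swap) (simp add: y_def power2_eq_square sum_distrib_left mult_ac)
    have "0 \<le> 2 * t * a + t\<^sup>2 * c" for t
      using nonneg[of "\<lambda>i. \<theta> i + t * y i"] quad_form_add_scaled[OF symmetric_entries[OF S sym], where x = \<theta> and t = t and y = y] q0 b
      by (simp add: c_def)
    then have "a = 0" by (rule linear_term_zero) (rule c)
    then have y0: "y j = 0" if "j < p" for j
      using that by (auto simp: a_def sum_nonneg_eq_0_iff)
    have "S *\<^sub>v vec p \<theta> = 0\<^sub>v p"
    proof (rule eq_vecI)
      fix j assume "j < dim_vec (0\<^sub>v p :: real vec)"
      then have j: "j < p" by simp
      have "(S *\<^sub>v vec p \<theta>) $ j = y j"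
        using S j by (auto simp: y_def scalar_prod_def atLeast0LessThan symmetric_entries[OF S sym, of j] mult.commute intro!: sum.cong)
      then show "(S *\<^sub>v vec p \<theta>) $ j = 0\<^sub>v p $ j" using y0[OF j] j by simp
    qed (use S in simp)
    moreover have "precision S *\<^sub>v (S *\<^sub>v vec p \<theta>) = (precision S * S) *\<^sub>v vec p \<theta>"
      by (rule assoc_mult_mat_vec[OF precision_inverse(1)[OF S det] S, symmetric]) simp
    ultimately have "vec p \<theta> = precision S *\<^sub>v 0\<^sub>v p"
      using precision_inverse(3)[OF S det] by simp
    also have "\<dots> = 0\<^sub>v p"
      by (rule eq_vecI) (use precision_inverse(1)[OF S det] in auto)
    finally have "vec p \<theta> = 0\<^sub>v p" .
    then show False using nz by (metis index_vec index_zero_vec(1))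
  qed
qed

section \<open>Existence of the Cholesky factor\<close>

lemma forward_substitution:
  fixes L :: "nat \<Rightarrow> nat \<Rightarrow> real"
  assumes "\<forall>i<p. 0 < L i i" "\<forall>j<p. \<forall>i<j. L i j = 0"
  shows "\<exists>x. \<forall>i<p. (\<Sum>l<p. L i l * x l) = c i"
  using assms
proof (induction p)
  case (Suc p)
  then obtain x where x: "\<And>i. i < p \<Longrightarrow> (\<Sum>l<p. L i l * x l) = c i" by auto
  let ?x = "x(p := (c p - (\<Sum>l<p. L p l * x l)) / L p p)"
  have "(\<Sum>l<Suc p. L i l * ?x l) = c i" if "i < Suc p" for i
    using that x[of i] Suc.prems by (cases "i = p") (auto simp: less_Suc_eq)
  then show ?case by blast
qed simp

lemma backward_substitution:
  fixes L :: "nat \<Rightarrow> nat \<Rightarrow> real"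
  assumes "\<forall>i<p. 0 < L i i" "\<forall>j<p. \<forall>i<j. L i j = 0"
  shows "\<exists>x. \<forall>l<p. (\<Sum>i<p. x i * L i l) = c l"
  using assms
proof (induction p arbitrary: c)
  case (Suc p)
  define t where "t = c p / L p p"
  obtain x where x: "\<And>l. l < p \<Longrightarrow> (\<Sum>i<p. x i * L i l) = c l - t * L p l" 
    using Suc.IH[of "\<lambda>l. c l - t * L p l"] Suc.prems by auto
  have "(\<Sum>i<Suc p. (x(p := t)) i * L i l) = c l" if "l < Suc p" for l
    using that x[of l] Suc.prems by (cases "l = p") (auto simp: less_Suc_eq t_def)
  then show ?case by blast
qed simp

text \<open>The factor grows by one row: its part \<open>r\<close> left of the diagonal solves a
  triangular system, and its diagonal entry is the square root of the Schur complement
  \<open>d\<close>. The point is that \<open>d\<close> is positive.\<close>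

lemma cholesky_factor:
  fixes s :: "nat \<Rightarrow> nat \<Rightarrow> real"
  assumes "\<And>i j. i < p \<Longrightarrow> j < p \<Longrightarrow> s i j = s j i"
    and "\<And>\<theta>. (\<exists>i<p. \<theta> i \<noteq> 0) \<Longrightarrow> 0 < (\<Sum>i<p. \<Sum>j<p. \<theta> i * \<theta> j * s i j)"
  shows "\<exists>L. (\<forall>i<p. 0 < L i i) \<and> (\<forall>j<p. \<forall>i<j. L i j = 0) \<and> (\<forall>i<p. \<forall>j<p. s i j = (\<Sum>l<p. L i l * L j l))"
  using assms
proof (induction p)
  case (Suc p)
  have "\<exists>L. (\<forall>i<p. 0 < L i i) \<and> (\<forall>j<p. \<forall>i<j. L i j = 0) \<and> (\<forall>i<p. \<forall>j<p. s i j = (\<Sum>l<p. L i l * L j l))"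
  proof (rule Suc.IH)
    fix \<theta> :: "nat \<Rightarrow> real" assume "\<exists>i<p. \<theta> i \<noteq> 0"
    then have "\<exists>i<Suc p. (\<theta>(p := 0)) i \<noteq> 0" by (metis fun_upd_apply less_SucI less_irrefl)
    from Suc.prems(2)[OF this] show "0 < (\<Sum>i<p. \<Sum>j<p. \<theta> i * \<theta> j * s i j)" by simp
  qed (use Suc.prems in auto)
  then obtain L where L: "\<forall>i<p. 0 < L i i" "\<forall>j<p. \<forall>i<j. L i j = 0"
    "\<And>i j. i < p \<Longrightarrow> j < p \<Longrightarrow> s i j = (\<Sum>l<p. L i l * L j l)" by auto
  obtain r where r: "\<And>i. i < p \<Longrightarrow> (\<Sum>l<p. L i l * r l) = s i p"
    using forward_substitution[OF L(1,2), of "\<lambda>i. s i p"] by auto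
  obtain \<theta> where \<theta>: "\<And>l. l < p \<Longrightarrow> (\<Sum>i<p. \<theta> i * L i l) = r l"
    using backward_substitution[OF L(1,2), of r] by auto
  define d where "d = s p p - (\<Sum>l<p. (r l)\<^sup>2)"
  have q: "(\<Sum>i<p. \<Sum>j<p. \<theta> i * \<theta> j * s i j) = (\<Sum>l<p. (r l)\<^sup>2)"
  proof -
    have "(\<Sum>i<p. \<Sum>j<p. \<theta> i * \<theta> j * s i j) = (\<Sum>i<p. \<Sum>j<p. \<Sum>l<p. (\<theta> i * L i l) * (\<theta> j * L j l))"
      by (simp add: L(3) sum_distrib_left mult_ac)
    also have "\<dots> = (\<Sum>l<p. \<Sum>i<p. \<Sum>j<p. (\<theta> i * L i l) * (\<theta> j * L j l))"
      by (rule trans[OF sum.cong[OF refl sum.swap] sum.swap])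
    also have "\<dots> = (\<Sum>l<p. (r l)\<^sup>2)"
      by (simp add: \<theta>[symmetric] power2_eq_square sum_product)
    finally show ?thesis .
  qed
  have cr: "(\<Sum>i<p. \<theta> i * s i p) = (\<Sum>l<p. (r l)\<^sup>2)"
  proof -
    have "(\<Sum>i<p. \<theta> i * s i p) = (\<Sum>i<p. \<Sum>l<p. (\<theta> i * L i l) * r l)"
      by (simp add: r[symmetric] sum_distrib_left mult_ac)
    also have "\<dots> = (\<Sum>l<p. (\<Sum>i<p. \<theta> i * L i l) * r l)"
      by (subst sum.swap) (simp add: sum_distrib_right)
    also have "\<dots> = (\<Sum>l<p. (r l)\<^sup>2)" by (simp add: \<theta> power2_eq_square)
    finally show ?thesis .
  qed
  \<comment> \<open>Since \<open>L r\<close> is the last column and \<open>L^T \<theta> = r\<close>,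
    the vector \<open>\<theta>\<close> extended by -1 is the one at which the form takes the value
    \<open>d\<close>.\<close>
  have "0 < (\<Sum>i<Suc p. \<Sum>j<Suc p. (\<theta>(p := -1)) i * (\<theta>(p := -1)) j * s i j)"
    by (rule Suc.prems(2)) auto
  also have "\<dots> = (\<Sum>i<p. \<Sum>j<p. \<theta> i * \<theta> j * s i j) - (\<Sum>i<p. \<theta> i * s i p) - (\<Sum>j<p. \<theta> j * s p j) + s p p"
    by (simp add: sum.distrib sum_negf sum_subtractf)
  also have "(\<Sum>j<p. \<theta> j * s p j) = (\<Sum>i<p. \<theta> i * s i p)"
    using Suc.prems(1) by (intro sum.cong) auto
  finally have d: "0 < d" by (simp add: q cr d_def)
  define M where "M i j = (if i < p then (if j < p then L i j else 0) else if j < p then r j else sqrt d)" for i j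
  have "\<forall>i<Suc p. 0 < M i i" using L(1) d by (auto simp: M_def)
  moreover have "\<forall>j<Suc p. \<forall>i<j. M i j = 0" using L(2) by (auto simp: M_def)
  moreover have "s i j = (\<Sum>l<Suc p. M i l * M j l)" if ij: "i < Suc p" "j < Suc p" for i j
  proof -
    consider "i < p" "j < p" | "i < p" "j = p" | "i = p" "j < p" | "i = p" "j = p" using ij by linarith
    then show ?thesis
    proof cases
      case 3
      then have "s i j = (\<Sum>l<p. L j l * r l)" using r[of j] Suc.prems(1)[of p j] by simp
      then show ?thesis using 3 by (simp add: M_def mult.commute)
    qed (use L(3) r d in \<open>auto simp: M_def d_def power2_eq_square\<close>)
  qed
  ultimately show ?case by blast
qed simp

lemma cholesky_exists:
  assumes S: "S \<in> carrier_mat p p" "transpose_mat S = S" and pd: "pos_def p S"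
  shows "\<exists>L. cholesky p S L"
  using cholesky_factor[of p "\<lambda>i j. S $$ (i, j)"] symmetric_entries[OF S] S(1) pd
  by (auto simp: cholesky_def pos_def_def quad_form_def)

text \<open>The form is \<open>|w|^2\<close> with \<open>w = L^T \<theta>\<close>, and
  \<open>\<theta>\<close> is recovered from \<open>w\<close> by the inverse of \<open>L^T\<close>;
  Cauchy-Schwarz in each row gives for \<open>B\<close> the sum of the squared entries of that
  inverse.\<close>

lemma cholesky_coercive:
  assumes "cholesky p S L"
  shows "\<exists>B. \<forall>\<theta>. (\<Sum>i<p. (\<theta> i)\<^sup>2) \<le> B * quad_form p S \<theta>"
proof -
  let ?T = "transpose_mat (lmat p L)"
  have T: "?T \<in> carrier_mat p p" by simp
  have "det ?T \<noteq> 0"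
    unfolding det_transpose[of "lmat p L" p, simplified] cholesky_det_lmat[OF assms]
    by (rule less_imp_neq[OF cholesky_prod_pos[OF assms], symmetric])
  note inv = precision_inverse[OF T this]
  let ?P = "precision ?T"
  have "(\<Sum>i<p. (\<theta> i)\<^sup>2) \<le> (\<Sum>i<p. \<Sum>l<p. (?P $$ (i, l))\<^sup>2) * quad_form p S \<theta>" for \<theta>
  proof -
    define w where "w l = (\<Sum>j<p. \<theta> j * L j l)" for l
    have "?T *\<^sub>v vec p \<theta> = vec p w"
      by (rule eq_vecI) (auto simp: w_def scalar_prod_def atLeast0LessThan mult.commute)
    moreover have "?P *\<^sub>v (?T *\<^sub>v vec p \<theta>) = (?P * ?T) *\<^sub>v vec p \<theta>"
      by (rule assoc_mult_mat_vec[OF inv(1) T, symmetric]) simp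
    ultimately have eq: "vec p \<theta> = ?P *\<^sub>v vec p w" using inv(3) by simp
    have "\<theta> i = (\<Sum>l<p. ?P $$ (i, l) * w l)" if "i < p" for i
      using arg_cong[OF eq, of "\<lambda>v. v $ i"] that inv(1) by (simp add: scalar_prod_def atLeast0LessThan)
    then have "(\<Sum>i<p. (\<theta> i)\<^sup>2) = (\<Sum>i<p. (\<Sum>l<p. ?P $$ (i, l) * w l)\<^sup>2)" by simp
    also have "\<dots> \<le> (\<Sum>i<p. (\<Sum>l<p. (?P $$ (i, l))\<^sup>2) * (\<Sum>l<p. (w l)\<^sup>2))"
      by (intro sum_mono Cauchy_Schwarz_ineq_sum)
    also have "(\<Sum>l<p. (w l)\<^sup>2) = quad_form p S \<theta>"
      unfolding w_def by (rule cholesky_quad_form[OF assms])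
    finally show ?thesis by (simp add: sum_distrib_right)
  qed
  then show ?thesis by blast
qed

section \<open>Rayleigh quotients and extreme eigenvalues\<close>

lemma quad_form_scale: "quad_form p S (\<lambda>i. c * \<theta> i) = c\<^sup>2 * quad_form p S \<theta>"
  by (simp add: quad_form_def sum_distrib_left power2_eq_square mult_ac)

text \<open>If \<open>T - m I\<close> were invertible for the infimum \<open>m\<close> of the Rayleigh quotient, it would have a
  Cholesky factor, hence be bounded below by a positive multiple of the identity.\<close>
lemma rayleigh_inf_eigenvalue:
  assumes T: "T \<in> carrier_mat p p" "transpose_mat T = T" and p: "0 < p"
  shows "\<exists>m \<in> spectrum T. \<forall>\<theta>. m * (\<Sum>i<p. (\<theta> i)\<^sup>2) \<le> quad_form p T \<theta>"
proof -
  define R where "R = {quad_form p T \<theta> | \<theta>. (\<Sum>i<p. (\<theta> i)\<^sup>2) = 1}"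
  define m where "m = Inf R"
  have bdd: "bdd_below R"
  proof (rule bdd_belowI[of _ "- (\<Sum>i<p. \<Sum>j<p. \<bar>T $$ (i, j)\<bar>)"])
    fix r assume "r \<in> R"
    then obtain \<theta> where \<theta>: "r = quad_form p T \<theta>" "(\<Sum>i<p. (\<theta> i)\<^sup>2) = 1" by (auto simp: R_def)
    have le1: "\<bar>\<theta> i\<bar> \<le> 1" if "i < p" for i
    proof -
      have "(\<theta> i)\<^sup>2 \<le> (\<Sum>i<p. (\<theta> i)\<^sup>2)" using that by (intro member_le_sum) auto
      then show ?thesis using \<theta> by (simp add: abs_square_le_1)
    qed
    have "\<bar>r\<bar> \<le> (\<Sum>i<p. \<Sum>j<p. \<bar>\<theta> i * \<theta> j * T $$ (i, j)\<bar>)"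
      unfolding \<theta> quad_form_def by (rule order_trans[OF sum_abs sum_mono[OF sum_abs]])
    also have "\<dots> \<le> (\<Sum>i<p. \<Sum>j<p. \<bar>T $$ (i, j)\<bar>)"
      by (intro sum_mono) (auto simp: abs_mult intro!: mult_left_le_one_le mult_le_one le1)
    finally show "- (\<Sum>i<p. \<Sum>j<p. \<bar>T $$ (i, j)\<bar>) \<le> r" by linarith
  qed
  define e0 :: "nat \<Rightarrow> real" where "e0 i = (if i = 0 then 1 else 0)" for i
  have "(\<Sum>i<p. (e0 i)\<^sup>2) = (\<Sum>i<p. if i = 0 then 1 else 0)"
    by (intro sum.cong) (auto simp: e0_def)
  then have unit: "(\<Sum>i<p. (e0 i)\<^sup>2) = 1" using p by simp
  then have "quad_form p T e0 \<in> R" unfolding R_def by blast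
  then have ne: "R \<noteq> {}" by blast
  have lower: "m * (\<Sum>i<p. (\<theta> i)\<^sup>2) \<le> quad_form p T \<theta>" for \<theta>
  proof (cases "(\<Sum>i<p. (\<theta> i)\<^sup>2) = 0")
    case True
    then have "quad_form p T \<theta> = 0" by (auto simp: quad_form_def sum_nonneg_eq_0_iff)
    with True show ?thesis by simp
  next
    case False
    define q where "q = (\<Sum>i<p. (\<theta> i)\<^sup>2)"
    have q: "0 < q" using False sum_nonneg[of "{..<p}" "\<lambda>i. (\<theta> i)\<^sup>2"] by (simp add: q_def less_le)
    have "(\<Sum>i<p. ((1 / sqrt q) * \<theta> i)\<^sup>2) = 1"
      using q by (simp only: power_mult_distrib sum_distrib_left[symmetric] q_def[symmetric]) (simp add: power_divide)
    then have "quad_form p T (\<lambda>i. (1 / sqrt q) * \<theta> i) \<in> R" unfolding R_def by blast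
    then have "m \<le> quad_form p T (\<lambda>i. (1 / sqrt q) * \<theta> i)" unfolding m_def by (rule cInf_lower[OF _ bdd])
    also have "\<dots> = quad_form p T \<theta> / q" using q unfolding quad_form_scale by (simp add: power_divide)
    finally show ?thesis using q by (simp add: q_def[symmetric] field_simps)
  qed
  define A where "A = char_matrix T m"
  have A: "A \<in> carrier_mat p p" using T by (simp add: A_def)
  have Aij: "A $$ (i, j) = T $$ (i, j) - (if i = j then m else 0)" if "i < p" "j < p" for i j
    using T that by (simp add: A_def char_matrix_def)
  have symA: "transpose_mat A = A"
    using A by (intro eq_matI) (auto simp: Aij symmetric_entries[OF T])
  have qA: "quad_form p A \<theta> = quad_form p T \<theta> - m * (\<Sum>i<p. (\<theta> i)\<^sup>2)" for \<theta>
  proof -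
    have "quad_form p A \<theta> = (\<Sum>i<p. \<Sum>j<p. \<theta> i * \<theta> j * T $$ (i, j) - (if i = j then m * (\<theta> i)\<^sup>2 else 0))"
      unfolding quad_form_def by (intro sum.cong refl) (auto simp: Aij power2_eq_square algebra_simps)
    then show ?thesis by (simp add: sum_subtractf quad_form_def sum.delta sum_distrib_left)
  qed
  have "covariance_matrix p A"
    unfolding covariance_matrix_def
  proof (intro conjI ballI A symA)
    fix v :: "real vec" assume "v \<in> carrier_vec p"
    then have "v = vec p (\<lambda>i. v $ i)" by auto
    then show "0 \<le> v \<bullet> (A *\<^sub>v v)" using quad_form_vec[OF A, of "\<lambda>i. v $ i"] lower[of "\<lambda>i. v $ i"] qA by simp
  qed
  have "det A = 0"
  proof (rule ccontr)
    assume "det A \<noteq> 0"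
    from cholesky_exists[OF A symA covariance_pos_def[OF \<open>covariance_matrix p A\<close> this]]
    obtain L where "cholesky p A L" by blast
    then obtain B where B: "\<And>\<theta>. (\<Sum>i<p. (\<theta> i)\<^sup>2) \<le> B * quad_form p A \<theta>" using cholesky_coercive by blast
    have "quad_form p A \<theta> \<ge> 0" for \<theta> using lower[of \<theta>] by (simp add: qA)
    have B0: "0 < B"
    proof (rule ccontr)
      assume "\<not> 0 < B"
      then have "B * quad_form p A e0 \<le> 0"
        using \<open>\<And>\<theta>. quad_form p A \<theta> \<ge> 0\<close> by (intro mult_nonpos_nonneg) auto
      with B[of e0] unit show False by linarith
    qed
    have "m + 1 / B \<le> m"
      unfolding m_def
    proof (subst m_def[symmetric], rule cInf_greatest[OF ne])
      fix r assume "r \<in> R"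
      then obtain \<theta> where \<theta>: "r = quad_form p T \<theta>" "(\<Sum>i<p. (\<theta> i)\<^sup>2) = 1" by (auto simp: R_def)
      from B[of \<theta>] \<theta> have "1 \<le> B * (r - m)" by (simp add: qA)
      then show "m + 1 / B \<le> r" using B0 by (simp add: field_simps)
    qed
    then show False using B0 by simp
  qed
  then have "m \<in> spectrum T"
    using eigenvalue_det[OF T(1), of m] by (simp add: spectrum_def A_def)
  with lower show ?thesis by blast
qed

lemma eigenvector_quad_form:
  assumes S: "S \<in> carrier_mat p p" and "m \<in> spectrum S"
  shows "\<exists>\<theta>. (\<exists>i<p. \<theta> i \<noteq> 0) \<and> quad_form p S \<theta> = m * (\<Sum>i<p. (\<theta> i)\<^sup>2)"
proof -
  obtain v where v: "v \<in> carrier_vec p" "v \<noteq> 0\<^sub>v p" "S *\<^sub>v v = m \<cdot>\<^sub>v v"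
    using assms by (auto simp: spectrum_def eigenvalue_def eigenvector_def)
  have vv: "vec p (\<lambda>i. v $ i) = v" using v by auto
  have "\<exists>i<p. v $ i \<noteq> 0" using v by (metis carrier_vecD eq_vecI index_zero_vec)
  moreover have "quad_form p S (\<lambda>i. v $ i) = v \<bullet> (m \<cdot>\<^sub>v v)"
    using quad_form_vec[OF S, of "\<lambda>i. v $ i"] v vv by simp
  moreover have "\<dots> = m * (\<Sum>i<p. (v $ i)\<^sup>2)"
    using v by (simp add: scalar_prod_def atLeast0LessThan sum_distrib_left power2_eq_square mult_ac)
  ultimately show ?thesis by (intro exI[of _ "\<lambda>i. v $ i"]) auto
qed

text \<open>The upper bound is the lower bound for \<open>- S\<close>, whose eigenvalues are the
  negatives of those of \<open>S\<close>. Positivity follows by evaluating the form at an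
  eigenvector for the smallest eigenvalue.\<close>

lemma lambda_bounds:
  assumes cov: "covariance_matrix p S" and det: "det S \<noteq> 0" and p: "0 < p"
  shows "0 < lambda_min S"
    "lambda_min S * (\<Sum>i<p. (\<theta> i)\<^sup>2) \<le> quad_form p S \<theta>"
    "quad_form p S \<theta> \<le> lambda_max S * (\<Sum>i<p. (\<theta> i)\<^sup>2)"
proof -
  have S: "S \<in> carrier_mat p p" "transpose_mat S = S" using cov by (auto simp: covariance_matrix_def)
  have fin: "finite (spectrum S)" by (rule card_finite_spectrum[OF S(1)])
  obtain m where m: "m \<in> spectrum S" "\<And>\<theta>. m * (\<Sum>i<p. (\<theta> i)\<^sup>2) \<le> quad_form p S \<theta>"
    using rayleigh_inf_eigenvalue[OF S p] by blast
  have "lambda_min S \<le> m" unfolding lambda_min_def by (rule Min_le[OF fin m(1)])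
  then have "lambda_min S * (\<Sum>i<p. (\<theta> i)\<^sup>2) \<le> m * (\<Sum>i<p. (\<theta> i)\<^sup>2)" by (intro mult_right_mono sum_nonneg) auto
  with m(2)[of \<theta>] show "lambda_min S * (\<Sum>i<p. (\<theta> i)\<^sup>2) \<le> quad_form p S \<theta>" by linarith
  have "lambda_min S \<in> spectrum S" unfolding lambda_min_def using fin m(1) by (intro Min_in) auto
  then obtain \<theta>' where \<theta>': "\<exists>i<p. \<theta>' i \<noteq> 0" "quad_form p S \<theta>' = lambda_min S * (\<Sum>i<p. (\<theta>' i)\<^sup>2)"
    using eigenvector_quad_form[OF S(1)] by blast
  have "0 < lambda_min S * (\<Sum>i<p. (\<theta>' i)\<^sup>2)"
    using covariance_pos_def[OF cov det] \<theta>' by (auto simp: pos_def_def)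
  moreover have "0 \<le> (\<Sum>i<p. (\<theta>' i)\<^sup>2)" by (intro sum_nonneg) auto
  ultimately show "0 < lambda_min S" by (simp add: zero_less_mult_iff)
  have mS: "- S \<in> carrier_mat p p" "transpose_mat (- S) = - S"
    using S(1) by (auto simp: symmetric_entries[OF S] intro!: eq_matI)
  obtain k where k: "k \<in> spectrum (- S)" "\<And>\<theta>. k * (\<Sum>i<p. (\<theta> i)\<^sup>2) \<le> quad_form p (- S) \<theta>"
    using rayleigh_inf_eigenvalue[OF mS p] by blast
  have "char_matrix S (- k) = (-1) \<cdot>\<^sub>m char_matrix (- S) k"
    using S(1) by (intro eq_matI) (auto simp: char_matrix_def)
  then have "det (char_matrix S (- k)) = 0"
    using eigenvalue_det[OF mS(1), of k] k(1) by (simp add: spectrum_def)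
  then have "- k \<in> spectrum S" using eigenvalue_det[OF S(1)] by (simp add: spectrum_def)
  then have "- k \<le> lambda_max S" unfolding lambda_max_def by (rule Max_ge[OF fin])
  then have "- k * (\<Sum>i<p. (\<theta> i)\<^sup>2) \<le> lambda_max S * (\<Sum>i<p. (\<theta> i)\<^sup>2)" by (intro mult_right_mono sum_nonneg) auto
  moreover have "quad_form p (- S) \<theta> = - quad_form p S \<theta>"
    using S(1) by (simp add: quad_form_def sum_negf)
  ultimately show "quad_form p S \<theta> \<le> lambda_max S * (\<Sum>i<p. (\<theta> i)\<^sup>2)" using k(2)[of \<theta>] by simp
qed

section \<open>Deterministic analysis of the square-root Lasso\<close>

lemma quad_form_cong: "(\<And>j. j < p \<Longrightarrow> x j = y j) \<Longrightarrow> quad_form p M x = quad_form p M y"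
  by (simp add: quad_form_def)

lemma quad_form_single:
  assumes "l < p" shows "quad_form p M (\<lambda>j. if j = l then t else 0) = t\<^sup>2 * M $$ (l, l)"
proof -
  have "(\<Sum>j<p. t * (if j = l then t else 0) * M $$ (l, j)) = (\<Sum>j<p. if j = l then t * t * M $$ (l, l) else 0)"
    by (intro sum.cong) auto
  also have "\<dots> = t * t * M $$ (l, l)" using assms by simp
  finally have inner: "(\<Sum>j<p. t * (if j = l then t else 0) * M $$ (l, j)) = t * t * M $$ (l, l)" .
  have "quad_form p M (\<lambda>j. if j = l then t else 0) =
      (\<Sum>i<p. if i = l then (\<Sum>j<p. t * (if j = l then t else 0) * M $$ (l, j)) else 0)"
    unfolding quad_form_def by (intro sum.cong refl) simp
  then show ?thesis unfolding inner using assms by (simp add: power2_eq_square)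
qed

section \<open>Maurey's method and restricted eigenvalues\<close>

lemma weighted_average_le:
  fixes q F :: "'i \<Rightarrow> real"
  assumes "finite I" "\<And>i. i \<in> I \<Longrightarrow> 0 \<le> q i" "(\<Sum>i\<in>I. q i) = 1"
  shows "\<exists>i\<in>I. F i \<le> (\<Sum>i\<in>I. q i * F i)"
proof (rule ccontr)
  define c where "c = (\<Sum>i\<in>I. q i * F i)"
  assume "\<not> (\<exists>i\<in>I. F i \<le> (\<Sum>i\<in>I. q i * F i))"
  then have less: "c < F i" if "i \<in> I" for i using that by (auto simp: c_def)
  obtain k where k: "k \<in> I" "0 < q k"
    using assms by (metis less_eq_real_def sum.neutral zero_neq_one)
  have "(\<Sum>i\<in>I. q i * c) < (\<Sum>i\<in>I. q i * F i)"
    using assms(1,2) k less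
    by (intro sum_strict_mono_ex1 ballI bexI[of _ k] mult_left_mono mult_strict_left_mono)
      (auto intro: less_imp_le)
  then show False using assms(3) by (simp add: c_def sum_distrib_right[symmetric])
qed

text \<open>A derandomised form of Maurey's empirical method: the atoms are chosen greedily, one at a time,
  so that the value of the quadratic form never exceeds its conditional expectation.\<close>
lemma maurey_greedy:
  fixes a :: "'i \<Rightarrow> nat \<Rightarrow> real" and q :: "'i \<Rightarrow> real"
  assumes sym: "\<And>i j. i < p \<Longrightarrow> j < p \<Longrightarrow> M $$ (i, j) = M $$ (j, i)"
    and I: "finite I" "\<And>i. i \<in> I \<Longrightarrow> 0 \<le> q i" "(\<Sum>i\<in>I. q i) = 1"
    and u: "\<And>j. u j = (\<Sum>i\<in>I. q i * a i j)"
  shows "\<exists>is. length is = m \<and> set is \<subseteq> I \<and>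
    quad_form p M (\<lambda>j. x j + (\<Sum>i\<leftarrow>is. a i j)) \<le>
      quad_form p M (\<lambda>j. x j + real m * u j) + real m * ((\<Sum>i\<in>I. q i * quad_form p M (a i)) - quad_form p M u)"
\<comment> \<open>The vector \<open>x\<close> is general because it absorbs the atoms that have
  already been chosen.\<close>
proof (induction m arbitrary: x)
  case 0
  then show ?case by simp
next
  case (Suc m)
  let ?Q = "quad_form p M" and ?V = "\<Sum>i\<in>I. q i * quad_form p M (a i)"
  \<comment> \<open>All atoms but the next one are replaced by their mean \<open>u\<close>.
    Averaging the form over the next atom then exceeds its value at \<open>y + u\<close> by the
    variance term \<open>?V - ?Q u\<close>, and some atom does no worse than the average.\<close>
  define y where "y j = x j + real m * u j" for j
  have add: "?Q (\<lambda>j. y j + v j) = ?Q y + 2 * bil_form p M y v + ?Q v" for v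
    using quad_form_add_scaled[OF sym, where x = y and t = 1 and y = v] by simp
  have lin: "bil_form p M y u = (\<Sum>i\<in>I. q i * bil_form p M y (a i))"
  proof -
    have "(\<Sum>i\<in>I. q i * bil_form p M y (a i)) = (\<Sum>k<p. \<Sum>l<p. \<Sum>i\<in>I. q i * (y k * a i l * M $$ (k, l)))"
      unfolding bil_form_def sum_distrib_left
      by (subst sum.swap, rule sum.cong[OF refl], rule sum.swap)
    then show ?thesis
      by (simp add: bil_form_def u sum_distrib_left sum_distrib_right mult_ac)
  qed
  have "(\<Sum>i\<in>I. q i * ?Q (\<lambda>j. y j + a i j)) = ?Q y + 2 * bil_form p M y u + ?V"
    using I(3) by (simp add: add algebra_simps sum.distrib lin sum_distrib_left)
      (simp add: sum_distrib_left[symmetric] sum_distrib_right[symmetric])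
  moreover obtain i where i: "i \<in> I" "?Q (\<lambda>j. y j + a i j) \<le> (\<Sum>i\<in>I. q i * ?Q (\<lambda>j. y j + a i j))"
    using weighted_average_le[OF I, of "\<lambda>i. ?Q (\<lambda>j. y j + a i j)"] by blast
  ultimately have step: "?Q (\<lambda>j. y j + a i j) \<le> ?Q (\<lambda>j. y j + u j) + (?V - ?Q u)"
    by (simp add: add)
  obtain "is" where is_: "length is = m" "set is \<subseteq> I"
    "?Q (\<lambda>j. (x j + a i j) + (\<Sum>i\<leftarrow>is. a i j)) \<le> ?Q (\<lambda>j. (x j + a i j) + real m * u j) + real m * (?V - ?Q u)"
    using Suc.IH[of "\<lambda>j. x j + a i j"] by blast
  have "(\<lambda>j. (x j + a i j) + real m * u j) = (\<lambda>j. y j + a i j)" by (simp add: y_def fun_eq_iff)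
  moreover have "(\<lambda>j. y j + u j) = (\<lambda>j. x j + real (Suc m) * u j)" by (simp add: y_def fun_eq_iff algebra_simps)
  moreover have "(\<lambda>j. (x j + a i j) + (\<Sum>i\<leftarrow>is. a i j)) = (\<lambda>j. x j + (\<Sum>i\<leftarrow>i # is. a i j))"
    by (simp add: fun_eq_iff)
  ultimately have "?Q (\<lambda>j. x j + (\<Sum>i\<leftarrow>i # is. a i j)) \<le> ?Q (\<lambda>j. x j + real (Suc m) * u j) + real (Suc m) * (?V - ?Q u)"
    using is_(3) step by (simp add: algebra_simps)
  with is_ i(1) show ?case by (intro exI[of _ "i # is"]) auto
qed

text \<open>Each summand is a signed coordinate vector scaled to have unit length in the metric of
  \<open>S\<close>. Maurey's average over \<open>m\<close> atoms is left undivided by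
  \<open>m\<close>, as only the sign of a quadratic form matters. Repetitions are allowed and
  opposite signs may cancel.\<close>

definition grid_point :: "real mat \<Rightarrow> (nat \<times> real) list \<Rightarrow> nat \<Rightarrow> real" where
  "grid_point S ls j = (\<Sum>(l, s)\<leftarrow>ls. if j = l then s / sqrt (S $$ (l, l)) else 0)"

definition signed_lists :: "nat \<Rightarrow> nat \<Rightarrow> (nat \<times> real) list set" where
  "signed_lists p m = {ls. set ls \<subseteq> {..<p} \<times> {- 1, 1} \<and> length ls = m}"

text \<open>Its sign decides whether \<open>|X u|^2 >= n u^T S u / 4\<close>. It is again a
  quadratic form in \<open>u\<close>, in general indefinite, and Maurey's method asks only for
  symmetry.\<close>

definition excess :: "nat \<Rightarrow> nat \<Rightarrow> real mat \<Rightarrow> (nat \<Rightarrow> nat \<Rightarrow> real) \<Rightarrow> (nat \<Rightarrow> real) \<Rightarrow> real" where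
  "excess n p S x u = (\<Sum>i<n. (lin_form p u (x i))\<^sup>2) - real n / 4 * quad_form p S u"

lemma sum_squares_lin_form:
  "(\<Sum>i<n. (lin_form p u (x i))\<^sup>2) = (\<Sum>a<p. \<Sum>b<p. u a * u b * (\<Sum>i<n. x i a * x i b))"
proof -
  have "(\<Sum>i<n. (lin_form p u (x i))\<^sup>2) = (\<Sum>i<n. \<Sum>a<p. \<Sum>b<p. u a * u b * (x i a * x i b))"
    by (simp add: power2_eq_square sum_product mult_ac)
  also have "\<dots> = (\<Sum>a<p. \<Sum>b<p. \<Sum>i<n. u a * u b * (x i a * x i b))"
    by (subst sum.swap, rule sum.cong[OF refl], rule sum.swap)
  finally show ?thesis by (simp add: sum_distrib_left)
qed

lemma excess_quad_form:
  assumes S: "S \<in> carrier_mat p p"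
  shows "excess n p S x u = quad_form p (mat p p (\<lambda>(a, b). (\<Sum>i<n. x i a * x i b) - real n / 4 * S $$ (a, b))) u"
  unfolding excess_def sum_squares_lin_form
  by (simp add: quad_form_def right_diff_distrib sum_subtractf sum_distrib_left mult_ac)

text \<open>With \<open>r\<close> the scaled \<open>l1\<close> norm, \<open>u / r\<close> is a
  convex combination of signed atoms with weights \<open>\<bar>u j\<bar> sqrt (S_jj) / r\<close>.
  For the form \<open>Q\<close>, Maurey's method finds a grid point with
  \<open>0 <= m^2 Q(u / r) + m (4 n - Q(u / r))\<close>, since every atom has
  \<open>Q <= 4 n\<close> by the column bound. Multiplying by \<open>r^2 / m\<close> gives the
  claim, the factor \<open>m - 1\<close> being \<open>m^2 - m\<close> divided by
  \<open>m\<close>.\<close>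

lemma excess_lower_bound:
  assumes S: "S \<in> carrier_mat p p" "transpose_mat S = S" and diag: "\<And>j. j < p \<Longrightarrow> 0 < S $$ (j, j)"
    and m: "2 \<le> m"
    and grid: "\<And>ls. ls \<in> signed_lists p m \<Longrightarrow> 0 \<le> excess n p S x (grid_point S ls)"
    and col: "\<And>j. j < p \<Longrightarrow> (\<Sum>i<n. (x i j)\<^sup>2) \<le> 4 * (real n * S $$ (j, j))"
  shows "- (4 * real n * (\<Sum>j<p. \<bar>u j\<bar> * sqrt (S $$ (j, j)))\<^sup>2) \<le> (real m - 1) * excess n p S x u"
proof -
  define r where "r = (\<Sum>j<p. \<bar>u j\<bar> * sqrt (S $$ (j, j)))"
  have r0: "0 \<le> r" unfolding r_def by (intro sum_nonneg mult_nonneg_nonneg) (auto intro!: less_imp_le[OF diag])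
  define M where "M = mat p p (\<lambda>(a, b). (\<Sum>i<n. x i a * x i b) - real n / 4 * S $$ (a, b))"
  have ex: "excess n p S x v = quad_form p M v" for v
    unfolding M_def by (rule excess_quad_form[OF S(1)])
  have symM: "M $$ (i, j) = M $$ (j, i)" if "i < p" "j < p" for i j
    using that symmetric_entries[OF S that] by (simp add: M_def mult.commute)
  show ?thesis
  proof (cases "r = 0")
    case True
    then have "\<forall>j\<in>{..<p}. \<bar>u j\<bar> * sqrt (S $$ (j, j)) = 0"
      unfolding r_def by (subst (asm) sum_nonneg_eq_0_iff) (auto intro!: mult_nonneg_nonneg less_imp_le[OF diag])
    then have "u j = 0" if "j < p" for j using that diag[of j] by auto
    then have "excess n p S x u = 0" unfolding ex by (simp add: quad_form_def)
    with True show ?thesis by (simp add: r_def)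
  next
    case False
    with r0 have r: "0 < r" by simp
    define sg :: "nat \<Rightarrow> real" where "sg j = (if u j < 0 then -1 else 1)" for j
    define a where "a l j = (if j = l then sg l / sqrt (S $$ (l, l)) else 0)" for l j
    define q where "q j = \<bar>u j\<bar> * sqrt (S $$ (j, j)) / r" for j
    define v where "v j = (\<Sum>l\<in>{..<p}. q l * a l j)" for j
    have q0: "0 \<le> q j" if "j \<in> {..<p}" for j using that diag[of j] r by (simp add: q_def)
    have q1: "(\<Sum>j<p. q j) = 1" using r by (simp add: q_def sum_divide_distrib[symmetric] r_def[symmetric])
    have v: "v j = (1 / r) * u j" if "j < p" for j
    proof -
      have "v j = (\<Sum>l<p. if j = l then q l * (sg l / sqrt (S $$ (l, l))) else 0)"
        unfolding v_def a_def by (intro sum.cong) auto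
      also have "\<dots> = q j * (sg j / sqrt (S $$ (j, j)))" using that by simp
      also have "\<dots> = (1 / r) * u j" using diag[OF that] r by (simp add: q_def sg_def)
      finally show ?thesis .
    qed
    have Qv: "quad_form p M (\<lambda>j. c * v j) = (c / r)\<^sup>2 * quad_form p M u" for c
    proof -
      have "quad_form p M (\<lambda>j. c * v j) = quad_form p M (\<lambda>j. (c / r) * u j)"
        by (rule quad_form_cong) (simp add: v)
      then show ?thesis by (simp only: quad_form_scale)
    qed
    \<comment> \<open>For a single atom the negative part of the form is dropped and the upper bound
      on the column norm is used.\<close>
    have Qa: "quad_form p M (a l) \<le> 4 * real n" if l: "l < p" for l
    proof -
      have "quad_form p M (a l) = (sg l / sqrt (S $$ (l, l)))\<^sup>2 * M $$ (l, l)"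
        unfolding a_def by (rule quad_form_single[OF l])
      also have "(sg l / sqrt (S $$ (l, l)))\<^sup>2 = 1 / S $$ (l, l)"
        using diag[OF l] by (simp add: power_divide sg_def)
      finally have eq: "quad_form p M (a l) = 1 / S $$ (l, l) * M $$ (l, l)" .
      have "M $$ (l, l) \<le> 4 * (real n * S $$ (l, l))"
        using l col[OF l] diag[OF l] by (simp add: M_def power2_eq_square) 
          (smt (verit, best) divide_nonneg_nonneg mult_nonneg_nonneg of_nat_0_le_iff)
      then show ?thesis unfolding eq using diag[OF l] by (simp add: pos_divide_le_eq)
    qed
    obtain ks where ks: "length ks = m" "set ks \<subseteq> {..<p}"
      and le: "quad_form p M (\<lambda>j. 0 + (\<Sum>i\<leftarrow>ks. a i j)) \<le> quad_form p M (\<lambda>j. 0 + real m * v j)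
          + real m * ((\<Sum>l<p. q l * quad_form p M (a l)) - quad_form p M v)"
      using maurey_greedy[where M = M and p = p and I = "{..<p}" and q = q and u = v and a = a and m = m
        and x = "\<lambda>_. 0", OF symM finite_lessThan q0 q1 v_def] by auto
    define ls where "ls = map (\<lambda>l. (l, sg l)) ks"
    have ls: "ls \<in> signed_lists p m" using ks by (auto simp: ls_def signed_lists_def sg_def)
    have "grid_point S ls = (\<lambda>j. 0 + (\<Sum>i\<leftarrow>ks. a i j))"
      by (simp add: grid_point_def ls_def a_def comp_def fun_eq_iff)
    then have "0 \<le> quad_form p M (\<lambda>j. 0 + (\<Sum>i\<leftarrow>ks. a i j))" using grid[OF ls] by (simp add: ex)
    with le have "0 \<le> (real m / r)\<^sup>2 * quad_form p M u
       + real m * ((\<Sum>l<p. q l * quad_form p M (a l)) - (1 / r)\<^sup>2 * quad_form p M u)"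
      using Qv[of "real m"] Qv[of 1] by simp
    moreover have "(\<Sum>l<p. q l * quad_form p M (a l)) \<le> (\<Sum>l<p. q l * (4 * real n))"
      using q0 Qa by (intro sum_mono mult_left_mono) auto
    moreover have "\<dots> = 4 * real n" by (simp only: sum_distrib_right[symmetric] q1)
    ultimately have "0 \<le> (real m / r)\<^sup>2 * quad_form p M u + real m * (4 * real n - (1 / r)\<^sup>2 * quad_form p M u)"
      by (smt (verit, best) mult_left_mono of_nat_0_le_iff)
    also have "\<dots> = real m / r\<^sup>2 * ((real m - 1) * quad_form p M u + 4 * real n * r\<^sup>2)"
      using r by (simp add: power2_eq_square field_simps)
    finally have "real m / r\<^sup>2 * 0 \<le> real m / r\<^sup>2 * ((real m - 1) * quad_form p M u + 4 * real n * r\<^sup>2)"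
      by simp
    then have "0 \<le> (real m - 1) * quad_form p M u + 4 * real n * r\<^sup>2"
      by (rule mult_left_le_imp_le) (use r m in simp)
    then show ?thesis by (simp add: ex r_def)
  qed
qed

text \<open>The list that repeats one atom \<open>m\<close> times belongs to the grid, so lower
  bounds on column norms need no event of their own.\<close>

lemma column_lower_bound:
  assumes S: "S \<in> carrier_mat p p" and diag: "0 < S $$ (j, j)" and j: "j < p" and m: "1 \<le> m"
    and grid: "\<And>ls. ls \<in> signed_lists p m \<Longrightarrow> 0 \<le> excess n p S x (grid_point S ls)"
  shows "real n * S $$ (j, j) / 4 \<le> (\<Sum>i<n. (x i j)\<^sup>2)"
proof -
  define ls where "ls = replicate m (j, 1 :: real)"
  have "grid_point S ls = (\<lambda>k. if k = j then real m / sqrt (S $$ (j, j)) else 0)"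
    by (auto simp: grid_point_def ls_def sum_list_replicate fun_eq_iff)
  moreover have "ls \<in> signed_lists p m" using j by (auto simp: ls_def signed_lists_def)
  ultimately have "0 \<le> excess n p S x (\<lambda>k. if k = j then real m / sqrt (S $$ (j, j)) else 0)"
    using grid by metis
  also have "\<dots> = (real m / sqrt (S $$ (j, j)))\<^sup>2 * ((\<Sum>i<n. (x i j)\<^sup>2) - real n / 4 * S $$ (j, j))"
    unfolding excess_quad_form[OF S] quad_form_single[OF j] using j by (simp add: power2_eq_square)
  finally show ?thesis using diag m by (simp add: zero_le_mult_iff)
qed

text \<open>In the cone the \<open>l1\<close> norm is controlled by the \<open>l2\<close> norm, and
  the latter by the form \<open>q\<close> of \<open>S\<close> at the price of
  \<open>lmax / lmin\<close>. Hence the loss in Maurey's method is a multiple of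
  \<open>n q k (lmax / lmin) / (m - 1)\<close>; for \<open>m\<close> large enough it is at most
  \<open>n q / 8\<close>, half of the main term \<open>n q / 4\<close>.\<close>

lemma restricted_eigenvalue:
  assumes S: "S \<in> carrier_mat p p" "transpose_mat S = S" and diag: "\<And>j. j < p \<Longrightarrow> 0 < S $$ (j, j)"
    and lmin: "0 < lmin" "\<And>\<theta>. lmin * (\<Sum>j<p. (\<theta> j)\<^sup>2) \<le> quad_form p S \<theta>"
    and lmax: "\<And>j. j < p \<Longrightarrow> S $$ (j, j) \<le> lmax"
    and n: "1 \<le> n" and m: "2 \<le> m" "4608 * (real k * (lmax / lmin)) \<le> real m - 1"
    and grid: "\<And>ls. ls \<in> signed_lists p m \<Longrightarrow> 0 \<le> excess n p S x (grid_point S ls)"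
    and col: "\<And>j. j < p \<Longrightarrow> (\<Sum>i<n. (x i j)\<^sup>2) \<le> 4 * (real n * S $$ (j, j))"
    and cone: "(\<Sum>j<p. \<bar>u j\<bar> * sqrt (\<Sum>i<n. (x i j)\<^sup>2))\<^sup>2 \<le> 9 * real k * (\<Sum>j<p. (u j)\<^sup>2 * (\<Sum>i<n. (x i j)\<^sup>2))"
  shows "lmin / lmax / 32 * (\<Sum>j<p. (u j)\<^sup>2 * (\<Sum>i<n. (x i j)\<^sup>2)) \<le> (\<Sum>i<n. (lin_form p u (x i))\<^sup>2)"
proof (cases "p = 0")
  case True
  then show ?thesis by simp
next
  case False
  define c where "c j = (\<Sum>i<n. (x i j)\<^sup>2)" for j
  define \<Delta> where "\<Delta> = (\<Sum>j<p. (u j)\<^sup>2 * c j)"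
  define N where "N = (\<Sum>j<p. \<bar>u j\<bar> * sqrt (c j))"
  define r where "r = (\<Sum>j<p. \<bar>u j\<bar> * sqrt (S $$ (j, j)))"
  define q where "q = quad_form p S u"
  define \<kappa> where "\<kappa> = lmax / lmin"
  have lmax0: "0 < lmax" using diag[of 0] lmax[of 0] False by linarith
  have \<kappa>: "0 < \<kappa>" using lmax0 lmin(1) by (simp add: \<kappa>_def)
  have q0: "0 \<le> q"
    using lmin(2)[of u] mult_nonneg_nonneg[OF less_imp_le[OF lmin(1)] sum_nonneg[of "{..<p}" "\<lambda>j. (u j)\<^sup>2"]]
    by (simp add: q_def)
  have "sqrt (S $$ (j, j)) \<le> 2 / sqrt (real n) * sqrt (c j)" if j: "j < p" for j
  proof -
    have "real n * S $$ (j, j) / 4 \<le> c j"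
      unfolding c_def by (rule column_lower_bound[OF S(1) diag[OF j] j, of m]) (use m grid in auto)
    then have "S $$ (j, j) \<le> 4 / real n * c j" using n by (simp add: field_simps)
    then have "sqrt (S $$ (j, j)) \<le> sqrt (4 / real n * c j)" by simp
    then show ?thesis by (simp add: real_sqrt_mult real_sqrt_divide)
  qed
  then have "r \<le> (\<Sum>j<p. \<bar>u j\<bar> * (2 / sqrt (real n) * sqrt (c j)))"
    unfolding r_def by (intro sum_mono mult_left_mono) auto
  also have "\<dots> = 2 / sqrt (real n) * N" by (simp add: N_def sum_distrib_left mult_ac)
  finally have rN: "r \<le> 2 / sqrt (real n) * N" .
  have r0: "0 \<le> r" unfolding r_def by (intro sum_nonneg mult_nonneg_nonneg) (auto intro!: less_imp_le[OF diag])
  have \<Delta>: "\<Delta> \<le> 4 * real n * \<kappa> * q"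
  proof -
    have "\<Delta> \<le> (\<Sum>j<p. (u j)\<^sup>2 * (4 * (real n * lmax)))"
      unfolding \<Delta>_def c_def using col lmax
      by (intro sum_mono mult_left_mono) (auto intro!: order_trans[OF col] mult_left_mono)
    also have "\<dots> = 4 * real n * \<kappa> * (lmin * (\<Sum>j<p. (u j)\<^sup>2))"
      using lmin(1) by (simp add: \<kappa>_def sum_distrib_left mult_ac)
    also have "\<dots> \<le> 4 * real n * \<kappa> * q"
      using lmin(2)[of u] \<kappa> by (intro mult_left_mono) (auto simp: q_def)
    finally show ?thesis .
  qed
  have "r\<^sup>2 \<le> (2 / sqrt (real n) * N)\<^sup>2" using rN r0 by (intro power_mono)
  also have "\<dots> = 4 / real n * N\<^sup>2" using n by (simp add: power_mult_distrib power_divide)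
  also have "\<dots> \<le> 4 / real n * (9 * real k * \<Delta>)"
    using cone by (intro mult_left_mono) (auto simp: N_def \<Delta>_def c_def)
  also have "\<dots> \<le> 4 / real n * (9 * real k * (4 * real n * \<kappa> * q))"
    using \<Delta> by (intro mult_left_mono) auto
  also have "\<dots> = 144 * (real k * \<kappa>) * q" using n by (simp add: field_simps)
  finally have r2: "r\<^sup>2 \<le> 144 * (real k * \<kappa>) * q" .
  \<comment> \<open>The required size of \<open>m\<close> comes from here:
    \<open>4608 = 8 * 4 * 144\<close>.\<close>
  have "4 * real n * r\<^sup>2 \<le> 4 * real n * (144 * (real k * \<kappa>) * q)" using r2 by (intro mult_left_mono) auto
  also have "\<dots> = real n / 8 * q * (4608 * (real k * \<kappa>))" by simp
  also have "\<dots> \<le> real n / 8 * q * (real m - 1)" using m(2) q0 by (intro mult_left_mono) (auto simp: \<kappa>_def)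
  finally have "- (real n / 8 * q * (real m - 1)) \<le> - (4 * real n * r\<^sup>2)" by simp
  also have "\<dots> \<le> (real m - 1) * excess n p S x u"
    unfolding r_def by (rule excess_lower_bound[OF S diag m(1) grid col])
  finally have "(real m - 1) * (- (real n / 8 * q)) \<le> (real m - 1) * excess n p S x u" by (simp add: mult_ac)
  then have "- (real n / 8 * q) \<le> excess n p S x u" by (rule mult_left_le_imp_le) (use m(1) in simp)
  then have lower: "real n / 8 * q \<le> (\<Sum>i<n. (lin_form p u (x i))\<^sup>2)" by (simp add: excess_def q_def)
  have "lmin / lmax / 32 * \<Delta> \<le> lmin / lmax / 32 * (4 * real n * \<kappa> * q)"
    using \<Delta> lmin(1) lmax0 by (intro mult_left_mono) auto
  also have "\<dots> = real n / 8 * q" using lmin(1) lmax0 by (simp add: \<kappa>_def field_simps)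
  finally show ?thesis using lower by (simp add: \<Delta>_def c_def)
qed

text \<open>The basic inequality puts the error \<open>\<delta>\<close> in the cone \<open>B \<le> 2 A\<close>, where \<open>A\<close> and \<open>B\<close> are its
  \<open>l1\<close> masses on and off the support.  The restricted eigenvalue condition then bounds \<open>N = A + B\<close>,
  and \<open>\<lambda> N\<close> controls the change of the residual norm.\<close>
lemma sqrt_lasso_residual:
  fixes x :: "nat \<Rightarrow> nat \<Rightarrow> real" and b e g :: "nat \<Rightarrow> real" and n p k :: nat and lam \<phi> :: real
  defines "c \<equiv> \<lambda>j. sqrt (\<Sum>i<n. (x i j)\<^sup>2)"
  defines "res \<equiv> \<lambda>h. sqrt (\<Sum>i<n. (lin_form p b (x i) + e i - (\<Sum>j<p. x i j / c j * h j))\<^sup>2)"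
  defines "E \<equiv> sqrt (\<Sum>i<n. (e i)\<^sup>2)"
  assumes c_pos: "\<And>j. j < p \<Longrightarrow> 0 < c j" and E: "0 < E" and lam: "0 < lam" and \<phi>: "0 < \<phi>"
    and min: "res g + lam * (\<Sum>j<p. \<bar>g j\<bar>) \<le> res (\<lambda>j. c j * b j) + lam * (\<Sum>j<p. \<bar>c j * b j\<bar>)"
    and noise: "\<And>j. j < p \<Longrightarrow> \<bar>\<Sum>i<n. x i j * e i\<bar> \<le> lam / 3 * c j * E"
    and sparse: "card {j. j < p \<and> b j \<noteq> 0} \<le> k"
    and re: "\<And>u. (\<Sum>j<p. \<bar>u j\<bar> * c j)\<^sup>2 \<le> 9 * real k * (\<Sum>j<p. (u j)\<^sup>2 * (c j)\<^sup>2) \<Longrightarrow>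
       \<phi> * (\<Sum>j<p. (u j)\<^sup>2 * (c j)\<^sup>2) \<le> (\<Sum>i<n. (lin_form p u (x i))\<^sup>2)"
    and small: "18 * real k * lam\<^sup>2 \<le> \<phi>"
  shows "\<phi> * \<bar>(res g)\<^sup>2 - E\<^sup>2\<bar> \<le> 240 * real k * lam\<^sup>2 * E\<^sup>2"
proof -
  \<comment> \<open>In the normalised coordinates of the Lasso the true coefficients are
    \<open>c j * b j\<close>. Thus \<open>\<delta>\<close> is the error there, \<open>u\<close> the
    same error in the original coordinates, and \<open>w\<close> its effect on the fitted
    values.\<close>
  define \<delta> where "\<delta> j = g j - c j * b j" for j
  define u where "u j = \<delta> j / c j" for j
  define w where "w i = lin_form p u (x i)" for i
  define T where "T = (\<Sum>i<n. e i * w i)"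
  define Wn where "Wn = (\<Sum>i<n. (w i)\<^sup>2)"
  define J where "J = {j. j < p \<and> b j \<noteq> 0}"
  define A where "A = (\<Sum>j\<in>J. \<bar>\<delta> j\<bar>)"
  define B where "B = (\<Sum>j\<in>{..<p} - J. \<bar>\<delta> j\<bar>)"
  define N where "N = (\<Sum>j<p. \<bar>\<delta> j\<bar>)"
  define \<Delta> where "\<Delta> = (\<Sum>j<p. (\<delta> j)\<^sup>2)"
  define R where "R = res g"
  define D where "D = R - E"
  have J: "finite J" "J \<subseteq> {..<p}" by (auto simp: J_def)
  have NAB: "N = A + B"
    unfolding N_def A_def B_def using sum.subset_diff[OF J(2), of "\<lambda>j. \<bar>\<delta> j\<bar>"] by simp
  have nonneg: "0 \<le> A" "0 \<le> B" "0 \<le> N" "0 \<le> \<Delta>" "0 \<le> Wn" "0 \<le> R"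
    by (auto simp: A_def B_def N_def \<Delta>_def Wn_def R_def res_def intro!: sum_nonneg)
  have resid: "lin_form p b (x i) + e i - (\<Sum>j<p. x i j / c j * g j) = e i - w i" for i
  proof -
    have "(\<Sum>j<p. x i j / c j * g j) = (\<Sum>j<p. b j * x i j + u j * x i j)"
    proof (intro sum.cong refl)
      fix j assume "j \<in> {..<p}"
      then have "c j \<noteq> 0" using c_pos[of j] by simp
      then show "x i j / c j * g j = b j * x i j + u j * x i j" by (simp add: u_def \<delta>_def field_simps)
    qed
    then show ?thesis by (simp add: w_def sum.distrib)
  qed
  have R: "R = sqrt (\<Sum>i<n. (e i - w i)\<^sup>2)" unfolding R_def res_def resid ..
  have "(\<Sum>j<p. x i j / c j * (c j * b j)) = lin_form p b (x i)" for i
  proof (intro sum.cong refl)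
    fix j assume "j \<in> {..<p}"
    then have "c j \<noteq> 0" using c_pos[of j] by simp
    then show "x i j / c j * (c j * b j) = b j * x i j" by simp
  qed
  then have res0: "res (\<lambda>j. c j * b j) = E" by (simp add: res_def E_def)
  have E2: "E\<^sup>2 = (\<Sum>i<n. (e i)\<^sup>2)" by (simp add: E_def sum_nonneg)
  have "R\<^sup>2 = (\<Sum>i<n. (e i - w i)\<^sup>2)" unfolding R by (simp add: sum_nonneg)
  then have R2: "R\<^sup>2 = E\<^sup>2 - 2 * T + Wn"
    by (simp add: E2 T_def Wn_def sum_nonneg power2_diff sum.distrib sum_subtractf sum_distrib_left mult.assoc)
  have T: "\<bar>T\<bar> \<le> lam / 3 * E * N"
  proof -
    have "T = (\<Sum>i<n. \<Sum>j<p. u j * (x i j * e i))"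
      by (simp add: T_def w_def sum_distrib_left mult_ac)
    also have "\<dots> = (\<Sum>j<p. u j * (\<Sum>i<n. x i j * e i))"
      by (subst sum.swap) (simp add: sum_distrib_left)
    finally have "\<bar>T\<bar> \<le> (\<Sum>j<p. \<bar>u j\<bar> * \<bar>\<Sum>i<n. x i j * e i\<bar>)"
      using sum_abs[of "\<lambda>j. u j * (\<Sum>i<n. x i j * e i)" "{..<p}"] by (simp add: abs_mult)
    also have "\<dots> \<le> (\<Sum>j<p. \<bar>u j\<bar> * (lam / 3 * c j * E))"
      using noise by (intro sum_mono mult_left_mono) auto
    also have "\<dots> = (\<Sum>j<p. lam / 3 * E * \<bar>\<delta> j\<bar>)"
    proof (intro sum.cong refl)
      fix j assume "j \<in> {..<p}"
      then have "0 < c j" using c_pos by simp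
      then show "\<bar>u j\<bar> * (lam / 3 * c j * E) = lam / 3 * E * \<bar>\<delta> j\<bar>" by (simp add: u_def)
    qed
    finally show ?thesis by (simp add: N_def sum_distrib_left)
  qed
  have "(\<Sum>j<p. \<bar>c j * b j\<bar>) - (\<Sum>j<p. \<bar>g j\<bar>) \<le> A - B"
  proof -
    have "(\<Sum>j<p. \<bar>c j * b j\<bar>) - (\<Sum>j<p. \<bar>g j\<bar>) = (\<Sum>j\<in>J. \<bar>c j * b j\<bar> - \<bar>g j\<bar>) + (\<Sum>j\<in>{..<p} - J. \<bar>c j * b j\<bar> - \<bar>g j\<bar>)"
      using sum.subset_diff[OF J(2), of "\<lambda>j. \<bar>c j * b j\<bar> - \<bar>g j\<bar>"] by (simp add: sum_subtractf)
    also have "(\<Sum>j\<in>J. \<bar>c j * b j\<bar> - \<bar>g j\<bar>) \<le> A"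
      unfolding A_def \<delta>_def by (intro sum_mono) auto
    also have "(\<Sum>j\<in>{..<p} - J. \<bar>c j * b j\<bar> - \<bar>g j\<bar>) = - B"
      unfolding B_def sum_negf[symmetric] by (intro sum.cong) (auto simp: \<delta>_def J_def)
    finally show ?thesis by simp
  qed
  then have "lam * ((\<Sum>j<p. \<bar>c j * b j\<bar>) - (\<Sum>j<p. \<bar>g j\<bar>)) \<le> lam * (A - B)"
    using lam by (intro mult_left_mono) auto
  with min[unfolded res0] have a: "D \<le> lam * (A - B)" by (simp add: D_def R_def algebra_simps)
  \<comment> \<open>Projecting the residual \<open>e - w\<close> on \<open>e\<close> gives
    \<open>E * R >= E^2 - T\<close>, so the residual norm cannot fall far below \<open>E\<close>
    when the noise is nearly uncorrelated with the columns.\<close>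
  have bl: "- (lam / 3 * N) \<le> D"
  proof -
    have "(\<Sum>i<n. e i * (e i - w i)) = E\<^sup>2 - T"
      unfolding E2 T_def by (simp add: right_diff_distrib sum_subtractf) (simp add: power2_eq_square)
    moreover have "(\<Sum>i<n. e i * (e i - w i)) \<le> E * R"
    proof -
      have "(\<Sum>i<n. e i * (e i - w i))\<^sup>2 \<le> (E * R)\<^sup>2"
        using Cauchy_Schwarz_ineq_sum[of e "\<lambda>i. e i - w i" "{..<n}"]
        by (simp add: R power_mult_distrib E2 sum_nonneg)
      then show ?thesis by (rule power2_le_imp_le) (use E nonneg in auto)
    qed
    ultimately have "E * E - T \<le> E * R" by (simp add: power2_eq_square)
    then have "- T \<le> E * D" by (simp add: D_def algebra_simps)
    then have "E * (- (lam / 3 * N)) \<le> E * D" using T by (simp add: mult_ac)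
    then show ?thesis by (rule mult_left_le_imp_le[OF _ E])
  qed
  from a bl have "lam * (- (N / 3)) \<le> lam * (A - B)" by simp
  then have "- (N / 3) \<le> A - B" by (rule mult_left_le_imp_le[OF _ lam])
  \<comment> \<open>From \<open>- (A + B) / 3 <= A - B\<close>; this cone is the source of the
    factor \<open>9 = 3^2\<close> in the restricted eigenvalue condition.\<close>
  then have "B \<le> 2 * A" using NAB by linarith
  then have N3: "N \<le> 3 * A" by (simp add: NAB)
  have "A\<^sup>2 \<le> real k * \<Delta>"
  proof -
    have "A\<^sup>2 \<le> (\<Sum>j\<in>J. 1\<^sup>2) * (\<Sum>j\<in>J. \<bar>\<delta> j\<bar>\<^sup>2)"
      using Cauchy_Schwarz_ineq_sum[of "\<lambda>_. 1" "\<lambda>j. \<bar>\<delta> j\<bar>" J] by (simp add: A_def)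
    also have "\<dots> = real (card J) * (\<Sum>j\<in>J. (\<delta> j)\<^sup>2)" by simp
    also have "\<dots> \<le> real k * \<Delta>"
      unfolding \<Delta>_def using sparse J by (intro mult_mono sum_mono2) (auto simp: J_def intro!: sum_nonneg)
    finally show ?thesis .
  qed
  moreover have "N\<^sup>2 \<le> (3 * A)\<^sup>2" using N3 nonneg by (intro power_mono)
  ultimately have N2: "N\<^sup>2 \<le> 9 * real k * \<Delta>" by (simp add: power_mult_distrib)
  have uN: "(\<Sum>j<p. \<bar>u j\<bar> * c j) = N"
    unfolding N_def
  proof (intro sum.cong refl)
    fix j assume "j \<in> {..<p}"
    then have "0 < c j" using c_pos by simp
    then show "\<bar>u j\<bar> * c j = \<bar>\<delta> j\<bar>" by (simp add: u_def)
  qed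
  have uD: "(\<Sum>j<p. (u j)\<^sup>2 * (c j)\<^sup>2) = \<Delta>"
    unfolding \<Delta>_def
  proof (intro sum.cong refl)
    fix j assume "j \<in> {..<p}"
    then have "0 < c j" using c_pos by simp
    then show "(u j)\<^sup>2 * (c j)\<^sup>2 = (\<delta> j)\<^sup>2" by (simp add: u_def power_divide)
  qed
  have "\<phi> * \<Delta> \<le> Wn" using re[of u] N2 by (simp add: uN uD Wn_def w_def)
  have "\<phi> * N\<^sup>2 \<le> \<phi> * (9 * real k * \<Delta>)" using N2 \<phi> by (intro mult_left_mono) auto
  also have "\<dots> = 9 * real k * (\<phi> * \<Delta>)" by simp
  also have "\<dots> \<le> 9 * real k * Wn" using \<open>\<phi> * \<Delta> \<le> Wn\<close> by (intro mult_left_mono) auto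
  finally have main: "\<phi> * N\<^sup>2 \<le> 9 * real k * Wn" .
  have Dabs: "\<bar>D\<bar> \<le> lam * N"
  proof -
    have "lam * (A - B) \<le> lam * N" using lam nonneg by (intro mult_left_mono) (auto simp: NAB)
    moreover have "lam / 3 * N \<le> lam * N" using lam nonneg by (intro mult_right_mono) auto
    ultimately show ?thesis using a bl by linarith
  qed
  have RD: "R = E + D" by (simp add: D_def)
  \<comment> \<open>The expansion of the squared residual norm is solved for the prediction error
    \<open>Wn\<close>, so that it is bounded through \<open>D\<close> and \<open>T\<close>, and
    hence through \<open>lam * N\<close>.\<close>
  have "Wn = D\<^sup>2 + 2 * (D * E) + 2 * T" using R2 unfolding RD by (simp add: power2_eq_square algebra_simps)
  also have "\<dots> \<le> (lam * N)\<^sup>2 + 2 * (lam * N * E) + 2 * (lam / 3 * E * N)"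
  proof (intro add_mono)
    show "D\<^sup>2 \<le> (lam * N)\<^sup>2" using Dabs lam nonneg by (simp add: abs_le_square_iff[symmetric])
    show "2 * (D * E) \<le> 2 * (lam * N * E)" using Dabs E by (intro mult_left_mono mult_right_mono) auto
    show "2 * T \<le> 2 * (lam / 3 * E * N)" using T by linarith
  qed
  also have "\<dots> = lam\<^sup>2 * N\<^sup>2 + 8 / 3 * (lam * N * E)" by (simp add: power_mult_distrib)
  finally have "9 * real k * Wn \<le> 9 * real k * (lam\<^sup>2 * N\<^sup>2 + 8 / 3 * (lam * N * E))"
    by (intro mult_left_mono) auto
  with main have "\<phi> * N\<^sup>2 \<le> (18 * real k * lam\<^sup>2) * N\<^sup>2 / 2 + 24 * real k * (lam * N * E)"
    by (simp add: algebra_simps)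
  \<comment> \<open>The smallness condition absorbs the term quadratic in \<open>lam * N\<close>
    into half of the left side, leaving a bound linear in \<open>N\<close>.\<close>
  also have "(18 * real k * lam\<^sup>2) * N\<^sup>2 / 2 \<le> \<phi> * N\<^sup>2 / 2"
    using small by (intro divide_right_mono mult_right_mono) auto
  finally have "\<phi> * N\<^sup>2 \<le> 48 * real k * (lam * N * E)" by simp
  then have cancel: "N * (\<phi> * N) \<le> N * (48 * real k * lam * E)" by (simp add: power2_eq_square mult_ac)
  have \<phi>N: "\<phi> * N \<le> 48 * real k * lam * E"
  proof (cases "N = 0")
    case True
    then show ?thesis using lam E by simp
  next
    case False
    then have "0 < N" using nonneg by simp
    then show ?thesis by (rule mult_left_le_imp_le[OF cancel])
  qed
  have "\<phi> * \<bar>D\<bar> \<le> \<phi> * (lam * N)" using Dabs \<phi> by (intro mult_left_mono) auto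
  also have "\<dots> = lam * (\<phi> * N)" by simp
  also have "\<dots> \<le> lam * (48 * real k * lam * E)" using \<phi>N lam by (intro mult_left_mono) auto
  also have "\<dots> = 48 * (real k * lam\<^sup>2 * E)" by (simp add: power2_eq_square)
  finally have \<phi>D: "\<phi> * \<bar>D\<bar> \<le> 48 * (real k * lam\<^sup>2 * E)" .
  also have "\<dots> = 48 / 18 * ((18 * real k * lam\<^sup>2) * E)" by simp
  also have "\<dots> \<le> 48 / 18 * (\<phi> * E)" using small E by (intro mult_left_mono mult_right_mono) auto
  also have "\<dots> \<le> \<phi> * (3 * E)" using \<phi> E by simp
  \<comment> \<open>A crude bound on \<open>D\<close>, needed so that \<open>2 * E + D\<close> is of
    order \<open>E\<close> when the difference of squares is factored.\<close>
  finally have D3: "\<bar>D\<bar> \<le> 3 * E" by (rule mult_left_le_imp_le[OF _ \<phi>])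
  have "\<bar>R\<^sup>2 - E\<^sup>2\<bar> = \<bar>D\<bar> * \<bar>2 * E + D\<bar>"
    unfolding RD abs_mult[symmetric] by (simp add: power2_eq_square algebra_simps)
  also have "\<dots> \<le> \<bar>D\<bar> * (5 * E)" using D3 by (intro mult_left_mono) auto
  finally have "\<phi> * \<bar>R\<^sup>2 - E\<^sup>2\<bar> \<le> \<phi> * (\<bar>D\<bar> * (5 * E))" using \<phi> by (intro mult_left_mono) auto
  also have "\<dots> = (\<phi> * \<bar>D\<bar>) * (5 * E)" by simp
  also have "\<dots> \<le> (48 * (real k * lam\<^sup>2 * E)) * (5 * E)" using \<phi>D E by (intro mult_right_mono) auto
  also have "\<dots> = 240 * real k * lam\<^sup>2 * E\<^sup>2" by (simp add: power2_eq_square)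
  finally show ?thesis by (simp add: R_def)
qed

section \<open>The square-root Lasso in the Gaussian model\<close>

definition col_norm :: "nat \<Rightarrow> (nat \<Rightarrow> nat \<Rightarrow> real) \<Rightarrow> nat \<Rightarrow> real" where
  "col_norm n x j = sqrt (\<Sum>i<n. (x i j)\<^sup>2)"

definition lasso_residual :: "nat \<Rightarrow> nat \<Rightarrow> (nat \<Rightarrow> real) \<Rightarrow> ((nat \<Rightarrow> nat \<Rightarrow> real) \<times> (nat \<Rightarrow> real)) \<Rightarrow> (nat \<Rightarrow> real) \<Rightarrow> real" where
  "lasso_residual n p b \<omega> h =
     sqrt (\<Sum>i<n. (lin_form p b (fst \<omega> i) + snd \<omega> i - (\<Sum>j<p. fst \<omega> i j / col_norm n (fst \<omega>) j * h j))\<^sup>2)"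

definition lasso_weight :: "nat \<Rightarrow> nat \<Rightarrow> real" where
  "lasso_weight n p = 13 * sqrt (ln (real p)) / sqrt (real n)"

lemma design_carrier [simp]: "design n p x \<in> carrier_mat n p"
  by (simp add: design_def)

lemma design_dim [simp]: "dim_row (design n p x) = n" "dim_col (design n p x) = p"
  by (simp_all add: design_def)

lemma response_dim [simp]: "dim_vec (response n p b \<omega>) = n"
  by (simp add: response_def case_prod_unfold)

lemma response_carrier [simp]: "response n p b \<omega> \<in> carrier_vec n"
  by (rule carrier_vecI) simp

lemma response_index:
  assumes "b \<in> carrier_vec p" "i < n"
  shows "response n p b \<omega> $ i = lin_form p (\<lambda>j. b $ j) (fst \<omega> i) + snd \<omega> i"
  using assms by (simp add: response_def design_def case_prod_unfold scalar_prod_def atLeast0LessThan mult.commute)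

lemma l2norm_eq: "v \<in> carrier_vec n \<Longrightarrow> l2norm v = sqrt (\<Sum>i<n. (v $ i)\<^sup>2)"
  by (simp add: l2norm_def scalar_prod_def atLeast0LessThan power2_eq_square)

lemma l2norm_power2: "v \<in> carrier_vec n \<Longrightarrow> (l2norm v)\<^sup>2 = (\<Sum>i<n. (v $ i)\<^sup>2)"
  by (simp add: l2norm_eq sum_nonneg)

lemma l2norm_residual:
  assumes b: "b \<in> carrier_vec p" and h: "h \<in> carrier_vec p"
  shows "l2norm (response n p b \<omega> - normalized_design (design n p (fst \<omega>)) *\<^sub>v h)
    = lasso_residual n p (\<lambda>j. b $ j) \<omega> (\<lambda>j. h $ j)"
proof -
  let ?W = "normalized_design (design n p (fst \<omega>))"
  have W: "?W \<in> carrier_mat n p" by (simp add: normalized_design_def)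
  have c: "l2norm (col (design n p (fst \<omega>)) j) = col_norm n (fst \<omega>) j" if "j < p" for j
    using that by (subst l2norm_eq[of _ n]) (auto simp: col_norm_def design_def)
  have Wij: "?W $$ (i, j) = fst \<omega> i j / col_norm n (fst \<omega>) j" if "i < n" "j < p" for i j
    using that c[of j] by (simp add: normalized_design_def) (simp add: design_def)
  have "(response n p b \<omega> - ?W *\<^sub>v h) $ i =
      lin_form p (\<lambda>j. b $ j) (fst \<omega> i) + snd \<omega> i - (\<Sum>j<p. fst \<omega> i j / col_norm n (fst \<omega>) j * h $ j)" if i: "i < n" for i
  proof -
    have "(?W *\<^sub>v h) $ i = (\<Sum>j<p. fst \<omega> i j / col_norm n (fst \<omega>) j * h $ j)"
      using i h W by (auto simp: scalar_prod_def atLeast0LessThan Wij intro!: sum.cong)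
    then show ?thesis using response_index[OF b i] i W by simp
  qed
  moreover have "response n p b \<omega> - ?W *\<^sub>v h \<in> carrier_vec n"
    by (rule minus_carrier_vec[OF response_carrier mult_mat_vec_carrier[OF W h]])
  ultimately show ?thesis by (simp add: l2norm_eq lasso_residual_def)
qed

lemma sqrt_lasso_minimal:
  fixes \<omega> :: "(nat \<Rightarrow> nat \<Rightarrow> real) \<times> (nat \<Rightarrow> real)"
  assumes sl: "sqrt_lasso_estimator n p sl" and b: "b \<in> carrier_vec p"
  defines "g \<equiv> \<lambda>j. sl (design n p (fst \<omega>)) (response n p b \<omega>) $ j"
  shows "lasso_residual n p (\<lambda>j. b $ j) \<omega> g + lasso_weight n p * (\<Sum>j<p. \<bar>g j\<bar>)
      \<le> lasso_residual n p (\<lambda>j. b $ j) \<omega> h + lasso_weight n p * (\<Sum>j<p. \<bar>h j\<bar>)"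
    "eta_sqrt_lasso sl (design n p (fst \<omega>)) (response n p b \<omega>)
      = 1 - (lasso_residual n p (\<lambda>j. b $ j) \<omega> g)\<^sup>2 / (l2norm (response n p b \<omega>))\<^sup>2"
proof -
  let ?X = "design n p (fst \<omega>)" and ?Y = "response n p b \<omega>"
  have am: "is_arg_min (sqrt_lasso_objective ?X ?Y) (\<lambda>b. b \<in> carrier_vec p) (sl ?X ?Y)"
    using sl by (simp add: sqrt_lasso_estimator_def)
  then have slc: "sl ?X ?Y \<in> carrier_vec p" by (simp add: is_arg_min_def)
  have obj: "sqrt_lasso_objective ?X ?Y v = lasso_residual n p (\<lambda>j. b $ j) \<omega> (\<lambda>j. v $ j) + lasso_weight n p * (\<Sum>j<p. \<bar>v $ j\<bar>)"
    if "v \<in> carrier_vec p" for v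
    using that by (simp add: sqrt_lasso_objective_def l2norm_residual[OF b that] lasso_weight_def l1norm_def)
  have "sqrt_lasso_objective ?X ?Y (sl ?X ?Y) \<le> sqrt_lasso_objective ?X ?Y (vec p h)"
    using am by (auto simp: is_arg_min_def not_less)
  then show "lasso_residual n p (\<lambda>j. b $ j) \<omega> g + lasso_weight n p * (\<Sum>j<p. \<bar>g j\<bar>)
      \<le> lasso_residual n p (\<lambda>j. b $ j) \<omega> h + lasso_weight n p * (\<Sum>j<p. \<bar>h j\<bar>)"
    using slc by (simp add: obj g_def) (simp add: lasso_residual_def)
  show "eta_sqrt_lasso sl ?X ?Y = 1 - (lasso_residual n p (\<lambda>j. b $ j) \<omega> g)\<^sup>2 / (l2norm ?Y)\<^sup>2"
    unfolding eta_sqrt_lasso_def l2norm_residual[OF b slc] g_def ..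
qed

text \<open>Comparing the minimiser with the zero vector shows that the residual norm is at most the
  norm of the response. For a zero response the quotient is 0 by convention and the bounds still
  hold.\<close>

lemma eta_sqrt_lasso_bounds:
  assumes sl: "sqrt_lasso_estimator n p sl" and b: "b \<in> carrier_vec p" and p: "1 \<le> p"
  shows "0 \<le> eta_sqrt_lasso sl (design n p (fst \<omega>)) (response n p b \<omega>)"
    "eta_sqrt_lasso sl (design n p (fst \<omega>)) (response n p b \<omega>) \<le> 1"
proof -
  let ?Y = "response n p b \<omega>"
  define g where "g = (\<lambda>j. sl (design n p (fst \<omega>)) ?Y $ j)"
  define R where "R = lasso_residual n p (\<lambda>j. b $ j) \<omega> g"
  have R0: "0 \<le> R" by (simp add: R_def lasso_residual_def sum_nonneg)
  have "lasso_residual n p (\<lambda>j. b $ j) \<omega> (\<lambda>_. 0) = l2norm ?Y"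
    by (simp add: lasso_residual_def l2norm_eq[OF response_carrier] response_index[OF b])
  moreover have "0 \<le> lasso_weight n p * (\<Sum>j<p. \<bar>g j\<bar>)"
    using p by (intro mult_nonneg_nonneg sum_nonneg) (auto simp: lasso_weight_def)
  ultimately have "R \<le> l2norm ?Y"
    using sqrt_lasso_minimal(1)[OF sl b, of \<omega> "\<lambda>_. 0"] by (simp add: R_def g_def)
  then have "R\<^sup>2 \<le> (l2norm ?Y)\<^sup>2" using R0 by (intro power_mono)
  then have "R\<^sup>2 / (l2norm ?Y)\<^sup>2 \<le> 1" by (simp add: divide_le_eq_1)
  moreover have "eta_sqrt_lasso sl (design n p (fst \<omega>)) ?Y = 1 - R\<^sup>2 / (l2norm ?Y)\<^sup>2"
    unfolding R_def g_def by (rule sqrt_lasso_minimal(2)[OF sl b])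
  ultimately show "0 \<le> eta_sqrt_lasso sl (design n p (fst \<omega>)) ?Y" "eta_sqrt_lasso sl (design n p (fst \<omega>)) ?Y \<le> 1"
    by simp_all
qed

lemma exp_minus_le_inverse:
  fixes y :: real
  assumes "0 < y" shows "exp (- y) \<le> 1 / y"
proof -
  have "y \<le> exp y" using exp_ge_add_one_self[of y] by linarith
  with assms show ?thesis by (simp add: exp_minus inverse_eq_divide frac_le)
qed

lemma card_signed_lists: "finite (signed_lists p m)" "card (signed_lists p m) = (2 * p) ^ m"
proof -
  have fin: "finite ({..<p} \<times> {- 1, 1 :: real})" by simp
  have "card ({..<p} \<times> {- 1, 1 :: real}) = 2 * p" by (simp add: card_cartesian_product)
  with card_lists_length_eq[OF fin, of m] show "card (signed_lists p m) = (2 * p) ^ m"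
    unfolding signed_lists_def by (simp only:)
  show "finite (signed_lists p m)" unfolding signed_lists_def by (rule finite_lists_length_eq[OF fin])
qed

lemma lin_form_single: "j < p \<Longrightarrow> lin_form p (\<lambda>l. if l = j then 1 else 0) y = y j"
proof -
  assume "j < p"
  have "lin_form p (\<lambda>l. if l = j then 1 else 0) y = (\<Sum>l<p. if l = j then y l else 0)"
    by (intro sum.cong) auto
  with \<open>j < p\<close> show ?thesis by simp
qed

text \<open>The error of the square-root Lasso splits into its effect on the residual and the fluctuation
  of the ratio of the two chi-square variables \<open>|e|^2\<close> and \<open>|Y|^2\<close>.\<close>
lemma ratio_error_bound:
  fixes R2 E2 Y2 n v s x :: real
  assumes n: "0 < n" and s: "0 < s" "s \<le> v" and x: "0 \<le> x"
    and res: "\<bar>R2 - E2\<bar> \<le> x * E2" and E: "0 \<le> E2" "E2 \<le> 4 * (n * s)" and Y: "n * v / 4 \<le> Y2"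
  shows "((1 - R2 / Y2) - (1 - s / v))\<^sup>2 \<le> 512 * x\<^sup>2 + 64 * ((E2 / (n * s) - 1)\<^sup>2 + (Y2 / (n * v) - 1)\<^sup>2)"
proof -
  define a where "a = E2 / (n * s)"
  define d where "d = Y2 / (n * v)"
  have v: "0 < v" using s by linarith
  have Y0: "0 < Y2" using Y n v by (smt (verit) divide_pos_pos mult_pos_pos)
  have d4: "1 / 4 \<le> d" using Y n v by (simp add: d_def field_simps)
  have sv: "s / v \<le> 1" using s v by simp
  have first: "\<bar>R2 - E2\<bar> / Y2 \<le> 16 * x"
  proof -
    have "E2 \<le> 4 * (n * v)" using E s n by (smt (verit) mult_left_mono)
    \<comment> \<open>The noise energy is compared with the response energy through the larger
      variance \<open>v\<close>, so no lower bound on \<open>s / v\<close> enters.\<close>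
    also have "\<dots> \<le> 16 * Y2" using Y by simp
    finally have "x * E2 \<le> x * (16 * Y2)" using x by (intro mult_left_mono)
    with res have "\<bar>R2 - E2\<bar> \<le> 16 * x * Y2" by simp
    then show ?thesis using Y0 by (simp add: pos_divide_le_eq)
  qed
  have "E2 / Y2 = s / v * (a / d)" using n s v by (simp add: a_def d_def)
  moreover have "(d - a) / d = 1 - a / d" using d4 by (simp add: diff_divide_distrib)
  ultimately have "s / v - E2 / Y2 = s / v * ((d - a) / d)" by (simp add: right_diff_distrib)
  then have "\<bar>s / v - E2 / Y2\<bar> = s / v * (\<bar>d - a\<bar> / d)" using s v d4 by (simp add: abs_mult)
  also have "\<dots> \<le> 1 * (\<bar>d - a\<bar> / d)" using sv d4 by (intro mult_right_mono) auto
  also have "\<dots> \<le> 4 * \<bar>d - a\<bar>" using d4 mult_right_mono[of "1/4" d "\<bar>d - a\<bar>"] by (simp add: divide_le_eq mult.commute)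
  finally have second: "\<bar>s / v - E2 / Y2\<bar> \<le> 4 * \<bar>d - a\<bar>" .
  have "(1 - R2 / Y2) - (1 - s / v) = (s / v - E2 / Y2) - (R2 - E2) / Y2" by (simp add: diff_divide_distrib)
  moreover have "\<bar>(R2 - E2) / Y2\<bar> \<le> 16 * x" using first Y0 by simp
  ultimately have "\<bar>(1 - R2 / Y2) - (1 - s / v)\<bar> \<le> 16 * x + 4 * \<bar>d - a\<bar>" using second by linarith
  then have "((1 - R2 / Y2) - (1 - s / v))\<^sup>2 \<le> (16 * x + 4 * \<bar>d - a\<bar>)\<^sup>2"
    by (simp add: abs_le_square_iff[symmetric])
  also have "\<dots> \<le> 2 * (16 * x)\<^sup>2 + 2 * (4 * \<bar>d - a\<bar>)\<^sup>2"
    using sum_squares_bound[of "16 * x" "4 * \<bar>d - a\<bar>"] by (simp add: power2_sum)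
  also have "\<dots> = 512 * x\<^sup>2 + 32 * (d - a)\<^sup>2" by (simp add: power_mult_distrib)
  also have "(d - a)\<^sup>2 \<le> 2 * (a - 1)\<^sup>2 + 2 * (d - 1)\<^sup>2"
    using sum_squares_bound[of "d - 1" "1 - a"] by (simp add: power2_eq_square algebra_simps)
  finally show ?thesis by (simp add: a_def d_def)
qed

section \<open>Exceptional events of the square-root Lasso\<close>

context gaussian_model
begin

text \<open>The guard makes the event empty when the variance vanishes, where it would otherwise
  have probability one. This does happen: a grid point whose signs cancel is the zero
  vector.\<close>

definition lower_event :: "(nat \<Rightarrow> real) \<Rightarrow> real \<Rightarrow> ((nat \<Rightarrow> nat \<Rightarrow> real) \<times> (nat \<Rightarrow> real)) set" where
  "lower_event \<theta> c = (if 0 < row_var \<theta> c then {\<omega> \<in> space \<mu>. sq_sum \<theta> c \<omega> \<le> real n * row_var \<theta> c / 4} else {})"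

definition upper_event :: "(nat \<Rightarrow> real) \<Rightarrow> real \<Rightarrow> ((nat \<Rightarrow> nat \<Rightarrow> real) \<times> (nat \<Rightarrow> real)) set" where
  "upper_event \<theta> c = {\<omega> \<in> space \<mu>. 4 * (real n * row_var \<theta> c) \<le> sq_sum \<theta> c \<omega>}"

definition noise_event :: "real \<Rightarrow> nat \<Rightarrow> ((nat \<Rightarrow> nat \<Rightarrow> real) \<times> (nat \<Rightarrow> real)) set" where
  "noise_event t j = {\<omega> \<in> space \<mu>. t * \<sigma> * sqrt (\<Sum>i<n. (fst \<omega> i j)\<^sup>2) < \<bar>\<Sum>i<n. fst \<omega> i j * snd \<omega> i\<bar>}"

definition unit_fun :: "nat \<Rightarrow> nat \<Rightarrow> real" where
  "unit_fun j l = (if l = j then 1 else 0)"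

text \<open>In order: failure of the grid condition, a column that is too long, a column too
  correlated with the noise, noise norm too small or too large, response norm too small. The noise
  level \<open>13 sqrt (ln p) / 6\<close> is \<open>lasso_weight / 3\<close> times
  \<open>sqrt n / 2\<close>, the latter times \<open>\<sigma>\<close> being the guaranteed lower
  bound for the noise norm.\<close>

definition lasso_bad :: "nat \<Rightarrow> (nat \<Rightarrow> real) \<Rightarrow> ((nat \<Rightarrow> nat \<Rightarrow> real) \<times> (nat \<Rightarrow> real)) set" where
  "lasso_bad m \<beta> =
    (\<Union>ls\<in>signed_lists p m. lower_event (grid_point S ls) 0)
    \<union> (\<Union>j\<in>{..<p}. upper_event (unit_fun j) 0)
    \<union> (\<Union>j\<in>{..<p}. noise_event (13 * sqrt (ln (real p)) / 6) j)
    \<union> lower_event (\<lambda>_. 0) 1 \<union> upper_event (\<lambda>_. 0) 1 \<union> lower_event \<beta> 1"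

lemma lower_event_sets: "lower_event \<theta> c \<in> sets (data_space n p)"
  and upper_event_sets: "upper_event \<theta> c \<in> sets (data_space n p)"
proof -
  have m: "{\<omega> \<in> space (data_space n p). sq_sum \<theta> c \<omega> \<le> r} \<in> sets (data_space n p)"
    "{\<omega> \<in> space (data_space n p). r \<le> sq_sum \<theta> c \<omega>} \<in> sets (data_space n p)" for r
    by measurable
  show "lower_event \<theta> c \<in> sets (data_space n p)" "upper_event \<theta> c \<in> sets (data_space n p)"
    by (auto simp only: lower_event_def upper_event_def space_model_law m sets.empty_sets split: if_split)
qed

lemma noise_event_sets: "j \<in> {..<p} \<Longrightarrow> noise_event t j \<in> sets (data_space n p)"
  unfolding noise_event_def space_model_law by measurable

lemmas event_sets = lower_event_sets upper_event_sets noise_event_sets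

lemma lasso_bad_sets: "lasso_bad m \<beta> \<in> sets (data_space n p)"
  unfolding lasso_bad_def
  by (intro sets.Un sets.finite_UN card_signed_lists(1) finite_lessThan event_sets)

lemma emeasure_lower_event: "emeasure \<mu> (lower_event \<theta> c) \<le> ennreal (exp (- real n / 4))"
  using sq_sum_lower_tail[of \<theta> c] by (simp add: lower_event_def)

lemma emeasure_finite_UN_le:
  assumes "finite I" "\<And>i. i \<in> I \<Longrightarrow> A i \<in> sets \<mu>" "\<And>i. i \<in> I \<Longrightarrow> emeasure \<mu> (A i) \<le> ennreal r" "0 \<le> r"
  shows "emeasure \<mu> (\<Union>i\<in>I. A i) \<le> ennreal (real (card I) * r)"
proof -
  have "emeasure \<mu> (\<Union>i\<in>I. A i) \<le> (\<Sum>i\<in>I. emeasure \<mu> (A i))"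
    using assms by (intro emeasure_subadditive_finite) auto
  also have "\<dots> \<le> (\<Sum>i\<in>I. ennreal r)" by (intro sum_mono assms)
  also have "\<dots> = ennreal (real (card I) * r)" using assms(4) by (simp add: ennreal_mult ennreal_of_nat_eq_real_of_nat)
  finally show ?thesis .
qed

lemma emeasure_Un_le:
  assumes "A \<in> sets \<mu>" "B \<in> sets \<mu>" "emeasure \<mu> A \<le> ennreal r" "emeasure \<mu> B \<le> ennreal s" "0 \<le> r" "0 \<le> s"
  shows "emeasure \<mu> (A \<union> B) \<le> ennreal (r + s)"
  using emeasure_subadditive[OF assms(1,2)] add_mono[OF assms(3,4)] assms(5,6)
  by (simp add: ennreal_plus[symmetric] del: ennreal_plus)

lemma row_var_noise_pos: "0 < row_var \<theta> 1"
  using quad_form_nonneg[of \<theta>] \<sigma>_pos by (simp add: row_var_def add_nonneg_pos)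

text \<open>The union bounds over the grid and over the columns each cost a factor
  \<open>exp (n / 8)\<close>, which leaves at most \<open>exp (- n / 8) <= 8 / n\<close>. Five
  groups of this size and \<open>2 / n\<close> for the noise correlations add up to
  \<open>42 / n\<close>.\<close>

lemma emeasure_lasso_bad:
  assumes n: "1 \<le> n" and p: "2 \<le> p" "n \<le> p" and m: "real m * ln (2 * real p) \<le> real n / 8" "ln (real p) \<le> real n / 8"
    and pos: "\<And>j. j < p \<Longrightarrow> 0 < S $$ (j, j)"
  shows "emeasure \<mu> (lasso_bad m \<beta>) \<le> ennreal (42 / real n)"
proof -
  let ?e = "8 / real n"
  have e8: "exp (- (real n / 8)) \<le> ?e" using exp_minus_le_inverse[of "real n / 8"] n by simp
  have e4: "exp (- real n / 4) \<le> ?e" by (rule order_trans[OF _ e8]) (use n in simp)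
  have e2: "exp (- real n / 2) \<le> ?e" by (rule order_trans[OF _ e8]) (use n in simp)
  have p0: "0 < real p" using p by simp
  let ?A1 = "\<Union>ls\<in>signed_lists p m. lower_event (grid_point S ls) 0"
  let ?A2 = "\<Union>j\<in>{..<p}. upper_event (unit_fun j) 0"
  let ?A3 = "\<Union>j\<in>{..<p}. noise_event (13 * sqrt (ln (real p)) / 6) j"
  have A1: "emeasure \<mu> ?A1 \<le> ennreal ?e"
  proof -
    have "emeasure \<mu> ?A1 \<le> ennreal (real (card (signed_lists p m)) * exp (- real n / 4))"
      by (intro emeasure_finite_UN_le card_signed_lists(1) emeasure_lower_event) (simp_all add: event_sets)
    also have "\<dots> \<le> ennreal ?e"
    proof (rule ennreal_leI)
      have "real (card (signed_lists p m)) = (2 * real p) ^ m" by (simp add: card_signed_lists)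
      also have "\<dots> = exp (real m * ln (2 * real p))" using p0 by (simp add: exp_of_nat_mult)
      also have "\<dots> \<le> exp (real n / 8)" using m by simp
      finally have "real (card (signed_lists p m)) * exp (- real n / 4) \<le> exp (real n / 8) * exp (- real n / 4)"
        by simp
      also have "\<dots> = exp (- (real n / 8))" by (simp add: exp_add[symmetric])
      finally show "real (card (signed_lists p m)) * exp (- real n / 4) \<le> ?e" using e8 by linarith
    qed
    finally show ?thesis .
  qed
  have A2: "emeasure \<mu> ?A2 \<le> ennreal ?e"
  proof -
    have "emeasure \<mu> ?A2 \<le> ennreal (real (card {..<p}) * exp (- real n / 2))"
    proof (rule emeasure_finite_UN_le)
      fix j assume "j \<in> {..<p}"
      then have "0 < row_var (unit_fun j) 0"
        using pos[of j] quad_form_single[of j p S 1] by (simp add: row_var_def unit_fun_def[abs_def])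
      then show "emeasure \<mu> (upper_event (unit_fun j) 0) \<le> ennreal (exp (- real n / 2))"
        unfolding upper_event_def by (rule sq_sum_upper_tail)
    qed (simp_all add: event_sets)
    also have "\<dots> \<le> ennreal ?e"
    proof (rule ennreal_leI)
      have "real (card {..<p}) = exp (ln (real p))" using p0 by simp
      also have "\<dots> \<le> exp (real n / 8)" using m by (simp only: exp_le_cancel_iff)
      finally have "real (card {..<p}) * exp (- real n / 2) \<le> exp (real n / 8) * exp (- real n / 2)"
        by (intro mult_right_mono) auto
      also have "\<dots> \<le> exp (- (real n / 8))" by (simp add: exp_add[symmetric])
      finally show "real (card {..<p}) * exp (- real n / 2) \<le> ?e" using e8 by linarith
    qed
    finally show ?thesis .
  qed
  have A3: "emeasure \<mu> ?A3 \<le> ennreal (2 / real n)"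
  proof -
    \<comment> \<open>Here 13 is large enough: \<open>?t^2 / 2 = (169 / 72) ln p\<close> exceeds
      \<open>2 ln p\<close>, so the union over \<open>p\<close> columns still leaves a factor
      \<open>1 / p\<close>.\<close>
    let ?t = "13 * sqrt (ln (real p)) / 6"
    have lp: "0 < ln (real p)" using p by simp
    have "emeasure \<mu> ?A3 \<le> ennreal (real (card {..<p}) * (2 * exp (- ?t\<^sup>2 / 2)))"
    proof (rule emeasure_finite_UN_le)
      fix j assume "j \<in> {..<p}"
      then show "emeasure \<mu> (noise_event ?t j) \<le> ennreal (2 * exp (- ?t\<^sup>2 / 2))"
        unfolding noise_event_def using lp by (intro noise_tail) auto
    qed (simp_all add: event_sets)
    also have "\<dots> \<le> ennreal (2 / real n)"
    proof (rule ennreal_leI)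
      have "?t\<^sup>2 = 169 / 36 * ln (real p)" using lp by (simp add: power_mult_distrib power_divide)
      then have "- ?t\<^sup>2 / 2 \<le> - (2 * ln (real p))" using lp by simp
      then have "exp (- ?t\<^sup>2 / 2) \<le> exp (- (2 * ln (real p)))" by (simp only: exp_le_cancel_iff)
      also have "\<dots> = 1 / (real p * real p)" using p0 by (simp add: exp_minus exp_double power2_eq_square inverse_eq_divide)
      finally have "real (card {..<p}) * (2 * exp (- ?t\<^sup>2 / 2)) \<le> real p * (2 * (1 / (real p * real p)))"
        by (intro mult_mono) auto
      also have "\<dots> = 2 / real p" using p0 by simp
      also have "\<dots> \<le> 2 / real n" using n p by (intro divide_left_mono) auto
      finally show "real (card {..<p}) * (2 * exp (- ?t\<^sup>2 / 2)) \<le> 2 / real n" .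
    qed
    finally show ?thesis .
  qed
  have s: "?A1 \<in> sets \<mu>" "?A2 \<in> sets \<mu>" "?A3 \<in> sets \<mu>"
    "lower_event \<theta> c \<in> sets \<mu>" "upper_event \<theta> c \<in> sets \<mu>" for \<theta> c
    by (auto simp: event_sets card_signed_lists(1) intro!: sets.finite_UN)
  have A4: "emeasure \<mu> (lower_event \<theta> c) \<le> ennreal ?e" for \<theta> c
    using emeasure_lower_event ennreal_leI[OF e4] by (rule order_trans)
  have A5: "emeasure \<mu> (upper_event (\<lambda>_. 0) 1) \<le> ennreal ?e"
    unfolding upper_event_def using sq_sum_upper_tail[OF row_var_noise_pos] ennreal_leI[OF e2] by (rule order_trans)
  have "emeasure \<mu> (lasso_bad m \<beta>) \<le> ennreal (((((?e + ?e) + 2 / real n) + ?e) + ?e) + ?e)"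
    unfolding lasso_bad_def
    by (intro emeasure_Un_le sets.Un s A1 A2 A3 A4 A5) (use n in auto)
  also have "(((((?e + ?e) + 2 / real n) + ?e) + ?e) + ?e) = 42 / real n" by simp
  finally show ?thesis .
qed

lemma S_carrier: "S \<in> carrier_mat p p"
  using chol by (simp add: cholesky_def)

lemma S_sym: "transpose_mat S = S"
  using chol by (intro eq_matI) (auto simp: cholesky_def mult.commute)

lemma S_det: "det S \<noteq> 0"
  unfolding cholesky_det[OF chol] by (rule less_imp_neq[OF zero_less_power[OF cholesky_prod_pos[OF chol]], symmetric])

lemma S_covariance: "covariance_matrix p S"
  unfolding covariance_matrix_def
proof (intro conjI ballI S_carrier S_sym)
  fix v :: "real vec" assume "v \<in> carrier_vec p"
  then have "v = vec p (\<lambda>i. v $ i)" by auto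
  then show "0 \<le> v \<bullet> (S *\<^sub>v v)"
    using quad_form_vec[OF S_carrier, of "\<lambda>i. v $ i"] quad_form_nonneg[of "\<lambda>i. v $ i"] by simp
qed

lemma S_diag: "j < p \<Longrightarrow> S $$ (j, j) = quad_form p S (unit_fun j)"
  using quad_form_single[of j p S 1] by (simp add: unit_fun_def[abs_def])

lemma unit_fun_norm: "j < p \<Longrightarrow> (\<Sum>i<p. (unit_fun j i)\<^sup>2) = 1"
proof -
  assume "j < p"
  have "(\<Sum>i<p. (unit_fun j i)\<^sup>2) = (\<Sum>i<p. if i = j then 1 else 0)"
    by (intro sum.cong) (auto simp: unit_fun_def)
  with \<open>j < p\<close> show ?thesis by simp
qed

lemma S_diag_bounds:
  assumes j: "j < p"
  shows "lambda_min S \<le> S $$ (j, j)" "S $$ (j, j) \<le> lambda_max S" "0 < S $$ (j, j)"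
proof -
  have p: "0 < p" using j by simp
  note b = lambda_bounds[OF S_covariance S_det p]
  show "lambda_min S \<le> S $$ (j, j)" "S $$ (j, j) \<le> lambda_max S"
    using b(2)[of "unit_fun j"] b(3)[of "unit_fun j"] by (simp_all add: S_diag[OF j] unit_fun_norm[OF j])
  then show "0 < S $$ (j, j)" using b(1) by linarith
qed

lemma explained_variation_eq:
  assumes b: "b \<in> carrier_vec p"
  shows "explained_variation S b \<sigma> = 1 - \<sigma>\<^sup>2 / row_var (\<lambda>j. b $ j) 1"
proof -
  have "b = vec p (\<lambda>i. b $ i)" using b by auto
  then have "b \<bullet> (S *\<^sub>v b) = quad_form p S (\<lambda>j. b $ j)"
    using quad_form_vec[OF S_carrier, of "\<lambda>i. b $ i"] by simp
  moreover have "row_var (\<lambda>j. b $ j) 1 \<noteq> 0" using row_var_noise_pos[of "\<lambda>j. b $ j"] by simp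
  ultimately show ?thesis by (simp add: explained_variation_def row_var_def field_simps)
qed

lemma response_norm:
  assumes b: "b \<in> carrier_vec p"
  shows "(l2norm (response n p b \<omega>))\<^sup>2 = sq_sum (\<lambda>j. b $ j) 1 \<omega>"
  by (simp add: l2norm_power2[OF response_carrier] response_index[OF b] sq_sum_def)

text \<open>Off the exceptional event all hypotheses of the deterministic analysis hold. What
  remains random on the right are the relative fluctuations of the noise and response energies,
  whose second moments are of order \<open>1 / n\<close>.\<close>

lemma sqrt_lasso_good:
  assumes n: "1 \<le> n" and p: "2 \<le> p" and b: "b \<in> carrier_vec p" and sl: "sqrt_lasso_estimator n p sl"
    and sparse: "k_sparse k b" and k: "1 \<le> k"
    and small: "100000 * (real k * (lambda_max S / lambda_min S) * ln (real p)) \<le> real n"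
    and m: "2 \<le> m" "4608 * (real k * (lambda_max S / lambda_min S)) \<le> real m - 1"
    and \<omega>: "\<omega> \<in> space \<mu>" "\<omega> \<notin> lasso_bad m (\<lambda>j. b $ j)"
  shows "(eta_sqrt_lasso sl (design n p (fst \<omega>)) (response n p b \<omega>) - explained_variation S b \<sigma>)\<^sup>2
    \<le> 512 * (1297920 * (real k * (lambda_max S / lambda_min S) * ln (real p) / real n))\<^sup>2
     + 64 * ((sq_sum (\<lambda>_. 0) 1 \<omega> / (real n * row_var (\<lambda>_. 0) 1) - 1)\<^sup>2
           + (sq_sum (\<lambda>j. b $ j) 1 \<omega> / (real n * row_var (\<lambda>j. b $ j) 1) - 1)\<^sup>2)"
proof -
  define \<beta> where "\<beta> = (\<lambda>j. b $ j)"
  define x where "x = fst \<omega>"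
  define e where "e = snd \<omega>"
  define c where "c = col_norm n x"
  define g where "g = (\<lambda>j. sl (design n p x) (response n p b \<omega>) $ j)"
  define \<kappa> where "\<kappa> = lambda_max S / lambda_min S"
  define lam where "lam = lasso_weight n p"
  define E2 where "E2 = sq_sum (\<lambda>_. 0) 1 \<omega>"
  define Y2 where "Y2 = sq_sum \<beta> 1 \<omega>"
  have p0: "0 < p" using p by simp
  note lb = lambda_bounds[OF S_covariance S_det p0]
  have l0: "lambda_min S \<le> lambda_max S" using S_diag_bounds(1,2)[OF p0] by linarith
  have \<kappa>1: "1 \<le> \<kappa>" using lb(1) l0 by (simp add: \<kappa>_def)
  have lnp: "0 < ln (real p)" using p by simp
  have lam2: "lam\<^sup>2 = 169 * ln (real p) / real n"
    using lnp n by (simp add: lam_def lasso_weight_def power_divide power_mult_distrib)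
  have lam0: "0 < lam" using lnp n by (simp add: lam_def lasso_weight_def)
  have grid: "0 \<le> excess n p S x (grid_point S ls)" if "ls \<in> signed_lists p m" for ls
  proof -
    have sq: "(\<Sum>i<n. (lin_form p (grid_point S ls) (x i))\<^sup>2) = sq_sum (grid_point S ls) 0 \<omega>"
      by (simp add: sq_sum_def x_def)
    have rv: "row_var (grid_point S ls) 0 = quad_form p S (grid_point S ls)" by (simp add: row_var_def)
    have "\<omega> \<notin> lower_event (grid_point S ls) 0" using \<omega>(2) that by (auto simp: lasso_bad_def)
    \<comment> \<open>In the degenerate case of zero variance the excess is a plain sum of
      squares.\<close>
    then show ?thesis using \<omega>(1) quad_form_nonneg[of "grid_point S ls"] sq_sum_def
      by (auto simp: lower_event_def excess_def sq rv sq_sum_def intro!: sum_nonneg split: if_splits)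
  qed
  have col: "(\<Sum>i<n. (x i j)\<^sup>2) \<le> 4 * (real n * S $$ (j, j))" if j: "j < p" for j
  proof -
    have "\<omega> \<notin> upper_event (unit_fun j) 0" using \<omega>(2) j by (auto simp: lasso_bad_def)
    moreover have "sq_sum (unit_fun j) 0 \<omega> = (\<Sum>i<n. (x i j)\<^sup>2)"
      using lin_form_single[OF j] by (simp add: sq_sum_def x_def unit_fun_def)
    moreover have "row_var (unit_fun j) 0 = S $$ (j, j)" by (simp add: row_var_def S_diag[OF j])
    ultimately show ?thesis using \<omega>(1) by (simp add: upper_event_def)
  qed
  have c2: "(c j)\<^sup>2 = (\<Sum>i<n. (x i j)\<^sup>2)" for j by (simp add: c_def col_norm_def sum_nonneg)
  have c_pos: "0 < c j" if j: "j < p" for j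
  proof -
    have "0 < real n * S $$ (j, j) / 4" using n S_diag_bounds(3)[OF j] by simp
    also have "\<dots> \<le> (\<Sum>i<n. (x i j)\<^sup>2)"
      by (rule column_lower_bound[OF S_carrier S_diag_bounds(3)[OF j] j _ grid]) (use m in auto)
    finally show ?thesis by (simp add: c_def col_norm_def)
  qed
  have rv0: "row_var (\<lambda>_. 0) 1 = \<sigma>\<^sup>2" by (simp add: row_var_def quad_form_def)
  have E2: "E2 = (\<Sum>i<n. (e i)\<^sup>2)" by (simp add: E2_def sq_sum_def e_def)
  have E2low: "real n * \<sigma>\<^sup>2 / 4 < E2"
    using \<omega> \<sigma>_pos by (auto simp: lasso_bad_def lower_event_def rv0 E2_def)
  have E2up: "E2 \<le> 4 * (real n * \<sigma>\<^sup>2)"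
    using \<omega> by (auto simp: lasso_bad_def upper_event_def rv0 E2_def)
  have Y2low: "real n * row_var \<beta> 1 / 4 \<le> Y2"
    using \<omega> row_var_noise_pos[of \<beta>] by (auto simp: lasso_bad_def lower_event_def Y2_def \<beta>_def)
  have E2_0: "0 < E2" using E2low by (smt (verit) divide_nonneg_nonneg mult_nonneg_nonneg of_nat_0_le_iff zero_le_power2)
  have noise: "\<bar>\<Sum>i<n. x i j * e i\<bar> \<le> lam / 3 * c j * sqrt E2" if j: "j < p" for j
  proof -
    have "\<omega> \<notin> noise_event (13 * sqrt (ln (real p)) / 6) j" using \<omega>(2) j by (auto simp: lasso_bad_def)
    then have "\<bar>\<Sum>i<n. x i j * e i\<bar> \<le> 13 * sqrt (ln (real p)) / 6 * \<sigma> * c j"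
      using \<omega>(1) by (simp add: noise_event_def c_def col_norm_def x_def e_def)
    also have "\<dots> = lam / 3 * c j * (sqrt (real n) * \<sigma> / 2)"
      using n by (simp add: lam_def lasso_weight_def)
    also have "\<dots> \<le> lam / 3 * c j * sqrt E2"
    proof (intro mult_left_mono)
      have "sqrt (real n) * \<sigma> / 2 = sqrt (real n * \<sigma>\<^sup>2 / 4)" using \<sigma>_pos by (simp add: real_sqrt_mult real_sqrt_divide)
      also have "\<dots> \<le> sqrt E2" using E2low by simp
      finally show "sqrt (real n) * \<sigma> / 2 \<le> sqrt E2" .
    qed (use lam0 c_pos[OF j] in simp)
    finally show ?thesis .
  qed
  have re: "lambda_min S / lambda_max S / 32 * (\<Sum>j<p. (u j)\<^sup>2 * (c j)\<^sup>2) \<le> (\<Sum>i<n. (lin_form p u (x i))\<^sup>2)"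
    if "(\<Sum>j<p. \<bar>u j\<bar> * c j)\<^sup>2 \<le> 9 * real k * (\<Sum>j<p. (u j)\<^sup>2 * (c j)\<^sup>2)" for u
  proof -
    have cone: "(\<Sum>j<p. \<bar>u j\<bar> * sqrt (\<Sum>i<n. (x i j)\<^sup>2))\<^sup>2 \<le> 9 * real k * (\<Sum>j<p. (u j)\<^sup>2 * (\<Sum>i<n. (x i j)\<^sup>2))"
      using that unfolding c2 by (simp add: c_def col_norm_def)
    show ?thesis
      unfolding c2
      by (rule restricted_eigenvalue[where S = S and k = k and m = m])
        (fact S_carrier S_sym S_diag_bounds(3) lb(1) lb(2) S_diag_bounds(2) n m(1) m(2) grid col cone)+
  qed
  define R where "R = lasso_residual n p \<beta> \<omega> g"
  have main: "lambda_min S / lambda_max S / 32 * \<bar>R\<^sup>2 - (sqrt E2)\<^sup>2\<bar> \<le> 240 * real k * lam\<^sup>2 * (sqrt E2)\<^sup>2"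
    unfolding R_def lasso_residual_def x_def[symmetric] e_def[symmetric] E2 col_norm_def
  proof (rule sqrt_lasso_residual[where lam = lam])
    show "sqrt (\<Sum>i<n. (lin_form p \<beta> (x i) + e i - (\<Sum>j<p. x i j / sqrt (\<Sum>i<n. (x i j)\<^sup>2) * g j))\<^sup>2) + lam * (\<Sum>j<p. \<bar>g j\<bar>)
      \<le> sqrt (\<Sum>i<n. (lin_form p \<beta> (x i) + e i - (\<Sum>j<p. x i j / sqrt (\<Sum>i<n. (x i j)\<^sup>2) * (sqrt (\<Sum>i<n. (x i j)\<^sup>2) * \<beta> j)))\<^sup>2)
        + lam * (\<Sum>j<p. \<bar>sqrt (\<Sum>i<n. (x i j)\<^sup>2) * \<beta> j\<bar>)"
      using sqrt_lasso_minimal(1)[OF sl b, of \<omega> "\<lambda>j. sqrt (\<Sum>i<n. (x i j)\<^sup>2) * \<beta> j"]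
      by (simp only: lasso_residual_def col_norm_def x_def e_def g_def lam_def \<beta>_def)
    show "card {j. j < p \<and> \<beta> j \<noteq> 0} \<le> k" using sparse b by (simp add: k_sparse_def \<beta>_def)
    show "0 < lambda_min S / lambda_max S / 32" using lb(1) l0 by simp
    show "18 * real k * lam\<^sup>2 \<le> lambda_min S / lambda_max S / 32"
    proof -
      \<comment> \<open>\<open>97344 = 18 * 169 * 32\<close>, where 169 comes from the squared
        penalty constant and 32 from the restricted eigenvalue.\<close>
      have "18 * real k * lam\<^sup>2 * 32 * \<kappa> = 97344 * (real k * \<kappa> * ln (real p)) / real n"
        by (simp add: lam2)
      also have "\<dots> \<le> 1" 
      proof -
        have "0 \<le> real k * \<kappa> * ln (real p)" using \<kappa>1 lnp by simp
        then have "97344 * (real k * \<kappa> * ln (real p)) \<le> real n"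
            using small unfolding \<kappa>_def[symmetric] by linarith
        then show ?thesis using n by simp
      qed
      finally have "18 * real k * lam\<^sup>2 * 32 * \<kappa> \<le> 1" .
      then show ?thesis using lb(1) l0 by (simp add: \<kappa>_def field_simps)
    qed
  qed (use c_pos noise re E2_0 E2 lam0 in \<open>simp_all add: c_def col_norm_def\<close>)
  have "\<bar>R\<^sup>2 - E2\<bar> \<le> 1297920 * (real k * \<kappa> * ln (real p) / real n) * E2"
  proof -
    have pos: "0 < lambda_min S" "0 < lambda_max S" using lb(1) l0 by auto
    have "\<bar>R\<^sup>2 - E2\<bar> = (32 * \<kappa>) * (lambda_min S / lambda_max S / 32 * \<bar>R\<^sup>2 - E2\<bar>)"
      using pos by (simp add: \<kappa>_def)
    also have "\<dots> \<le> (32 * \<kappa>) * (240 * real k * lam\<^sup>2 * E2)"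
      using main E2_0 \<kappa>1 by (intro mult_left_mono) auto
    \<comment> \<open>\<open>1297920 = 32 * 240 * 169\<close>.\<close>
    also have "\<dots> = 1297920 * (real k * \<kappa> * ln (real p) / real n) * E2" by (simp add: lam2)
    finally show ?thesis .
  qed
  from ratio_error_bound[OF _ _ _ _ this less_imp_le[OF E2_0] E2up Y2low] 
  have fin: "((1 - R\<^sup>2 / Y2) - (1 - \<sigma>\<^sup>2 / row_var \<beta> 1))\<^sup>2 \<le> 512 * (1297920 * (real k * \<kappa> * ln (real p) / real n))\<^sup>2
      + 64 * ((E2 / (real n * \<sigma>\<^sup>2) - 1)\<^sup>2 + (Y2 / (real n * row_var \<beta> 1) - 1)\<^sup>2)"
    using n \<sigma>_pos \<kappa>1 lnp quad_form_nonneg[of \<beta>] by (auto simp: row_var_def)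
  have "eta_sqrt_lasso sl (design n p (fst \<omega>)) (response n p b \<omega>) = 1 - R\<^sup>2 / Y2"
    unfolding sqrt_lasso_minimal(2)[OF sl b] response_norm[OF b] R_def g_def x_def \<beta>_def Y2_def ..
  then show ?thesis
    using fin unfolding explained_variation_eq[OF b] rv0 \<kappa>_def \<beta>_def E2_def Y2_def by simp
qed

end

section \<open>The dense estimator\<close>

text \<open>Written out in coordinates so that measurability reduces to that of the coordinate
  projections.\<close>

lemma dense_ratio_eq:
  assumes Om: "Om \<in> carrier_mat p p" and Y: "Y \<in> carrier_vec n"
  shows "eta_dense Om (design n p x) Y =
    (\<Sum>i<n. Y $ i * (\<Sum>k<n. ((\<Sum>j<p. (\<Sum>l<p. x i l * Om $$ (l, j)) * x k j)
        - (if i = k then (\<Sum>a<n. \<Sum>j<p. (\<Sum>l<p. x a l * Om $$ (l, j)) * x a j) / real n else 0)) * Y $ k))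
     / (real (n + 1) * (\<Sum>i<n. (Y $ i)\<^sup>2))"
proof -
  define K where "K = design n p x * Om * transpose_mat (design n p x)"
  have K: "K \<in> carrier_mat n n" 
    unfolding K_def by (rule mult_carrier_mat[OF mult_carrier_mat[OF design_carrier Om]]) simp
  have Kik: "K $$ (i, k) = (\<Sum>j<p. (\<Sum>l<p. x i l * Om $$ (l, j)) * x k j)" if "i < n" "k < n" for i k
    using that Om unfolding K_def by (simp add: scalar_prod_def atLeast0LessThan design_def)
  have tr: "trace K = (\<Sum>a<n. \<Sum>j<p. (\<Sum>l<p. x a l * Om $$ (l, j)) * x a j)"
    using K by (simp add: trace_def Kik)
  have dY: "dim_vec Y = n" using Y by simp
  have "((K - (trace K / real n) \<cdot>\<^sub>m 1\<^sub>m n) *\<^sub>v Y) $ i =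
      (\<Sum>k<n. (K $$ (i, k) - (if i = k then trace K / real n else 0)) * Y $ k)" if "i < n" for i
    using that K Y by (auto simp: scalar_prod_def atLeast0LessThan intro!: sum.cong)
  then have "Y \<bullet> ((K - (trace K / real n) \<cdot>\<^sub>m 1\<^sub>m n) *\<^sub>v Y) =
      (\<Sum>i<n. Y $ i * (\<Sum>k<n. (K $$ (i, k) - (if i = k then trace K / real n else 0)) * Y $ k))"
    using K by (simp add: scalar_prod_def atLeast0LessThan)
  moreover have "(\<Sum>i<n. Y $ i * (\<Sum>k<n. (K $$ (i, k) - (if i = k then trace K / real n else 0)) * Y $ k)) =
      (\<Sum>i<n. Y $ i * (\<Sum>k<n. ((\<Sum>j<p. (\<Sum>l<p. x i l * Om $$ (l, j)) * x k j)
        - (if i = k then (\<Sum>a<n. \<Sum>j<p. (\<Sum>l<p. x a l * Om $$ (l, j)) * x a j) / real n else 0)) * Y $ k))"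
    by (intro sum.cong refl arg_cong2[of _ _ _ _ times] arg_cong2[of _ _ _ _ minus]) (simp_all add: Kik tr)
  ultimately show ?thesis
    unfolding eta_dense_def centred_quadratic_ratio_def Let_def dY K_def[symmetric] l2norm_power2[OF Y]
    by (simp only:)
qed

lemma eta_dense_measurable:
  assumes Om: "Om \<in> carrier_mat p p" and b: "b \<in> carrier_vec p"
  shows "(\<lambda>\<omega>. eta_dense Om (design n p (fst \<omega>)) (response n p b \<omega>)) \<in> borel_measurable (data_space n p)"
proof -
  have eq: "(\<Sum>i<n. response n p b \<omega> $ i * F i) = (\<Sum>i<n. (lin_form p (\<lambda>j. b $ j) (fst \<omega> i) + snd \<omega> i) * F i)"
     "(\<Sum>k<n. F' k * response n p b \<omega> $ k) = (\<Sum>k<n. F' k * (lin_form p (\<lambda>j. b $ j) (fst \<omega> k) + snd \<omega> k))"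
     "(\<Sum>i<n. (response n p b \<omega> $ i)\<^sup>2) = (\<Sum>i<n. (lin_form p (\<lambda>j. b $ j) (fst \<omega> i) + snd \<omega> i)\<^sup>2)" for \<omega> F F'
    by (simp_all add: response_index[OF b])
  show ?thesis
    unfolding dense_ratio_eq[OF Om response_carrier] eq by measurable
qed

lemma eta_dense_one: "V_hat (design n p x) Y = eta_dense (1\<^sub>m p) (design n p x) Y"
  unfolding V_hat_def eta_dense_def by (simp add: right_mult_one_mat[OF design_carrier])

lemma cholesky_one: "cholesky p (1\<^sub>m p) (\<lambda>i j. if i = j then 1 else 0)"
proof -
  have "(\<Sum>l<p. (if i = l then 1 else 0) * (if j = l then 1 else 0)) = (if i = j then 1 else 0 :: real)"
    if "i < p" "j < p" for i j
  proof -
    have "(\<Sum>l<p. (if i = l then 1 else 0) * (if j = l then 1 else 0)) = (\<Sum>l<p. if l = i then (if i = j then 1 else 0 :: real) else 0)"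
      by (intro sum.cong) auto
    then show ?thesis using that by simp
  qed
  then show ?thesis by (auto simp: cholesky_def)
qed

lemma op_norm_one: "op_norm (1\<^sub>m p) \<le> 1"
  unfolding op_norm_def
proof (rule cSUP_least)
  have "0\<^sub>v p \<in> {v \<in> carrier_vec (dim_col (1\<^sub>m p)). l2norm v \<le> (1 :: real)}"
    by (simp add: l2norm_def scalar_prod_def)
  then show "{v \<in> carrier_vec (dim_col (1\<^sub>m p :: real mat)). l2norm v \<le> 1} \<noteq> {}" by blast
qed simp

text \<open>Identifies the whitened rows with rows of the model itself at covariance
  \<open>1\<^sub>m p\<close>, to which the assumed deviation bound can be applied.\<close>

lemma std_gauss_eq: "std_gauss p = gaussian_vector_law p (1\<^sub>m p)"
proof -
  have "gaussian_vector_law p (1\<^sub>m p) = distr (std_gauss p) (Pi\<^sub>M {..<p} (\<lambda>_. borel)) (lin_map p (\<lambda>i j. if i = j then 1 else 0))"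
    by (rule gaussian_vector_law_eq_distr[OF cholesky_one])
  also have "\<dots> = distr (std_gauss p) (Pi\<^sub>M {..<p} (\<lambda>_. borel)) (\<lambda>z. z)"
  proof (rule distr_cong)
    fix z assume "z \<in> space (std_gauss p)"
    then have z: "z \<in> extensional {..<p}" by (simp add: std_gauss_def space_PiM PiE_def)
    have "(\<Sum>j<p. (if i = j then 1 else 0) * z j) = z i" if "i < p" for i
    proof -
      have "(\<Sum>j<p. (if i = j then 1 else 0) * z j) = (\<Sum>j<p. if j = i then z j else 0)" by (intro sum.cong) auto
      then show ?thesis using that by simp
    qed
    then show "lin_map p (\<lambda>i j. if i = j then 1 else 0) z = z"
      using z by (auto simp: lin_map_def fun_eq_iff restrict_def extensional_def)
  qed simp_all
  also have "\<dots> = std_gauss p" by (rule distr_id2) simp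
  finally show ?thesis ..
qed

section \<open>Whitening and the dense estimator\<close>

context gaussian_model
begin

definition whiten :: "((nat \<Rightarrow> nat \<Rightarrow> real) \<times> (nat \<Rightarrow> real)) \<Rightarrow> (nat \<Rightarrow> nat \<Rightarrow> real) \<times> (nat \<Rightarrow> real)" where
  "whiten = (\<lambda>(z, e). (compose {..<n} (lin_map p L) z, e))"

lemma model_law_whiten: "\<mu> = distr (model_law n p (1\<^sub>m p) \<sigma>) \<mu> whiten"
proof -
  let ?G1 = "gaussian_vector_law p (1\<^sub>m p)"
  let ?N = "Pi\<^sub>M {..<n} (\<lambda>_. noise_law \<sigma>)"
  have P1: "prob_space ?G1" by (rule prob_space_gaussian_vector_law[OF cholesky_one])
  have lm: "lin_map p L \<in> ?G1 \<rightarrow>\<^sub>M G" by (simp cong: measurable_cong_sets)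
  have "distr (std_gauss p) G (lin_map p L) = distr (std_gauss p) (Pi\<^sub>M {..<p} (\<lambda>_. borel)) (lin_map p L)"
    by (rule distr_cong) simp_all
  also have "\<dots> = G" by (rule gaussian_vector_law_eq_distr[OF chol, symmetric])
  finally have "distr ?G1 G (lin_map p L) = G" unfolding std_gauss_eq .
  then have "Pi\<^sub>M {..<n} (\<lambda>_. G) = Pi\<^sub>M {..<n} (\<lambda>_. distr ?G1 G (lin_map p L))" by simp
  also have "\<dots> = distr (Pi\<^sub>M {..<n} (\<lambda>_. ?G1)) (Pi\<^sub>M {..<n} (\<lambda>_. G)) (compose {..<n} (lin_map p L))"
    by (rule distr_PiM_finite_prob_space'[symmetric]) (auto simp: P1 prob_G lm)
  finally have G: "Pi\<^sub>M {..<n} (\<lambda>_. G) = distr (Pi\<^sub>M {..<n} (\<lambda>_. ?G1)) (Pi\<^sub>M {..<n} (\<lambda>_. G)) (compose {..<n} (lin_map p L))" .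
  have cm: "compose {..<n} (lin_map p L) \<in> Pi\<^sub>M {..<n} (\<lambda>_. ?G1) \<rightarrow>\<^sub>M Pi\<^sub>M {..<n} (\<lambda>_. G)"
    unfolding compose_def
    by (intro measurable_restrict measurable_compose[OF _ lm] measurable_component_singleton)
  have N: "?N = distr ?N ?N (\<lambda>e. e)" by (rule distr_id2[symmetric]) simp
  have "sigma_finite_measure (distr ?N ?N (\<lambda>e. e))"
    unfolding N[symmetric] by (intro prob_space_imp_sigma_finite prob_space_PiM prob_noise)
  from pair_measure_distr[OF cm measurable_ident_sets[OF refl] this]
  have "Pi\<^sub>M {..<n} (\<lambda>_. G) \<Otimes>\<^sub>M ?N = distr (Pi\<^sub>M {..<n} (\<lambda>_. ?G1) \<Otimes>\<^sub>M ?N) (Pi\<^sub>M {..<n} (\<lambda>_. G) \<Otimes>\<^sub>M ?N) whiten"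
    unfolding G[symmetric] N[symmetric] whiten_def by simp
  then show ?thesis unfolding model_law_def .
qed

lemma whiten_measurable: "whiten \<in> model_law n p (1\<^sub>m p) \<sigma> \<rightarrow>\<^sub>M \<mu>"
proof -
  have "(\<lambda>\<omega>. (compose {..<n} (lin_map p L) (fst \<omega>), snd \<omega>)) \<in> data_space n p \<rightarrow>\<^sub>M data_space n p"
  proof (rule measurable_Pair)
    show "(\<lambda>\<omega>. compose {..<n} (lin_map p L) (fst \<omega>)) \<in> data_space n p \<rightarrow>\<^sub>M Pi\<^sub>M {..<n} (\<lambda>_. Pi\<^sub>M {..<p} (\<lambda>_. borel))"
      unfolding compose_def
      by (intro measurable_restrict measurable_compose[OF _ lin_map_measurable]
          measurable_compose[OF measurable_fst measurable_component_singleton])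
  qed simp
  then show ?thesis by (simp add: whiten_def case_prod_unfold cong: measurable_cong_sets)
qed

text \<open>With \<open>X = Z L^T\<close> and \<open>S = L L^T\<close> one has \<open>X S^-1 X^T = Z Z^T\<close> and \<open>X b = Z (L^T b)\<close>.\<close>
lemma whiten_eta_dense:
  assumes b: "b \<in> carrier_vec p"
  shows "eta_dense (precision S) (design n p (fst (whiten \<omega>))) (response n p b (whiten \<omega>)) =
    V_hat (design n p (fst \<omega>)) (response n p (transpose_mat (lmat p L) *\<^sub>v b) \<omega>)"
proof -
  let ?Z = "design n p (fst \<omega>)" and ?T = "transpose_mat (lmat p L)"
  have c: "?Z \<in> carrier_mat n p" "?T \<in> carrier_mat p p" "lmat p L \<in> carrier_mat p p" "transpose_mat ?Z \<in> carrier_mat p n" by simp_all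
  note w = cholesky_precision[OF chol]
  have X: "design n p (fst (whiten \<omega>)) = ?Z * ?T"
    by (rule eq_matI) (auto simp: design_def whiten_def case_prod_unfold compose_def lin_map_def scalar_prod_def atLeast0LessThan mult.commute intro!: sum.cong)
  have "response n p b (whiten \<omega>) = response n p (?T *\<^sub>v b) \<omega>"
    using assoc_mult_mat_vec[OF c(1,2) b] by (simp add: response_def case_prod_unfold X) (simp add: whiten_def case_prod_unfold)
  moreover have "?Z * ?T * precision S * transpose_mat (?Z * ?T) = ?Z * transpose_mat ?Z"
  proof -
    have PL: "precision S * lmat p L \<in> carrier_mat p p" by (rule mult_carrier_mat[OF w(2) c(3)])
    have "transpose_mat (?Z * ?T) = lmat p L * transpose_mat ?Z"
      by (simp add: transpose_mult[OF c(1,2)])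
    then have "?Z * ?T * precision S * transpose_mat (?Z * ?T) = ?Z * ?T * precision S * (lmat p L * transpose_mat ?Z)"
      by simp
    also have "\<dots> = ?Z * ?T * precision S * lmat p L * transpose_mat ?Z"
      by (rule assoc_mult_mat[OF mult_carrier_mat[OF mult_carrier_mat[OF c(1,2)] w(2)] c(3,4), symmetric])
    also have "?Z * ?T * precision S * lmat p L = ?Z * ?T * (precision S * lmat p L)"
      by (rule assoc_mult_mat[OF mult_carrier_mat[OF c(1,2)] w(2) c(3)])
    also have "\<dots> = ?Z * (?T * (precision S * lmat p L))"
      by (rule assoc_mult_mat[OF c(1,2) PL])
    also have "\<dots> = ?Z" unfolding w(1) by (rule right_mult_one_mat[OF c(1)])
    finally show ?thesis .
  qed
  ultimately show ?thesis unfolding eta_dense_def V_hat_def X by simp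
qed

text \<open>The product formula over rows, with the constant function 1 in every row but the
  first.\<close>

lemma nn_integral_first_row:
  assumes [measurable]: "f \<in> borel_measurable borel" and n: "1 \<le> n"
  shows "(\<integral>\<^sup>+\<omega>. f (lin_form p \<theta> (fst \<omega> 0) + snd \<omega> 0) \<partial>\<mu>) = (\<integral>\<^sup>+g. f (sqrt (row_var \<theta> 1) * g) \<partial>std_normal)"
proof -
  let ?f = "\<lambda>i y. if i = 0 then f y else (1 :: ennreal)"
  have fin: "(\<Prod>i<n. if i = 0 then a else 1) = (a :: ennreal)" for a
    using n by (simp add: prod.delta)
  have "(\<integral>\<^sup>+\<omega>. (\<Prod>i<n. ?f i (lin_form p \<theta> (fst \<omega> i) + 1 * snd \<omega> i)) \<partial>\<mu>)
      = (\<Prod>i<n. \<integral>\<^sup>+g. ?f i (sqrt (row_var \<theta> 1) * g) \<partial>std_normal)"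
    by (rule nn_integral_rows) simp
  moreover have "(\<Prod>i<n. ?f i (lin_form p \<theta> (fst \<omega> i) + 1 * snd \<omega> i)) = f (lin_form p \<theta> (fst \<omega> 0) + snd \<omega> 0)" for \<omega>
  proof -
    have "(\<Prod>i<n. ?f i (lin_form p \<theta> (fst \<omega> i) + 1 * snd \<omega> i)) = (\<Prod>i<n. if i = 0 then f (lin_form p \<theta> (fst \<omega> 0) + snd \<omega> 0) else 1)"
      by (intro prod.cong) auto
    then show ?thesis unfolding fin .
  qed
  moreover have "(\<Prod>i<n. \<integral>\<^sup>+g. ?f i (sqrt (row_var \<theta> 1) * g) \<partial>std_normal) = (\<integral>\<^sup>+g. f (sqrt (row_var \<theta> 1) * g) \<partial>std_normal)"
  proof -
    have "(\<Prod>i<n. \<integral>\<^sup>+g. ?f i (sqrt (row_var \<theta> 1) * g) \<partial>std_normal)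
       = (\<Prod>i<n. if i = 0 then (\<integral>\<^sup>+g. f (sqrt (row_var \<theta> 1) * g) \<partial>std_normal) else 1)"
      by (intro prod.cong) auto
    then show ?thesis unfolding fin .
  qed
  ultimately show ?thesis by simp
qed

text \<open>The deviation bound refers to an abstract variance, which has to be identified with the
  explicit one. Equality of laws is obtained from nonnegative integrals of indicators and then
  carries over to Bochner integrals.\<close>

lemma variance_response:
  assumes n: "1 \<le> n" and b: "b \<in> carrier_vec p"
  shows "variance_on \<mu> (\<lambda>\<omega>. response n p b \<omega> $ 0) = row_var (\<lambda>j. b $ j) 1"
proof -
  let ?r = "sqrt (row_var (\<lambda>j. b $ j) 1)"
  let ?y = "\<lambda>\<omega>. lin_form p (\<lambda>j. b $ j) (fst \<omega> 0) + snd \<omega> 0"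
  have n0: "0 \<in> {..<n}" using n by simp
  have ym: "?y \<in> borel_measurable (data_space n p)" using n0 by measurable
  then have ym': "?y \<in> borel_measurable \<mu>" by (simp cong: measurable_cong_sets)
  have law: "distr \<mu> borel ?y = distr std_normal borel (\<lambda>g. ?r * g)"
  proof (rule measure_eqI)
    fix A :: "real set" assume "A \<in> sets (distr \<mu> borel ?y)"
    then have A [measurable]: "A \<in> sets borel" by simp
    have "emeasure (distr \<mu> borel ?y) A = (\<integral>\<^sup>+z. indicator A z \<partial>distr \<mu> borel ?y)" by simp
    also have "\<dots> = (\<integral>\<^sup>+\<omega>. indicator A (?y \<omega>) \<partial>\<mu>)" by (rule nn_integral_distr[OF ym']) simp
    also have "\<dots> = (\<integral>\<^sup>+g. indicator A (?r * g) \<partial>std_normal)" by (rule nn_integral_first_row[OF _ n]) simp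
    also have "\<dots> = (\<integral>\<^sup>+z. indicator A z \<partial>distr std_normal borel (\<lambda>g. ?r * g))" by (rule nn_integral_distr[symmetric]) simp_all
    also have "\<dots> = emeasure (distr std_normal borel (\<lambda>g. ?r * g)) A" by simp
    finally show "emeasure (distr \<mu> borel ?y) A = emeasure (distr std_normal borel (\<lambda>g. ?r * g)) A" .
  qed simp
  have int: "(\<integral>\<omega>. h (?y \<omega>) \<partial>\<mu>) = (\<integral>g. h (?r * g) \<partial>std_normal)" if [measurable]: "h \<in> borel_measurable borel" for h :: "real \<Rightarrow> real"
  proof -
    have "(\<integral>\<omega>. h (?y \<omega>) \<partial>\<mu>) = (\<integral>z. h z \<partial>distr \<mu> borel ?y)" by (rule integral_distr[OF ym', symmetric]) simp
    also have "\<dots> = (\<integral>g. h (?r * g) \<partial>std_normal)" unfolding law by (rule integral_distr) simp_all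
    finally show ?thesis .
  qed
  have m1: "(\<integral>g. g \<partial>std_normal) = 0"
    unfolding std_normal_def using integral_std_normal_moment_odd[of 0] by (subst integral_density) simp_all
  have m2: "(\<integral>g. g\<^sup>2 \<partial>std_normal) = 1"
    unfolding std_normal_def using integral_std_normal_moment_even[of 1] by (subst integral_density) (simp_all add: numeral_2_eq_2)
  have y: "response n p b \<omega> $ 0 = ?y \<omega>" for \<omega> by (rule response_index[OF b]) (use n in simp)
  have "(\<integral>\<omega>. ?y \<omega> \<partial>\<mu>) = 0" using int[of "\<lambda>z. z"] m1 by simp
  moreover have "(\<integral>\<omega>. (?y \<omega>)\<^sup>2 \<partial>\<mu>) = row_var (\<lambda>j. b $ j) 1"
    using int[of "\<lambda>z. z\<^sup>2"] m2 row_var_nonneg by (simp add: power_mult_distrib)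
  ultimately show ?thesis unfolding variance_on_def y by simp
qed

text \<open>The deviation bound is used at the identity covariance, with \<open>L^T b\<close> and
  \<open>t = ln p\<close>. Its target there is \<open>|L^T b|^2\<close> over the variance of the
  response, and \<open>|L^T b|^2 = b^T S b\<close>, which is the explained variation. The
  exceptional probability is \<open>C2 exp (- ln p) = C2 / p\<close>.\<close>

lemma dense_event:
  assumes dev: "deviation_constants C1 C2" and n: "1 \<le> n" "n \<le> p" and b: "b \<in> carrier_vec p"
    and lnp: "ln (real p) \<le> real n powr (1 / 3)"
  defines "A \<equiv> {\<omega> \<in> space \<mu>. \<bar>eta_dense (precision S) (design n p (fst \<omega>)) (response n p b \<omega>) - explained_variation S b \<sigma>\<bar>
      \<le> C1 * sqrt (real p * ln (real p)) / real n}"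
  shows "A \<in> sets (data_space n p)" "emeasure \<mu> (space \<mu> - A) \<le> ennreal (C2 / real p)"
proof -
  interpret I: gaussian_model n p "1\<^sub>m p" \<sigma> "\<lambda>i j. if i = j then 1 else 0"
    by unfold_locales (rule cholesky_one, rule \<sigma>_pos)
  let ?r = "C1 * sqrt (real p * ln (real p)) / real n"
  let ?b = "transpose_mat (lmat p L) *\<^sub>v b"
  have C1: "0 < C1" using dev by (simp add: deviation_constants_def)
  have bc: "?b \<in> carrier_vec p" by (rule mult_mat_vec_carrier[OF _ b]) simp
  note [measurable] = eta_dense_measurable[OF cholesky_precision(2)[OF chol] b, of n]
  show A: "A \<in> sets (data_space n p)" unfolding A_def space_model_law by measurable
  have q: "(\<Sum>l<p. (?b $ l)\<^sup>2) = quad_form p S (\<lambda>j. b $ j)"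
    unfolding cholesky_quad_form[OF chol, symmetric] using b
    by (intro sum.cong refl) (auto simp: scalar_prod_def atLeast0LessThan mult.commute intro!: sum.cong arg_cong[of _ _ "\<lambda>x. x\<^sup>2"])
  have "?b \<bullet> ((1\<^sub>m p * 1\<^sub>m p) *\<^sub>v ?b) = (\<Sum>l<p. (?b $ l)\<^sup>2)"
    using bc by (simp add: scalar_prod_def atLeast0LessThan power2_eq_square)
  then have num: "?b \<bullet> ((1\<^sub>m p * 1\<^sub>m p) *\<^sub>v ?b) = quad_form p S (\<lambda>j. b $ j)" by (simp only: q)
  have "quad_form p (1\<^sub>m p) (\<lambda>j. ?b $ j) = (\<Sum>l<p. (?b $ l)\<^sup>2)"
    unfolding cholesky_quad_form[OF cholesky_one, symmetric]
  proof (intro sum.cong refl)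
    fix l assume l: "l \<in> {..<p}"
    have "(\<Sum>j<p. ?b $ j * (if j = l then 1 else 0)) = (\<Sum>j<p. if j = l then ?b $ j else 0)" by (intro sum.cong) auto
    then show "(\<Sum>j<p. ?b $ j * (if j = l then 1 else 0))\<^sup>2 = (?b $ l)\<^sup>2" using l by simp
  qed
  then have var: "variance_on I.\<mu> (\<lambda>\<omega>. response n p ?b \<omega> $ 0) = row_var (\<lambda>j. b $ j) 1"
    unfolding I.variance_response[OF n(1) bc] I.row_var_def row_var_def q by simp
  have target: "?b \<bullet> ((1\<^sub>m p * 1\<^sub>m p) *\<^sub>v ?b) / variance_on I.\<mu> (\<lambda>\<omega>. response n p ?b \<omega> $ 0) = explained_variation S b \<sigma>"
    unfolding num var explained_variation_eq[OF b] using row_var_noise_pos[of "\<lambda>j. b $ j"]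
    by (simp add: row_var_def field_simps)
  have inv1: "invertible_mat (1\<^sub>m p :: real mat)"
    unfolding invertible_mat_def inverts_mat_def by (auto intro!: exI[of _ "1\<^sub>m p"])
  have p1: "1 \<le> real p" using n by simp
  let ?D = "{\<omega> \<in> space I.\<mu>. \<bar>V_hat (design n p (fst \<omega>)) (response n p ?b \<omega>) - explained_variation S b \<sigma>\<bar>
      \<le> C1 * op_norm (1\<^sub>m p) * sqrt (real p * ln (real p)) / real n}"
  let ?D' = "{\<omega> \<in> space I.\<mu>. \<bar>V_hat (design n p (fst \<omega>)) (response n p ?b \<omega>) - explained_variation S b \<sigma>\<bar> \<le> ?r}"
  have "1 - C2 * exp (- ln (real p)) \<le> measure I.\<mu> ?D"
    using conjunct2[OF conjunct2[OF dev[unfolded deviation_constants_def]], rule_format,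
        of n p "1\<^sub>m p" ?b \<sigma> "ln (real p)", OF n I.S_covariance inv1 bc \<sigma>_pos _ lnp] p1
    unfolding target by simp
  also have "\<dots> \<le> measure I.\<mu> ?D'"
  proof (rule finite_measure.finite_measure_mono)
    show "finite_measure I.\<mu>" using I.prob_\<mu> by (rule prob_space.finite_measure)
    have "C1 * op_norm (1\<^sub>m p) * sqrt (real p * ln (real p)) / real n \<le> ?r"
      using C1 op_norm_one[of p] p1 by (intro divide_right_mono mult_right_mono) auto
    then show "?D \<subseteq> ?D'" by auto
    note [measurable] = eta_dense_measurable[OF one_carrier_mat bc, of n]
    have "?D' \<in> sets (data_space n p)"
      unfolding eta_dense_one space_model_law by measurable
    then show "?D' \<in> sets I.\<mu>" by simp
  qed
  also have "?D' = whiten -` A \<inter> space I.\<mu>"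
    using measurable_space[OF whiten_measurable] by (auto simp: A_def whiten_eta_dense[OF b])
  also have "measure I.\<mu> (whiten -` A \<inter> space I.\<mu>) = measure (distr I.\<mu> \<mu> whiten) A"
    by (rule measure_distr[symmetric, OF whiten_measurable]) (simp add: A)
  also have "\<dots> = measure \<mu> A" unfolding model_law_whiten[symmetric] ..
  finally have "1 - measure \<mu> A \<le> C2 / real p" using p1 by (simp add: exp_minus inverse_eq_divide)
  moreover have "measure \<mu> (space \<mu> - A) = 1 - measure \<mu> A"
    by (rule prob_space.prob_compl[OF prob_\<mu>]) (simp add: A)
  moreover have "emeasure \<mu> (space \<mu> - A) = ennreal (measure \<mu> (space \<mu> - A))"
    by (rule finite_measure.emeasure_eq_measure[OF prob_space.finite_measure[OF prob_\<mu>]])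
  ultimately show "emeasure \<mu> (space \<mu> - A) \<le> ennreal (C2 / real p)" by (simp add: ennreal_leI)
qed

end

section \<open>The adaptive estimator\<close>

lemma adaptive_pointwise:
  fixes D l h r :: real
  defines "a \<equiv> (if \<bar>D - l\<bar> \<le> 2 * r then l else D)"
  assumes "\<bar>D - h\<bar> \<le> r"
  shows "(a - h)\<^sup>2 \<le> 9 * r\<^sup>2" "(a - h)\<^sup>2 \<le> (l - h)\<^sup>2"
proof -
  have "\<bar>a - h\<bar> \<le> 3 * r" using assms by (auto simp: a_def)
  then have "\<bar>a - h\<bar>\<^sup>2 \<le> (3 * r)\<^sup>2" by (rule power_mono) simp
  then show "(a - h)\<^sup>2 \<le> 9 * r\<^sup>2" by (simp add: power_mult_distrib)
  have "\<bar>a - h\<bar> \<le> \<bar>l - h\<bar>" using assms by (auto simp: a_def)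
  then show "(a - h)\<^sup>2 \<le> (l - h)\<^sup>2" by (simp add: abs_le_square_iff)
qed

lemma unit_interval_diff_square:
  fixes a b :: real
  assumes "0 \<le> a" "a \<le> 1" "0 \<le> b" "b \<le> 1"
  shows "(a - b)\<^sup>2 \<le> 1"
  using assms by (simp add: abs_square_le_1) 

text \<open>To be used with \<open>y = n^(1/3)\<close>, where \<open>y^6 = n^2\<close>: the seventh
  power is the first that beats \<open>n^2\<close> with a factor \<open>y\<close> to spare. The
  constant is \<open>7^7\<close>.\<close>

lemma exp_ge_power7: "0 \<le> y \<Longrightarrow> y ^ 7 / 823543 \<le> exp y" for y :: real
proof -
  assume y: "0 \<le> y"
  have "y / 7 \<le> exp (y / 7)" using exp_ge_add_one_self[of "y / 7"] by linarith
  then have "(y / 7) ^ 7 \<le> exp (y / 7) ^ 7" using y by (intro power_mono) auto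
  also have "\<dots> = exp y" by (simp add: exp_of_nat_mult[symmetric])
  finally show ?thesis by (simp add: power_divide)
qed

text \<open>Outside the range in which the deviation bound for the dense estimator applies, \<open>p\<close> is so large
  that the threshold of the adaptive estimator exceeds 1 for all but finitely many \<open>n\<close>.\<close>
lemma ultra_high_dimension:
  assumes n: "1 \<le> n" and p: "n \<le> p" and big: "real n powr (1 / 3) < ln (real p)"
  shows "real n powr (1 / 3) / 823543 \<le> real p * ln (real p) / (real n)\<^sup>2" "1 \<le> real n powr (1 / 3)"
proof -
  define y where "y = real n powr (1 / 3)"
  show y1: "1 \<le> real n powr (1 / 3)" using n by (simp add: ge_one_powr_ge_zero)
  have "y ^ 6 = real n powr (real 6 * (1 / 3))"
    unfolding y_def by (rule powr_power) (use n in simp)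
  also have "\<dots> = real n powr 2" by simp
  also have "\<dots> = (real n)\<^sup>2" using n by (intro powr_numeral) linarith
  finally have y6: "y ^ 6 = (real n)\<^sup>2" .
  have "y ^ 7 / 823543 \<le> exp y" using y1 by (intro exp_ge_power7) (simp add: y_def)
  also have "\<dots> \<le> exp (ln (real p))" using big by (simp add: y_def)
  also have "\<dots> = real p" using n p by simp
  finally have pp: "y ^ 7 / 823543 \<le> real p" .
  have l: "1 \<le> ln (real p)" using big y1 by linarith
  have "y / 823543 * (real n)\<^sup>2 = y ^ 7 / 823543" unfolding y6[symmetric] by (simp add: eval_nat_numeral)
  also have "\<dots> \<le> real p * ln (real p)" using pp l mult_left_mono[of 1 "ln (real p)" "real p"] by simp
  finally show "real n powr (1 / 3) / 823543 \<le> real p * ln (real p) / (real n)\<^sup>2"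
    using n by (simp add: y_def pos_le_divide_eq)
qed

section \<open>Risk of the adaptive estimator\<close>

context gaussian_model
begin

text \<open>Turns a pointwise bound into a bound on the risk: on \<open>B\<close> the error is at
  most 1 and costs the probability of \<open>B\<close>, elsewhere it is a deterministic part plus a
  part that is small in mean.\<close>

lemma risk_bound:
  assumes f: "\<And>\<omega>. 0 \<le> f \<omega>" "\<And>\<omega>. f \<omega> \<le> 1"
    and B: "B \<in> sets (data_space n p)" "emeasure \<mu> B \<le> ennreal \<beta>"
    and g: "g \<in> borel_measurable (data_space n p)" "\<And>\<omega>. 0 \<le> g \<omega>" "(\<integral>\<^sup>+\<omega>. ennreal (g \<omega>) \<partial>\<mu>) \<le> ennreal \<gamma>"
    and le: "\<And>\<omega>. \<omega> \<in> space \<mu> \<Longrightarrow> \<omega> \<notin> B \<Longrightarrow> f \<omega> \<le> c + g \<omega>"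
    and nonneg: "0 \<le> \<beta>" "0 \<le> \<gamma>" "0 \<le> c"
  shows "(\<integral>\<omega>. f \<omega> \<partial>\<mu>) \<le> \<beta> + \<gamma> + c"
proof (cases "integrable \<mu> f")
  case True
  interpret prob_space \<mu> by (rule prob_\<mu>)
  note [measurable] = g(1)
  have "(\<integral>\<^sup>+\<omega>. ennreal (f \<omega>) \<partial>\<mu>) \<le> (\<integral>\<^sup>+\<omega>. (indicator B \<omega> + ennreal (g \<omega>)) + ennreal c \<partial>\<mu>)"
  proof (rule nn_integral_mono)
    fix \<omega> assume w: "\<omega> \<in> space \<mu>"
    show "ennreal (f \<omega>) \<le> (indicator B \<omega> + ennreal (g \<omega>)) + ennreal c"
    proof (cases "\<omega> \<in> B")
      case True
      have "ennreal (f \<omega>) \<le> 1" using ennreal_leI[OF f(2)] by simp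
      also have "\<dots> \<le> (indicator B \<omega> + ennreal (g \<omega>)) + ennreal c" using True by (simp add: add.assoc)
      finally show ?thesis .
    next
      case False
      then show ?thesis using ennreal_leI[OF le[OF w False]] g(2) nonneg
        by (simp add: ennreal_plus[symmetric] add.commute del: ennreal_plus)
    qed
  qed
  also have "\<dots> = emeasure \<mu> B + (\<integral>\<^sup>+\<omega>. ennreal (g \<omega>) \<partial>\<mu>) + ennreal c"
    using B(1) by (simp add: nn_integral_add emeasure_space_1)
  also have "\<dots> \<le> ennreal \<beta> + ennreal \<gamma> + ennreal c" using B(2) g(3) by (intro add_mono) auto
  also have "\<dots> = ennreal (\<beta> + \<gamma> + c)" using nonneg by simp
  finally have "enn2real (\<integral>\<^sup>+\<omega>. ennreal (f \<omega>) \<partial>\<mu>) \<le> \<beta> + \<gamma> + c"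
    using nonneg by (intro enn2real_leI) auto
  then show ?thesis using True f(1) by (simp add: integral_eq_nn_integral)
next
  case False
  \<comment> \<open>The Bochner integral of a non-integrable function is 0 by convention, and the
    right side is nonnegative.\<close>
  then show ?thesis using nonneg by (simp add: not_integrable_integral_eq)
qed

end

locale adaptive_setting = gaussian_model +
  fixes C1 C2 :: real and sl :: "real mat \<Rightarrow> real vec \<Rightarrow> real vec" and k :: nat and b :: "real vec"
  assumes dev: "deviation_constants C1 C2" and n1: "1 \<le> n" and np: "n \<le> p"
    and sl: "sqrt_lasso_estimator n p sl" and k1: "1 \<le> k" and b: "b \<in> carrier_vec p" and sparse: "k_sparse k b"
begin

abbreviation \<eta> where "\<eta> \<equiv> explained_variation S b \<sigma>"
abbreviation lasso where "lasso \<omega> \<equiv> eta_sqrt_lasso sl (design n p (fst \<omega>)) (response n p b \<omega>)"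
abbreviation dense where "dense \<omega> \<equiv> eta_dense_trunc (precision S) (design n p (fst \<omega>)) (response n p b \<omega>)"
abbreviation err where
  "err \<omega> \<equiv> (eta_adaptive (2 * C1) sl (precision S) (design n p (fst \<omega>)) (response n p b \<omega>) - \<eta>)\<^sup>2"

definition radius :: real where "radius = C1 * sqrt (real p * ln (real p)) / real n"
definition dense_rate :: real where "dense_rate = real p * ln (real p) / (real n)\<^sup>2"
definition sparse_rate :: real where
  "sparse_rate = (real k)\<^sup>2 * (ln (real p))\<^sup>2 / (real n)\<^sup>2 * ((lambda_max S)\<^sup>2 / (lambda_min S)\<^sup>2)"
definition dense_good :: "((nat \<Rightarrow> nat \<Rightarrow> real) \<times> (nat \<Rightarrow> real)) set" where
  "dense_good = {\<omega> \<in> space \<mu>. \<bar>eta_dense (precision S) (design n p (fst \<omega>)) (response n p b \<omega>) - \<eta>\<bar> \<le> radius}"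

lemma C_pos: "0 < C1" "0 < C2"
  using dev by (simp_all add: deviation_constants_def)

lemma eta_bounds: "0 \<le> \<eta>" "\<eta> \<le> 1"
proof -
  have "\<sigma>\<^sup>2 \<le> row_var (\<lambda>j. b $ j) 1" using quad_form_nonneg by (simp add: row_var_def)
  then show "0 \<le> \<eta>" "\<eta> \<le> 1"
    using row_var_noise_pos[of "\<lambda>j. b $ j"] unfolding explained_variation_eq[OF b] by (simp_all add: divide_le_eq_1)
qed

lemma lasso_bounds: "0 \<le> lasso \<omega>" "lasso \<omega> \<le> 1"
  using eta_sqrt_lasso_bounds[OF sl b] n1 np by simp_all

lemma dense_bounds: "0 \<le> dense \<omega>" "dense \<omega> \<le> 1"
  by (simp_all add: eta_dense_trunc_def)

lemma adaptive_eq: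
  "eta_adaptive (2 * C1) sl (precision S) (design n p (fst \<omega>)) (response n p b \<omega>) =
    (if \<bar>dense \<omega> - lasso \<omega>\<bar> \<le> 2 * radius then lasso \<omega> else dense \<omega>)"
  by (simp add: eta_adaptive_def radius_def)

lemma err_bounds: "0 \<le> err \<omega>" "err \<omega> \<le> 1"
  using lasso_bounds[of \<omega>] dense_bounds[of \<omega>] eta_bounds
  unfolding adaptive_eq by (auto intro!: unit_interval_diff_square)

lemma p1: "1 \<le> real p"
  using n1 np by simp

lemma ln_p_nonneg: "0 \<le> ln (real p)"
  using p1 by simp

lemma radius_sq: "radius\<^sup>2 = C1\<^sup>2 * dense_rate"
  using ln_p_nonneg by (simp add: radius_def dense_rate_def power_divide power_mult_distrib)

lemma rates_nonneg: "0 \<le> dense_rate" "0 \<le> sparse_rate"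
  using ln_p_nonneg by (simp_all add: dense_rate_def sparse_rate_def)

text \<open>Truncating to the unit interval cannot increase the distance to a point of that
  interval.\<close>

lemma dense_good_close: "\<omega> \<in> dense_good \<Longrightarrow> \<bar>dense \<omega> - \<eta>\<bar> \<le> radius"
  using eta_bounds by (auto simp: dense_good_def eta_dense_trunc_def min_def max_def split: if_splits)

lemma emeasure_dense_bad:
  assumes "ln (real p) \<le> real n powr (1 / 3)"
  shows "space \<mu> - dense_good \<in> sets (data_space n p)" "emeasure \<mu> (space \<mu> - dense_good) \<le> ennreal (C2 / real n)"
proof -
  note d = dense_event[OF dev n1 np b assms, folded radius_def]
  have good: "dense_good \<in> sets (data_space n p)" using d(1) by (simp add: dense_good_def)
  then show "space \<mu> - dense_good \<in> sets (data_space n p)"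
    unfolding space_model_law by (rule sets.compl_sets)
  have "emeasure \<mu> (space \<mu> - dense_good) \<le> ennreal (C2 / real p)" using d(2) by (simp add: dense_good_def)
  also have "\<dots> \<le> ennreal (C2 / real n)"
    using C_pos n1 np by (intro ennreal_leI divide_left_mono) auto
  finally show "emeasure \<mu> (space \<mu> - dense_good) \<le> ennreal (C2 / real n)" .
qed

lemma risk_le_1: "(\<integral>\<omega>. err \<omega> \<partial>\<mu>) \<le> 1"
  using risk_bound[of err "{}" 0 "\<lambda>_. 0" 0 1, OF err_bounds] err_bounds(2) by simp

text \<open>Where the deviation bound does not reach, \<open>p\<close> exceeds
  \<open>exp (n^(1/3))\<close> and the dense rate is at least \<open>7^(-7)\<close>, so the trivial
  bound 1 on the risk suffices.\<close>

lemma dense_risk: "(\<integral>\<omega>. err \<omega> \<partial>\<mu>) \<le> (C2 + 9 * C1\<^sup>2 + 823543) * (1 / real n + dense_rate)"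
proof (cases "ln (real p) \<le> real n powr (1 / 3)")
  case True
  have "(\<integral>\<omega>. err \<omega> \<partial>\<mu>) \<le> C2 / real n + 0 + 9 * radius\<^sup>2"
  proof (rule risk_bound[OF err_bounds emeasure_dense_bad[OF True]])
    fix \<omega> assume "\<omega> \<in> space \<mu>" "\<omega> \<notin> space \<mu> - dense_good"
    then have "\<bar>dense \<omega> - \<eta>\<bar> \<le> radius" using dense_good_close by blast
    then show "err \<omega> \<le> 9 * radius\<^sup>2 + 0" unfolding adaptive_eq using adaptive_pointwise(1) by simp
  qed (use C_pos in simp_all)
  also have "\<dots> = C2 * (1 / real n) + 9 * C1\<^sup>2 * dense_rate" by (simp add: radius_sq)
  also have "\<dots> \<le> (C2 + 9 * C1\<^sup>2 + 823543) * (1 / real n) + (C2 + 9 * C1\<^sup>2 + 823543) * dense_rate"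
    using C_pos rates_nonneg by (intro add_mono mult_right_mono) auto
  finally show ?thesis by (simp add: distrib_left)
next
  case False
  then have u: "real n powr (1 / 3) / 823543 \<le> dense_rate" "1 \<le> real n powr (1 / 3)"
    using ultra_high_dimension[OF n1 np] by (auto simp: dense_rate_def)
  have "1 \<le> 823543 * dense_rate" using u by simp
  also have "\<dots> \<le> (C2 + 9 * C1\<^sup>2 + 823543) * (1 / real n + dense_rate)"
    using C_pos rates_nonneg by (intro mult_mono) auto
  finally show ?thesis using risk_le_1 by linarith
qed

lemma sparse_rate_eq: "sparse_rate = (real k * (lambda_max S / lambda_min S) * ln (real p) / real n)\<^sup>2"
  by (simp add: sparse_rate_def power_divide power_mult_distrib mult_ac)

lemma lasso_event:
  assumes p2: "2 \<le> p" and small: "100000 * (real k * (lambda_max S / lambda_min S) * ln (real p)) \<le> real n"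
  obtains B where "B \<in> sets (data_space n p)" "emeasure \<mu> B \<le> ennreal (42 / real n)"
    "\<And>\<omega>. \<omega> \<in> space \<mu> \<Longrightarrow> \<omega> \<notin> B \<Longrightarrow> (lasso \<omega> - \<eta>)\<^sup>2 \<le> 512 * 1297920\<^sup>2 * sparse_rate
       + 64 * ((sq_sum (\<lambda>_. 0) 1 \<omega> / (real n * row_var (\<lambda>_. 0) 1) - 1)\<^sup>2
           + (sq_sum (\<lambda>j. b $ j) 1 \<omega> / (real n * row_var (\<lambda>j. b $ j) 1) - 1)\<^sup>2)"
proof -
  define y where "y = real k * (lambda_max S / lambda_min S)"
  \<comment> \<open>Large enough for the restricted eigenvalue condition, yet at most
    \<open>4610 * y\<close>, so that the grid stays small enough for the union bound.\<close>
  define m where "m = nat \<lceil>4608 * y\<rceil> + 1"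
  have p0: "0 < p" using p2 by simp
  have lp: "0 < ln (real p)" using p2 by simp
  have "1 \<le> lambda_max S / lambda_min S"
    using lambda_bounds(1)[OF S_covariance S_det p0] S_diag_bounds(1,2)[OF p0] by simp
  then have y1: "1 \<le> y" unfolding y_def using k1 mult_mono[of 1 "real k" 1 "lambda_max S / lambda_min S"] by simp
  have m1: "4608 * y \<le> real m - 1" unfolding m_def by (simp add: real_nat_ceiling_ge)
  have m2: "2 \<le> m" using m1 y1 by linarith
  have m3: "real m \<le> 4610 * y"
  proof -
    have "real (nat \<lceil>4608 * y\<rceil>) \<le> 4608 * y + 1" using y1 by linarith
    then show ?thesis unfolding m_def of_nat_add of_nat_1 using y1 by linarith
  qed
  have s: "100000 * (y * ln (real p)) \<le> real n" using small by (simp add: y_def)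
  have ypos: "0 \<le> y * ln (real p)" using y1 lp by simp
  have "ln (2 * real p) \<le> 2 * ln (real p)"
  proof -
    have "ln (2 * real p) = ln 2 + ln (real p)" using p2 by (simp add: ln_mult)
    moreover have "ln 2 \<le> ln (real p)" using p2 by simp
    ultimately show ?thesis by simp
  qed
  then have "real m * ln (2 * real p) \<le> real m * (2 * ln (real p))" by (intro mult_left_mono) auto
  also have "\<dots> \<le> 4610 * y * (2 * ln (real p))" using m3 lp by (intro mult_right_mono) auto
  also have "\<dots> = 9220 * (y * ln (real p))" by simp
  \<comment> \<open>This needs \<open>n >= 73760 y ln p\<close>; the factor 100000 in the assumption
    leaves room for it.\<close>
  also have "\<dots> \<le> real n / 8" using s ypos by linarith
  finally have m4: "real m * ln (2 * real p) \<le> real n / 8" .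
  have "ln (real p) \<le> y * ln (real p)" using y1 lp mult_right_mono[of 1 y "ln (real p)"] by simp
  then have lpn: "ln (real p) \<le> real n / 8" using s ypos by linarith
  show thesis
  proof (rule that)
    show "lasso_bad m (\<lambda>j. b $ j) \<in> sets (data_space n p)" by (rule lasso_bad_sets)
    show "emeasure \<mu> (lasso_bad m (\<lambda>j. b $ j)) \<le> ennreal (42 / real n)"
      by (rule emeasure_lasso_bad[OF n1 p2 np m4 lpn S_diag_bounds(3)])
    fix \<omega> assume "\<omega> \<in> space \<mu>" "\<omega> \<notin> lasso_bad m (\<lambda>j. b $ j)"
    from sqrt_lasso_good[OF n1 p2 b sl sparse k1 small m2 m1[unfolded y_def] this]
    show "(lasso \<omega> - \<eta>)\<^sup>2 \<le> 512 * 1297920\<^sup>2 * sparse_rate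
       + 64 * ((sq_sum (\<lambda>_. 0) 1 \<omega> / (real n * row_var (\<lambda>_. 0) 1) - 1)\<^sup>2
           + (sq_sum (\<lambda>j. b $ j) 1 \<omega> / (real n * row_var (\<lambda>j. b $ j) 1) - 1)\<^sup>2)"
      unfolding sparse_rate_eq power_mult_distrib[of 1297920] by (simp only: mult.assoc)
  qed
qed

text \<open>Domination by the Lasso is established in two different ways, hence the abstract event
  \<open>A\<close>: the failure of the dense bound, or the empty set when the threshold is never
  exceeded.\<close>

lemma sparse_risk_of_dominated:
  assumes p2: "2 \<le> p" and small: "100000 * (real k * (lambda_max S / lambda_min S) * ln (real p)) \<le> real n"
    and A: "A \<in> sets (data_space n p)" "emeasure \<mu> A \<le> ennreal (C2 / real n)"
    and dom: "\<And>\<omega>. \<omega> \<in> space \<mu> \<Longrightarrow> \<omega> \<notin> A \<Longrightarrow> err \<omega> \<le> (lasso \<omega> - \<eta>)\<^sup>2"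
  shows "(\<integral>\<omega>. err \<omega> \<partial>\<mu>) \<le> (C2 + 16426) / real n + 512 * 1297920\<^sup>2 * sparse_rate"
proof -
  define f where "f \<theta> \<omega> = (sq_sum \<theta> 1 \<omega> / (real n * row_var \<theta> 1) - 1)\<^sup>2" for \<theta> \<omega>
  define g where "g \<omega> = 64 * (f (\<lambda>_. 0) \<omega> + f (\<lambda>j. b $ j) \<omega>)" for \<omega>
  have fm [measurable]: "f \<theta> \<in> borel_measurable (data_space n p)" for \<theta> unfolding f_def by measurable
  have f0: "0 \<le> f \<theta> \<omega>" for \<theta> \<omega> by (simp add: f_def)
  have fi: "(\<integral>\<^sup>+\<omega>. ennreal (f \<theta> \<omega>) \<partial>\<mu>) \<le> ennreal (128 / real n)" for \<theta>
    unfolding f_def by (rule sq_sum_second_moment[OF row_var_noise_pos n1])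
  obtain B where B: "B \<in> sets (data_space n p)" "emeasure \<mu> B \<le> ennreal (42 / real n)"
    "\<And>\<omega>. \<omega> \<in> space \<mu> \<Longrightarrow> \<omega> \<notin> B \<Longrightarrow> (lasso \<omega> - \<eta>)\<^sup>2 \<le> 512 * 1297920\<^sup>2 * sparse_rate + g \<omega>"
    using lasso_event[OF p2 small] unfolding g_def f_def by blast
  have "ennreal (g \<omega>) = ennreal 64 * (ennreal (f (\<lambda>_. 0) \<omega>) + ennreal (f (\<lambda>j. b $ j) \<omega>))" for \<omega>
    unfolding g_def using f0 by (subst ennreal_mult) simp_all
  then have "(\<integral>\<^sup>+\<omega>. ennreal (g \<omega>) \<partial>\<mu>) = (\<integral>\<^sup>+\<omega>. ennreal 64 * (ennreal (f (\<lambda>_. 0) \<omega>) + ennreal (f (\<lambda>j. b $ j) \<omega>)) \<partial>\<mu>)"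
    by simp
  also have "\<dots> = ennreal 64 * ((\<integral>\<^sup>+\<omega>. ennreal (f (\<lambda>_. 0) \<omega>) \<partial>\<mu>) + (\<integral>\<^sup>+\<omega>. ennreal (f (\<lambda>j. b $ j) \<omega>) \<partial>\<mu>))"
    by (simp add: nn_integral_cmult nn_integral_add)
  also have "\<dots> \<le> ennreal 64 * (ennreal (128 / real n) + ennreal (128 / real n))"
    by (intro mult_left_mono add_mono fi) auto
  also have "ennreal (128 / real n) + ennreal (128 / real n) = ennreal (256 / real n)"
    by (simp add: ennreal_plus[symmetric] del: ennreal_plus)
  also have "ennreal 64 * ennreal (256 / real n) = ennreal (16384 / real n)"
    by (subst ennreal_mult[symmetric]) simp_all
  finally have gi: "(\<integral>\<^sup>+\<omega>. ennreal (g \<omega>) \<partial>\<mu>) \<le> ennreal (16384 / real n)" .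
  have "(\<integral>\<omega>. err \<omega> \<partial>\<mu>) \<le> (C2 / real n + 42 / real n) + 16384 / real n + 512 * 1297920\<^sup>2 * sparse_rate"
  proof (rule risk_bound[OF err_bounds])
    show "A \<union> B \<in> sets (data_space n p)" using A B by auto
    show "emeasure \<mu> (A \<union> B) \<le> ennreal (C2 / real n + 42 / real n)"
      by (rule emeasure_Un_le) (use A B C_pos in auto)
    show "g \<in> borel_measurable (data_space n p)" unfolding g_def by measurable
    show "0 \<le> g \<omega>" for \<omega> using f0 by (simp add: g_def)
    fix \<omega> assume "\<omega> \<in> space \<mu>" "\<omega> \<notin> A \<union> B"
    then show "err \<omega> \<le> 512 * 1297920\<^sup>2 * sparse_rate + g \<omega>" using dom B(3) order_trans by blast
  qed (use gi C_pos rates_nonneg in auto)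
  \<comment> \<open>\<open>16426 = 42 + 64 * (128 + 128)\<close>: the exceptional event and the two
    second moments.\<close>
  also have "\<dots> = (C2 + 16426) / real n + 512 * 1297920\<^sup>2 * sparse_rate" by (simp add: add_divide_distrib)
  finally show ?thesis .
qed

text \<open>The first three summands cover the range where the Lasso analysis applies,
  \<open>100000^2\<close> the range where its sparsity condition fails, and the cube bounds those
  \<open>n\<close> for which \<open>ln p > n^(1/3)\<close> although the threshold stays below
  1.\<close>

definition sparse_const :: real where
  "sparse_const = C2 + 16426 + 512 * 1297920\<^sup>2 + 100000\<^sup>2 + (823543 / (4 * C1\<^sup>2)) ^ 3"

text \<open>Four ranges. For \<open>p < 2\<close> one has \<open>n = 1\<close>; if the sparsity
  condition fails, the sparse rate is at least \<open>10^(-10)\<close>; within reach of the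
  deviation bound the Lasso dominates off a small event. For still larger \<open>p\<close>, either
  the threshold is at least 1, or \<open>n\<close> is bounded in terms of \<open>C1\<close>.\<close>

lemma sparse_risk: "(\<integral>\<omega>. err \<omega> \<partial>\<mu>) \<le> sparse_const * (1 / real n + sparse_rate)"
proof -
  have K: "C2 + 16426 \<le> sparse_const" "512 * 1297920\<^sup>2 \<le> sparse_const" "100000\<^sup>2 \<le> sparse_const"
    "(823543 / (4 * C1\<^sup>2)) ^ 3 \<le> sparse_const" "0 \<le> sparse_const" "1 \<le> sparse_const"
    using C_pos zero_le_power[of "823543 / (4 * C1\<^sup>2)" 3] unfolding sparse_const_def by (auto simp del: zero_le_power)
  have trivial: ?thesis if "1 \<le> c * (1 / real n)" "c \<le> sparse_const" for c
  proof -
    have "1 \<le> sparse_const * (1 / real n)" using that by (meson mult_right_mono order_trans divide_nonneg_nonneg of_nat_0_le_iff zero_le_one)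
    also have "\<dots> \<le> sparse_const * (1 / real n + sparse_rate)" using K rates_nonneg by (intro mult_left_mono) auto
    finally show ?thesis using risk_le_1 by linarith
  qed
  have main: ?thesis if p2: "2 \<le> p" and small: "100000 * (real k * (lambda_max S / lambda_min S) * ln (real p)) \<le> real n"
    and A: "A \<in> sets (data_space n p)" "emeasure \<mu> A \<le> ennreal (C2 / real n)"
    and dom: "\<And>\<omega>. \<omega> \<in> space \<mu> \<Longrightarrow> \<omega> \<notin> A \<Longrightarrow> err \<omega> \<le> (lasso \<omega> - \<eta>)\<^sup>2" for A
  proof -
    have "(\<integral>\<omega>. err \<omega> \<partial>\<mu>) \<le> (C2 + 16426) * (1 / real n) + 512 * 1297920\<^sup>2 * sparse_rate"
      using sparse_risk_of_dominated[OF that] by simp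
    also have "\<dots> \<le> sparse_const * (1 / real n) + sparse_const * sparse_rate"
      using K rates_nonneg by (intro add_mono mult_right_mono) auto
    finally show ?thesis by (simp add: distrib_left)
  qed
  consider "p < 2" | "real n < 100000 * (real k * (lambda_max S / lambda_min S) * ln (real p))"
    | "2 \<le> p" "100000 * (real k * (lambda_max S / lambda_min S) * ln (real p)) \<le> real n" "ln (real p) \<le> real n powr (1 / 3)"
    | "2 \<le> p" "100000 * (real k * (lambda_max S / lambda_min S) * ln (real p)) \<le> real n" "real n powr (1 / 3) < ln (real p)"
    by linarith
  then show ?thesis
  proof cases
    case 1
    then have "n = 1" using n1 np by simp
    then show ?thesis using K(6) by (intro trivial[of 1]) auto
  next
    case 2
    define y where "y = real k * (lambda_max S / lambda_min S) * ln (real p)"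
    have "1 \<le> 100000 * (y / real n)" using 2[folded y_def] n1 by simp
    then have "1\<^sup>2 \<le> (100000 * (y / real n))\<^sup>2" by (intro power_mono) auto
    also have "\<dots> = 100000\<^sup>2 * sparse_rate" by (simp only: sparse_rate_eq y_def power_mult_distrib)
    also have "\<dots> \<le> sparse_const * (1 / real n + sparse_rate)"
      using K rates_nonneg by (intro mult_mono) auto
    finally show ?thesis using risk_le_1 by simp
  next
    case 3
    show ?thesis
    proof (rule main[OF 3(1,2) emeasure_dense_bad[OF 3(3)]])
      fix \<omega> assume "\<omega> \<in> space \<mu>" "\<omega> \<notin> space \<mu> - dense_good"
      then have "\<bar>dense \<omega> - \<eta>\<bar> \<le> radius" using dense_good_close by blast
      then show "err \<omega> \<le> (lasso \<omega> - \<eta>)\<^sup>2" unfolding adaptive_eq by (rule adaptive_pointwise(2))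
    qed
  next
    case 4
    note u = ultra_high_dimension[OF n1 np 4(3), folded dense_rate_def]
    show ?thesis
    proof (cases "1 \<le> 2 * radius")
      case True
      show ?thesis
      \<comment> \<open>Both estimators lie in the unit interval, so a threshold of at least 1 is
        never exceeded and the adaptive estimator is the Lasso everywhere.\<close>
      proof (rule main[OF 4(1,2), of "{}"])
        fix \<omega>
        have "\<bar>dense \<omega> - lasso \<omega>\<bar> \<le> 2 * radius" using True lasso_bounds[of \<omega>] dense_bounds[of \<omega>] by linarith
        then show "err \<omega> \<le> (lasso \<omega> - \<eta>)\<^sup>2" unfolding adaptive_eq by simp
      qed auto
    next
      case False
      define y where "y = real n powr (1 / 3)"
      have "0 \<le> radius" using C_pos ln_p_nonneg by (simp add: radius_def)
      then have "(2 * radius)\<^sup>2 < 1\<^sup>2" using False by (intro power_strict_mono) auto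
      then have "4 * C1\<^sup>2 * dense_rate < 1" by (simp add: power_mult_distrib radius_sq)
      moreover have "4 * C1\<^sup>2 * (y / 823543) \<le> 4 * C1\<^sup>2 * dense_rate" using u(1) by (intro mult_left_mono) (auto simp: y_def)
      ultimately have "4 * C1\<^sup>2 * (y / 823543) < 1" by linarith
      then have "y \<le> 823543 / (4 * C1\<^sup>2)" using C_pos by (simp add: field_simps)
      then have "y ^ 3 \<le> (823543 / (4 * C1\<^sup>2)) ^ 3" using u(2) by (intro power_mono) (auto simp: y_def)
      moreover have "y ^ 3 = real n powr (real 3 * (1 / 3))"
        unfolding y_def by (rule powr_power) (use n1 in simp)
      moreover have "real n powr (real 3 * (1 / 3)) = real n" by simp
      ultimately have "1 \<le> (823543 / (4 * C1\<^sup>2)) ^ 3 * (1 / real n)" using n1 by simp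
      then show ?thesis by (rule trivial) (rule K)
    qed
  qed
qed

end

theorem theorem3p2:
  fixes C1 C2 :: real
  assumes "deviation_constants C1 C2"
  shows "\<exists>C>0. \<forall>(n::nat) (p::nat) (S::real mat) (sl::real mat \<Rightarrow> real vec \<Rightarrow> real vec)
           (k::nat) (b::real vec) (\<sigma>::real).
       1 \<le> n \<longrightarrow> n \<le> p \<longrightarrow> covariance_matrix p S \<longrightarrow> invertible_mat S \<longrightarrow>
       sqrt_lasso_estimator n p sl \<longrightarrow>
       k \<in> {1..p} \<longrightarrow> b \<in> carrier_vec p \<longrightarrow> k_sparse k b \<longrightarrow> 0 < \<sigma> \<longrightarrow>
       (\<integral>\<omega>. (eta_adaptive (2 * C1) sl (precision S) (design n p (fst \<omega>)) (response n p b \<omega>)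
              - explained_variation S b \<sigma>)\<^sup>2 \<partial>model_law n p S \<sigma>)
       \<le> C * (1 / real n
              + min ((real k)\<^sup>2 * (ln (real p))\<^sup>2 / (real n)\<^sup>2
                       * ((lambda_max S)\<^sup>2 / (lambda_min S)\<^sup>2))
                    (real p * ln (real p) / (real n)\<^sup>2))"
proof -
  \<comment> \<open>Both constants are spelled out in \<open>C1\<close> and \<open>C2\<close>, since
    they have to be fixed before the parameters of the model on which the locale depends.\<close>
  define KD where "KD = C2 + 9 * C1\<^sup>2 + 823543"
  define KL where "KL = C2 + 16426 + 512 * 1297920\<^sup>2 + 100000\<^sup>2 + (823543 / (4 * C1\<^sup>2)) ^ 3"
  have C: "0 < C1" "0 < C2" using assms by (simp_all add: deviation_constants_def)
  have KD: "0 < KD" using C by (simp add: KD_def add_pos_nonneg)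
  have KL: "0 < KL" using C by (simp add: KL_def add_pos_nonneg)
  show ?thesis
  proof (intro exI[of _ "KD + KL"] conjI allI impI)
    show "0 < KD + KL" using KD KL by simp
    fix n p k :: nat and S :: "real mat" and sl :: "real mat \<Rightarrow> real vec \<Rightarrow> real vec" and b :: "real vec" and \<sigma> :: real
    assume h: "1 \<le> n" "n \<le> p" "covariance_matrix p S" "invertible_mat S" "sqrt_lasso_estimator n p sl"
      "k \<in> {1..p}" "b \<in> carrier_vec p" "k_sparse k b" "0 < \<sigma>"
    have S: "S \<in> carrier_mat p p" "transpose_mat S = S" using h(3) by (auto simp: covariance_matrix_def)
    obtain L where L: "cholesky p S L"
      using cholesky_exists[OF S covariance_pos_def[OF h(3) invertible_det[OF S(1) h(4)]]] by blast
    interpret adaptive_setting n p S \<sigma> L C1 C2 sl k b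
      by unfold_locales (use L h assms in auto)
    have "(\<integral>\<omega>. err \<omega> \<partial>\<mu>) \<le> (KD + KL) * (1 / real n + min sparse_rate dense_rate)"
    proof (cases "sparse_rate \<le> dense_rate")
      case True
      have "(\<integral>\<omega>. err \<omega> \<partial>\<mu>) \<le> KL * (1 / real n + sparse_rate)"
        using sparse_risk by (simp add: KL_def sparse_const_def)
      also have "\<dots> \<le> (KD + KL) * (1 / real n + sparse_rate)"
        using KD rates_nonneg by (intro mult_right_mono) auto
      finally show ?thesis using True by (simp add: min_absorb1)
    next
      case False
      have "(\<integral>\<omega>. err \<omega> \<partial>\<mu>) \<le> KD * (1 / real n + dense_rate)"
        using dense_risk by (simp add: KD_def)
      also have "\<dots> \<le> (KD + KL) * (1 / real n + dense_rate)"
        using KL rates_nonneg by (intro mult_right_mono) auto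
      finally show ?thesis using False by (simp add: min_absorb2)
    qed
    then show "(\<integral>\<omega>. (eta_adaptive (2 * C1) sl (precision S) (design n p (fst \<omega>)) (response n p b \<omega>)
              - explained_variation S b \<sigma>)\<^sup>2 \<partial>model_law n p S \<sigma>)
       \<le> (KD + KL) * (1 / real n
              + min ((real k)\<^sup>2 * (ln (real p))\<^sup>2 / (real n)\<^sup>2
                       * ((lambda_max S)\<^sup>2 / (lambda_min S)\<^sup>2))
                    (real p * ln (real p) / (real n)\<^sup>2))"
      by (simp add: sparse_rate_def dense_rate_def)
  qed
qed

end
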